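(* The category $HAlg_k$ of Hopf algebroids over $k$ is enriched over the symmetric monoidal category $CoCoalg_k$ of cocommutative $k$-coalgebras, with hom-object from $\mathcal U$ to $\mathcal U'$ given by the universal cocommutative measuring coalgebra $\mathcal M_c(\mathcal U,\mathcal U')$.
   Context: $k$ is a field; $Vect_k(V,W)$ denotes the space of $k$-linear maps. Sweedler notation is used with summation suppressed. Left bialgebroid $(U,A_L,s_L,t_L,\Delta_L,\epsilon_L)$ over $k$ (write $A=A_L$): unital $k$-algebras $U,A$; $k$-algebra morphisms $s_L:A\to U$, $t_L:A^{op}\to U$ with commuting images; $U$ is an $(A,A)$-bimodule via $a\cdot u\cdot b=s_L(a)t_L(b)u$ and $U\otimes_{A_L}U$ is formed with this structure (so $t_L(a)u\otimes v=u\otimes s_L(a)v$); $(U,\Delta_L:U\to U\otimes_{A_L}U,\epsilon_L:U\to A_L)$ is a coalgebra in $(A,A)$-bimodules such that $\Delta_L$ takes values in $U\times_{A_L}U:=\{\sum u_i\otimes u_i' : \sum u_it_L(a)\otimes u'_i=\sum u_i\otimes u_i's_L(a)\ \forall a\in A\}$ (an algebra under factorwise multiplication), $\Delta_L:U\to U\times_{A_L}U$ is a unital algebra morphism, and $\epsilon_L(us_L(\epsilon_L(u')))=\epsilon_L(uu')=\epsilon_L(ut_L(\epsilon_L(u')))$. Hopf algebroid $\mathcal U=(U,A_L,s_L,t_L,\Delta_L,\epsilon_L,S)$: a left bialgebroid with an involutive ($S^2=\mathrm{id}$) anti-automorphism $S$ of the $k$-algebra $U$ with $S\circ t_L=s_L$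 and, in $U\otimes_{A_L}U$ for all $u\in U$, $S(u_{(1)})_{(1)}u_{(2)}\otimes S(u_{(1)})_{(2)}=1_U\otimes S(u)$ and $S(u_{(2)})_{(1)}\otimes S(u_{(2)})_{(2)}u_{(1)}=S(u)\otimes 1_U$. A morphism $(F,f):\mathcal U\to\mathcal U'$ in $HAlg_k$ is a pair of unital algebra morphisms $F:U\to U'$, $f:A_L\to A_L'$ with $Fs_L=s_L'f$, $Ft_L=t_L'f$, $\Delta_L'F=(F\otimes_fF)\Delta_L$, $f\epsilon_L=\epsilon_L'F$, $S'F=FS$. Measuring of algebras: for $k$-algebras $R,R'$ and a $k$-coalgebra $C$ with counit $\epsilon_C$, a linear map $\psi:C\to Vect_k(R,R')$ with $\psi(x)(ab)=\psi(x_{(1)})(a)\psi(x_{(2)})(b)$ and $\psi(x)(1_R)=\epsilon_C(x)1_{R'}$. Measuring of Hopf algebroids from $\mathcal U$ to $\mathcal U'$ by a cocommutative $k$-coalgebra $C$: a pair of algebra measurings $\Psi:C\to Vect_k(U,U')$, $\psi:C\to Vect_k(A_L,A'_L)$ such that for all $x\in C$: $\Psi(x)s_L=s_L'\psi(x)$, $\Psi(x)t_L=t'_L\psi(x)$, $\Psi(x)S=S'\Psi(x)$, $\psi(x)\epsilon_L=\epsilon_L'\Psi(x)$, and $\Delta'_L(\Psi(x)(u))=\Psi(x_{(1)})(u_{(1)})\otimes\Psi(x_{(2)})(u_{(2)})$ in $U'\otimes_{A'_L}U'$ for all $u\in U$. The map $(\Psi,\psi)$ takes values in $V(\mathcal U,\mathcal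 U'):=\{(F,f)\in Vect_k(U,U')\times Vect_k(A_L,A_L'): Fs_L=s_L'f,\ Ft_L=t_L'f,\ FS=S'F,\ f\epsilon_L=\epsilon_L'F\}$. $\mathcal M_c(\mathcal U,\mathcal U')$, with its measuring $(\Phi,\phi):\mathcal M_c(\mathcal U,\mathcal U')\to V(\mathcal U,\mathcal U')$, is the universal cocommutative measuring: every measuring $(\Psi,\psi):C\to V(\mathcal U,\mathcal U')$ with $C$ cocommutative factors as $(\Phi,\phi)\circ\xi$ for a unique coalgebra morphism $\xi:C\to\mathcal M_c(\mathcal U,\mathcal U')$. Composition $\mathcal M_c(\mathcal U,\mathcal U')\otimes\mathcal M_c(\mathcal U',\mathcal U'')\to\mathcal M_c(\mathcal U,\mathcal U'')$ is the coalgebra map induced by the measuring $x\otimes x'\mapsto(\Phi'(x')\circ\Phi(x),\phi'(x')\circ\phi(x))$, and the unit $k\to\mathcal M_c(\mathcal U,\mathcal U)$ is induced by the measuring $\lambda\mapsto(\lambda\,\mathrm{id}_U,\lambda\,\mathrm{id}_{A_L})$. *)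

theory Defs
  imports "HOL-Algebra.Free_Abelian_Groups" "HOL-Algebra.Module"
begin

section \<open>Linear maps and algebras\<close>

text \<open>Linear maps are extensional (\<open>undefined\<close> outside the carrier of the source), so that
  equality of linear maps is equality of HOL functions.\<close>

definition linear_maps ::
  "'k ring \<Rightarrow> ('k, 'v, 'x) module_scheme \<Rightarrow> ('k, 'w, 'y) module_scheme \<Rightarrow> ('v \<Rightarrow> 'w) set" where
  "linear_maps K V W = {f \<in> carrier V \<rightarrow>\<^sub>E carrier W.
     (\<forall>x\<in>carrier V. \<forall>y\<in>carrier V. f (x \<oplus>\<^bsub>V\<^esub> y) = f x \<oplus>\<^bsub>W\<^esub> f y) \<and>
     (\<forall>c\<in>carrier K. \<forall>x\<in>carrier V. f (c \<odot>\<^bsub>V\<^esub> x) = c \<odot>\<^bsub>W\<^esub> f x)}"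

text \<open>The record type \<^typ>\<open>('k, 'v) module\<close> extends \<^typ>\<open>'v ring\<close>. For objects that are only
  vector spaces (not algebras) the ring fields \<open>mult\<close> and \<open>one\<close> are never used
  and are set to \<open>undefined\<close>.\<close>

definition Vect ::
  "'k ring \<Rightarrow> ('k, 'v, 'x) module_scheme \<Rightarrow> ('k, 'w, 'y) module_scheme \<Rightarrow> ('k, 'v \<Rightarrow> 'w) module" where
  "Vect K V W = \<lparr>carrier = linear_maps K V W, monoid.mult = undefined, one = undefined,
     ring.zero = (\<lambda>x\<in>carrier V. \<zero>\<^bsub>W\<^esub>),
     ring.add = (\<lambda>f g. \<lambda>x\<in>carrier V. f x \<oplus>\<^bsub>W\<^esub> g x),
     smult = (\<lambda>c f. \<lambda>x\<in>carrier V. c \<odot>\<^bsub>W\<^esub> f x)\<rparr>"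

definition k_algebra :: "'k ring \<Rightarrow> ('k, 'r, 'x) module_scheme \<Rightarrow> bool" where
  "k_algebra K R \<longleftrightarrow> ring R \<and> module K R \<and>
     (\<forall>c\<in>carrier K. \<forall>x\<in>carrier R. \<forall>y\<in>carrier R.
        c \<odot>\<^bsub>R\<^esub> (x \<otimes>\<^bsub>R\<^esub> y) = (c \<odot>\<^bsub>R\<^esub> x) \<otimes>\<^bsub>R\<^esub> y \<and>
        c \<odot>\<^bsub>R\<^esub> (x \<otimes>\<^bsub>R\<^esub> y) = x \<otimes>\<^bsub>R\<^esub> (c \<odot>\<^bsub>R\<^esub> y))"

definition op_alg :: "('k, 'r) module \<Rightarrow> ('k, 'r) module" where
  "op_alg R = R\<lparr>monoid.mult := (\<lambda>x y. y \<otimes>\<^bsub>R\<^esub> x)\<rparr>"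

definition alg_hom ::
  "'k ring \<Rightarrow> ('k, 'r, 'x) module_scheme \<Rightarrow> ('k, 's, 'y) module_scheme \<Rightarrow> ('r \<Rightarrow> 's) set" where
  "alg_hom K R S = linear_maps K R S \<inter> ring_hom R S"

definition ground :: "'k ring \<Rightarrow> ('k, 'k) module" where
  "ground K = \<lparr>carrier = carrier K, monoid.mult = monoid.mult K, one = one K,
     ring.zero = ring.zero K, ring.add = ring.add K, smult = monoid.mult K\<rparr>"


section \<open>Tensor products\<close>

text \<open>Elements of tensor products are cosets of formal integer combinations of pairs.\<close>

type_synonym ('m, 'n) tensor = "(('m \<times> 'n) \<Rightarrow>\<^sub>0 int) set"

text \<open>The balanced tensor product of abelian groups \<open>M\<close> and \<open>N\<close>: additive in both arguments,
  and \<open>r a m \<otimes> n = m \<otimes> l a n\<close> for \<open>a \<in> A\<close>, where \<open>r\<close> is a right action of \<open>A\<close> on \<open>M\<close> and \<open>l\<close> a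
  left action on \<open>N\<close>.\<close>

definition tensor_relators ::
  "('k, 'm, 'x) module_scheme \<Rightarrow> ('k, 'n, 'y) module_scheme \<Rightarrow> 'a set \<Rightarrow>
   ('a \<Rightarrow> 'm \<Rightarrow> 'm) \<Rightarrow> ('a \<Rightarrow> 'n \<Rightarrow> 'n) \<Rightarrow> (('m \<times> 'n) \<Rightarrow>\<^sub>0 int) set" where
  "tensor_relators M N A r l =
     {frag_of (m \<oplus>\<^bsub>M\<^esub> m', n) - frag_of (m, n) - frag_of (m', n) | m m' n.
        m \<in> carrier M \<and> m' \<in> carrier M \<and> n \<in> carrier N} \<union>
     {frag_of (m, n \<oplus>\<^bsub>N\<^esub> n') - frag_of (m, n) - frag_of (m, n') | m n n'.
        m \<in> carrier M \<and> n \<in> carrier N \<and> n' \<in> carrier N} \<union>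
     {frag_of (r a m, n) - frag_of (m, l a n) | a m n.
        a \<in> A \<and> m \<in> carrier M \<and> n \<in> carrier N}"

definition tensor_group ::
  "('k, 'm, 'x) module_scheme \<Rightarrow> ('k, 'n, 'y) module_scheme \<Rightarrow> 'a set \<Rightarrow>
   ('a \<Rightarrow> 'm \<Rightarrow> 'm) \<Rightarrow> ('a \<Rightarrow> 'n \<Rightarrow> 'n) \<Rightarrow> ('m, 'n) tensor monoid" where
  "tensor_group M N A r l =
     (let F = free_Abelian_group (carrier M \<times> carrier N)
      in F Mod generate F (tensor_relators M N A r l))"

text \<open>Additive extension of \<open>\<beta>\<close> to a tensor \<open>t\<close>, evaluated at an arbitrary representative of the
  coset \<open>t\<close>; the value does not depend on the representative when \<open>\<beta>\<close> is biadditive and balanced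
  (and takes values in the commutative group \<open>G\<close>).\<close>

definition tensor_lift ::
  "('p, 'z) monoid_scheme \<Rightarrow> ('m, 'n) tensor \<Rightarrow> ('m \<Rightarrow> 'n \<Rightarrow> 'p) \<Rightarrow> 'p" where
  "tensor_lift G t \<beta> =
     (let f = (SOME f. f \<in> t)
      in finprod G (\<lambda>(m, n). \<beta> m n [^]\<^bsub>G\<^esub> Poly_Mapping.lookup f (m, n)) (Poly_Mapping.keys f))"

text \<open>Sweedler-style sum: \<open>tsum P t (\<lambda>m n. \<beta> m n)\<close> is \<open>\<Sum> \<beta> m\<^sub>i n\<^sub>i \<in> P\<close> for \<open>t = \<Sum> m\<^sub>i \<otimes> n\<^sub>i\<close>.\<close>

definition tsum :: "('p, 'z) ring_scheme \<Rightarrow> ('m, 'n) tensor \<Rightarrow> ('m \<Rightarrow> 'n \<Rightarrow> 'p) \<Rightarrow> 'p" where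
  "tsum P t \<beta> = tensor_lift (add_monoid P) t \<beta>"

definition balanced_tensor ::
  "('k, 'm, 'x) module_scheme \<Rightarrow> ('k, 'n, 'y) module_scheme \<Rightarrow> 'a set \<Rightarrow>
   ('a \<Rightarrow> 'm \<Rightarrow> 'm) \<Rightarrow> ('a \<Rightarrow> 'n \<Rightarrow> 'n) \<Rightarrow> ('k, ('m, 'n) tensor) module" where
  "balanced_tensor M N A r l =
     (let F = free_Abelian_group (carrier M \<times> carrier N); T = tensor_group M N A r l
      in \<lparr>carrier = carrier T, monoid.mult = undefined, one = undefined,
          ring.zero = monoid.one T, ring.add = monoid.mult T,
          smult = (\<lambda>c t. tensor_lift T t
             (\<lambda>m n. monoid.one T #>\<^bsub>F\<^esub> frag_of (c \<odot>\<^bsub>M\<^esub> m, n)))\<rparr>)"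

text \<open>The zero of a tensor product is the subgroup of relations, so its translate by
  \<open>frag_of (m, n)\<close> is the coset of the formal sum \<open>(m, n)\<close>.\<close>

definition pure_tensor ::
  "('k, ('m, 'n) tensor, 'z) module_scheme \<Rightarrow> 'm \<Rightarrow> 'n \<Rightarrow> ('m, 'n) tensor"
  (\<open>(_ \<boxtimes>\<index> _)\<close> [71, 71] 70) where
  "m \<boxtimes>\<^bsub>T\<^esub> n = (\<lambda>h. h + frag_of (m, n)) ` \<zero>\<^bsub>T\<^esub>"

text \<open>\<open>f \<otimes> g\<close> as a map from the tensor product \<open>T\<close> to the tensor product \<open>T'\<close>.\<close>

definition tensor_map ::
  "('k, ('m, 'n) tensor, 'x) module_scheme \<Rightarrow> ('k, ('p, 'q) tensor, 'y) module_scheme \<Rightarrow>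
   ('m \<Rightarrow> 'p) \<Rightarrow> ('n \<Rightarrow> 'q) \<Rightarrow> ('m, 'n) tensor \<Rightarrow> ('p, 'q) tensor" where
  "tensor_map T T' f g = (\<lambda>t\<in>carrier T. tsum T' t (\<lambda>m n. f m \<boxtimes>\<^bsub>T'\<^esub> g n))"

text \<open>\<open>(x \<otimes> y) \<otimes> z \<mapsto> x \<otimes> (y \<otimes> z)\<close>, where \<open>R = X \<otimes> I\<close> and \<open>I = Y \<otimes> Z\<close>.\<close>

definition tensor_assoc ::
  "('k, ('m, ('n, 'p) tensor) tensor, 'x) module_scheme \<Rightarrow> ('k, ('n, 'p) tensor, 'y) module_scheme \<Rightarrow>
   (('m, 'n) tensor, 'p) tensor \<Rightarrow> ('m, ('n, 'p) tensor) tensor" where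
  "tensor_assoc R I t = tsum R t (\<lambda>w z. tsum R w (\<lambda>x y. x \<boxtimes>\<^bsub>R\<^esub> (y \<boxtimes>\<^bsub>I\<^esub> z)))"

text \<open>The tensor product over the ground field.\<close>

definition ktensor ::
  "'k ring \<Rightarrow> ('k, 'm, 'x) module_scheme \<Rightarrow> ('k, 'n, 'y) module_scheme \<Rightarrow>
   ('k, ('m, 'n) tensor) module" where
  "ktensor K M N = balanced_tensor M N (carrier K) (smult M) (smult N)"


section \<open>The symmetric monoidal category of cocommutative coalgebras\<close>

record ('k, 'c) coalgebra = "('k, 'c) module" +
  comult :: "'c \<Rightarrow> ('c, 'c) tensor"
  counit :: "'c \<Rightarrow> 'k"

definition coalgebra :: "'k ring \<Rightarrow> ('k, 'c) coalgebra \<Rightarrow> bool" where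
  "coalgebra K C \<longleftrightarrow>
     (let CC = ktensor K C C; L = ktensor K CC C; R = ktensor K C CC in
      module K C \<and>
      comult C \<in> linear_maps K C CC \<and>
      counit C \<in> linear_maps K C (ground K) \<and>
      (\<forall>x\<in>carrier C.
         tensor_assoc R CC (tsum L (comult C x) (\<lambda>x\<^sub>1 x\<^sub>2. comult C x\<^sub>1 \<boxtimes>\<^bsub>L\<^esub> x\<^sub>2))
           = tsum R (comult C x) (\<lambda>x\<^sub>1 x\<^sub>2. x\<^sub>1 \<boxtimes>\<^bsub>R\<^esub> comult C x\<^sub>2)) \<and>
      (\<forall>x\<in>carrier C.
         tsum C (comult C x) (\<lambda>x\<^sub>1 x\<^sub>2. counit C x\<^sub>1 \<odot>\<^bsub>C\<^esub> x\<^sub>2) = x \<and>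
         tsum C (comult C x) (\<lambda>x\<^sub>1 x\<^sub>2. counit C x\<^sub>2 \<odot>\<^bsub>C\<^esub> x\<^sub>1) = x))"

definition cocoalgebra :: "'k ring \<Rightarrow> ('k, 'c) coalgebra \<Rightarrow> bool" where
  "cocoalgebra K C \<longleftrightarrow> coalgebra K C \<and>
     (\<forall>x\<in>carrier C.
        tsum (ktensor K C C) (comult C x) (\<lambda>x\<^sub>1 x\<^sub>2. x\<^sub>2 \<boxtimes>\<^bsub>ktensor K C C\<^esub> x\<^sub>1) = comult C x)"

text \<open>The morphisms of the category of cocommutative coalgebras; the set is empty unless source
  and target are objects of that category.\<close>

definition cocoalg_hom ::
  "'k ring \<Rightarrow> ('k, 'c) coalgebra \<Rightarrow> ('k, 'd) coalgebra \<Rightarrow> ('c \<Rightarrow> 'd) set" where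
  "cocoalg_hom K C D = {\<xi> \<in> linear_maps K C D. cocoalgebra K C \<and> cocoalgebra K D \<and>
     (\<forall>x\<in>carrier C. comult D (\<xi> x) = tensor_map (ktensor K C C) (ktensor K D D) \<xi> \<xi> (comult C x)) \<and>
     (\<forall>x\<in>carrier C. counit D (\<xi> x) = counit C x)}"

definition unit_coalg :: "'k ring \<Rightarrow> ('k, 'k) coalgebra" where
  "unit_coalg K = module.extend (ground K) (coalgebra.fields
     (\<lambda>c\<in>carrier K. c \<boxtimes>\<^bsub>ktensor K (ground K) (ground K)\<^esub> \<one>\<^bsub>K\<^esub>)
     (\<lambda>c\<in>carrier K. c))"

definition tensor_coalg ::
  "'k ring \<Rightarrow> ('k, 'c) coalgebra \<Rightarrow> ('k, 'd) coalgebra \<Rightarrow> ('k, ('c, 'd) tensor) coalgebra" where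
  "tensor_coalg K C D =
     (let T = ktensor K C D; TT = ktensor K T T in
      module.extend T (coalgebra.fields
        (\<lambda>t\<in>carrier T. tsum TT t (\<lambda>x y.
           tsum TT (comult C x) (\<lambda>x\<^sub>1 x\<^sub>2.
             tsum TT (comult D y) (\<lambda>y\<^sub>1 y\<^sub>2. (x\<^sub>1 \<boxtimes>\<^bsub>T\<^esub> y\<^sub>1) \<boxtimes>\<^bsub>TT\<^esub> (x\<^sub>2 \<boxtimes>\<^bsub>T\<^esub> y\<^sub>2)))))
        (\<lambda>t\<in>carrier T. tsum (ground K) t (\<lambda>x y. counit C x \<otimes>\<^bsub>K\<^esub> counit D y))))"


section \<open>Enrichment in cocommutative coalgebras\<close>

text \<open>Composition is written diagrammatically: \<open>ecomp X Y Z : Hom X Y \<otimes> Hom Y Z \<rightarrow> Hom X Z\<close>.\<close>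

definition cocoalg_enriched_category ::
  "'k ring \<Rightarrow> 'o set \<Rightarrow> ('o \<Rightarrow> 'o \<Rightarrow> ('k, 'm) coalgebra) \<Rightarrow>
   ('o \<Rightarrow> 'o \<Rightarrow> 'o \<Rightarrow> ('m, 'm) tensor \<Rightarrow> 'm) \<Rightarrow> ('o \<Rightarrow> 'k \<Rightarrow> 'm) \<Rightarrow> bool" where
  "cocoalg_enriched_category K Ob Hom ecomp eunit \<longleftrightarrow>
     (\<forall>X\<in>Ob. \<forall>Y\<in>Ob. cocoalgebra K (Hom X Y)) \<and>
     (\<forall>X\<in>Ob. \<forall>Y\<in>Ob. \<forall>Z\<in>Ob.
        ecomp X Y Z \<in> cocoalg_hom K (tensor_coalg K (Hom X Y) (Hom Y Z)) (Hom X Z)) \<and>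
     (\<forall>X\<in>Ob. eunit X \<in> cocoalg_hom K (unit_coalg K) (Hom X X)) \<and>
     (\<forall>W\<in>Ob. \<forall>X\<in>Ob. \<forall>Y\<in>Ob. \<forall>Z\<in>Ob.
        let WXY = ktensor K (Hom W X) (Hom X Y);
            XYZ = ktensor K (Hom X Y) (Hom Y Z);
            L = ktensor K WXY (Hom Y Z);
            R = ktensor K (Hom W X) XYZ
        in \<forall>t\<in>carrier L.
             ecomp W Y Z (tensor_map L (ktensor K (Hom W Y) (Hom Y Z)) (ecomp W X Y) id t) =
             ecomp W X Z (tensor_map R (ktensor K (Hom W X) (Hom X Z)) id (ecomp X Y Z)
               (tensor_assoc R XYZ t))) \<and>
     (\<forall>X\<in>Ob. \<forall>Y\<in>Ob.
        let L = ktensor K (ground K) (Hom X Y); R = ktensor K (Hom X Y) (ground K) in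
        (\<forall>t\<in>carrier L.
           ecomp X X Y (tensor_map L (ktensor K (Hom X X) (Hom X Y)) (eunit X) id t) =
           tsum (Hom X Y) t (\<lambda>c x. c \<odot>\<^bsub>Hom X Y\<^esub> x)) \<and>
        (\<forall>t\<in>carrier R.
           ecomp X Y Y (tensor_map R (ktensor K (Hom X Y) (Hom Y Y)) id (eunit Y) t) =
           tsum (Hom X Y) t (\<lambda>x c. c \<odot>\<^bsub>Hom X Y\<^esub> x)))"

definition category ::
  "'o set \<Rightarrow> ('o \<Rightarrow> 'o \<Rightarrow> 'f set) \<Rightarrow> ('o \<Rightarrow> 'o \<Rightarrow> 'o \<Rightarrow> 'f \<Rightarrow> 'f \<Rightarrow> 'f) \<Rightarrow> ('o \<Rightarrow> 'f) \<Rightarrow> bool" where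
  "category Ob mor cmp idn \<longleftrightarrow>
     (\<forall>X\<in>Ob. idn X \<in> mor X X) \<and>
     (\<forall>X\<in>Ob. \<forall>Y\<in>Ob. \<forall>Z\<in>Ob. \<forall>f\<in>mor X Y. \<forall>g\<in>mor Y Z. cmp X Y Z f g \<in> mor X Z) \<and>
     (\<forall>X\<in>Ob. \<forall>Y\<in>Ob. \<forall>f\<in>mor X Y. cmp X X Y (idn X) f = f \<and> cmp X Y Y f (idn Y) = f) \<and>
     (\<forall>W\<in>Ob. \<forall>X\<in>Ob. \<forall>Y\<in>Ob. \<forall>Z\<in>Ob. \<forall>f\<in>mor W X. \<forall>g\<in>mor X Y. \<forall>h\<in>mor Y Z.
        cmp W Y Z (cmp W X Y f g) h = cmp W X Z f (cmp X Y Z g h))"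

text \<open>An ordinary category is enriched by \<open>(Hom, ecomp, eunit)\<close> if these form an enriched category on
  the same objects and \<open>J\<close> is an isomorphism, identical on objects, from the given category to the
  underlying category of the enriched one, whose morphisms \<open>X \<rightarrow> Y\<close> are the coalgebra maps
  \<open>k \<rightarrow> Hom X Y\<close>, composed by \<open>k \<cong> k \<otimes> k \<rightarrow> Hom X Y \<otimes> Hom Y Z \<rightarrow> Hom X Z\<close>.\<close>

definition enriches_category ::
  "'k ring \<Rightarrow> 'o set \<Rightarrow> ('o \<Rightarrow> 'o \<Rightarrow> 'f set) \<Rightarrow> ('o \<Rightarrow> 'o \<Rightarrow> 'o \<Rightarrow> 'f \<Rightarrow> 'f \<Rightarrow> 'f) \<Rightarrow> ('o \<Rightarrow> 'f) \<Rightarrow>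
   ('o \<Rightarrow> 'o \<Rightarrow> ('k, 'm) coalgebra) \<Rightarrow>
   ('o \<Rightarrow> 'o \<Rightarrow> 'o \<Rightarrow> ('m, 'm) tensor \<Rightarrow> 'm) \<Rightarrow> ('o \<Rightarrow> 'k \<Rightarrow> 'm) \<Rightarrow>
   ('o \<Rightarrow> 'o \<Rightarrow> 'f \<Rightarrow> 'k \<Rightarrow> 'm) \<Rightarrow> bool" where
  "enriches_category K Ob mor cmp idn Hom ecomp eunit J \<longleftrightarrow>
     category Ob mor cmp idn \<and>
     cocoalg_enriched_category K Ob Hom ecomp eunit \<and>
     (\<forall>X\<in>Ob. \<forall>Y\<in>Ob. bij_betw (J X Y) (mor X Y) (cocoalg_hom K (unit_coalg K) (Hom X Y))) \<and>
     (\<forall>X\<in>Ob. J X X (idn X) = eunit X) \<and>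
     (\<forall>X\<in>Ob. \<forall>Y\<in>Ob. \<forall>Z\<in>Ob. \<forall>f\<in>mor X Y. \<forall>g\<in>mor Y Z. \<forall>c\<in>carrier K.
        let kk = ktensor K (ground K) (ground K) in
        J X Z (cmp X Y Z f g) c =
        ecomp X Y Z (tensor_map kk (ktensor K (Hom X Y) (Hom Y Z)) (J X Y f) (J Y Z g)
          (c \<boxtimes>\<^bsub>kk\<^esub> \<one>\<^bsub>K\<^esub>)))"


section \<open>Hopf algebroids\<close>

record ('k, 'u, 'a) left_bialgebroid =
  total_alg :: "('k, 'u) module"
  base_alg :: "('k, 'a) module"
  src :: "'a \<Rightarrow> 'u"
  tgt :: "'a \<Rightarrow> 'u"
  coproduct :: "'u \<Rightarrow> ('u, 'u) tensor"
  augmentation :: "'u \<Rightarrow> 'a"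

record ('k, 'u, 'a) hopf_algebroid = "('k, 'u, 'a) left_bialgebroid" +
  antipode :: "'u \<Rightarrow> 'u"

text \<open>\<open>U \<otimes>\<^sub>A U\<close> for the bimodule structure \<open>a \<cdot> u \<cdot> b = s(a) t(b) u\<close>, and the two bracketings of the
  triple tensor product; the bimodule structure of \<open>U \<otimes>\<^sub>A U\<close> is
  \<open>a \<cdot> (u \<otimes> v) \<cdot> b = s(a) u \<otimes> t(b) v\<close>.\<close>

definition atensor ::
  "('k, 'u, 'a, 'z) left_bialgebroid_scheme \<Rightarrow> ('k, ('u, 'u) tensor) module" where
  "atensor H = (let U = total_alg H in
     balanced_tensor U U (carrier (base_alg H)) (\<lambda>a u. tgt H a \<otimes>\<^bsub>U\<^esub> u) (\<lambda>a u. src H a \<otimes>\<^bsub>U\<^esub> u))"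

definition atensor3_left ::
  "('k, 'u, 'a, 'z) left_bialgebroid_scheme \<Rightarrow> ('k, (('u, 'u) tensor, 'u) tensor) module" where
  "atensor3_left H = (let U = total_alg H; T = atensor H in
     balanced_tensor T U (carrier (base_alg H))
       (\<lambda>a t. tsum T t (\<lambda>u v. u \<boxtimes>\<^bsub>T\<^esub> (tgt H a \<otimes>\<^bsub>U\<^esub> v))) (\<lambda>a u. src H a \<otimes>\<^bsub>U\<^esub> u))"

definition atensor3_right ::
  "('k, 'u, 'a, 'z) left_bialgebroid_scheme \<Rightarrow> ('k, ('u, ('u, 'u) tensor) tensor) module" where
  "atensor3_right H = (let U = total_alg H; T = atensor H in
     balanced_tensor U T (carrier (base_alg H))
       (\<lambda>a u. tgt H a \<otimes>\<^bsub>U\<^esub> u) (\<lambda>a t. tsum T t (\<lambda>u v. (src H a \<otimes>\<^bsub>U\<^esub> u) \<boxtimes>\<^bsub>T\<^esub> v)))"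

text \<open>The subspace \<open>U \<times>\<^sub>A U\<close> and its factorwise product. In the product the sum over the second
  factor is taken outermost: right multiplication by \<open>v \<otimes> v'\<close> is well defined on all of
  \<open>U \<otimes>\<^sub>A U\<close>, whereas left multiplication by a single \<open>u \<otimes> u'\<close> is not.\<close>

definition takeuchi :: "('k, 'u, 'a, 'z) left_bialgebroid_scheme \<Rightarrow> ('u, 'u) tensor set" where
  "takeuchi H = (let U = total_alg H; T = atensor H in
     {z \<in> carrier T. \<forall>a\<in>carrier (base_alg H).
        tsum T z (\<lambda>u u'. (u \<otimes>\<^bsub>U\<^esub> tgt H a) \<boxtimes>\<^bsub>T\<^esub> u') = tsum T z (\<lambda>u u'. u \<boxtimes>\<^bsub>T\<^esub> (u' \<otimes>\<^bsub>U\<^esub> src H a))})"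

definition takeuchi_mult ::
  "('k, 'u, 'a, 'z) left_bialgebroid_scheme \<Rightarrow> ('u, 'u) tensor \<Rightarrow> ('u, 'u) tensor \<Rightarrow> ('u, 'u) tensor" where
  "takeuchi_mult H y z = (let U = total_alg H; T = atensor H in
     tsum T z (\<lambda>v v'. tsum T y (\<lambda>u u'. (u \<otimes>\<^bsub>U\<^esub> v) \<boxtimes>\<^bsub>T\<^esub> (u' \<otimes>\<^bsub>U\<^esub> v'))))"

definition left_bialgebroid ::
  "'k ring \<Rightarrow> ('k, 'u, 'a, 'z) left_bialgebroid_scheme \<Rightarrow> bool" where
  "left_bialgebroid K H \<longleftrightarrow>
     (let U = total_alg H; A = base_alg H; s = src H; t = tgt H; \<Delta> = coproduct H; \<epsilon> = augmentation H;
          T = atensor H; L = atensor3_left H; R = atensor3_right H in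
      k_algebra K U \<and> k_algebra K A \<and>
      s \<in> alg_hom K A U \<and> t \<in> alg_hom K (op_alg A) U \<and>
      (\<forall>a\<in>carrier A. \<forall>b\<in>carrier A. s a \<otimes>\<^bsub>U\<^esub> t b = t b \<otimes>\<^bsub>U\<^esub> s a) \<and>
      \<comment> \<open>\<open>(U, \<Delta>, \<epsilon>)\<close> is a coalgebra in bimodules\<close>
      \<Delta> \<in> linear_maps K U T \<and>
      \<epsilon> \<in> linear_maps K U A \<and>
      (\<forall>a\<in>carrier A. \<forall>b\<in>carrier A. \<forall>u\<in>carrier U.
         \<Delta> (s a \<otimes>\<^bsub>U\<^esub> t b \<otimes>\<^bsub>U\<^esub> u) =
           tsum T (\<Delta> u) (\<lambda>u\<^sub>1 u\<^sub>2. (s a \<otimes>\<^bsub>U\<^esub> u\<^sub>1) \<boxtimes>\<^bsub>T\<^esub> (t b \<otimes>\<^bsub>U\<^esub> u\<^sub>2)) \<and>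
         \<epsilon> (s a \<otimes>\<^bsub>U\<^esub> t b \<otimes>\<^bsub>U\<^esub> u) = a \<otimes>\<^bsub>A\<^esub> \<epsilon> u \<otimes>\<^bsub>A\<^esub> b) \<and>
      (\<forall>u\<in>carrier U.
         tensor_assoc R T (tsum L (\<Delta> u) (\<lambda>u\<^sub>1 u\<^sub>2. \<Delta> u\<^sub>1 \<boxtimes>\<^bsub>L\<^esub> u\<^sub>2)) =
           tsum R (\<Delta> u) (\<lambda>u\<^sub>1 u\<^sub>2. u\<^sub>1 \<boxtimes>\<^bsub>R\<^esub> \<Delta> u\<^sub>2)) \<and>
      (\<forall>u\<in>carrier U.
         tsum U (\<Delta> u) (\<lambda>u\<^sub>1 u\<^sub>2. s (\<epsilon> u\<^sub>1) \<otimes>\<^bsub>U\<^esub> u\<^sub>2) = u \<and>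
         tsum U (\<Delta> u) (\<lambda>u\<^sub>1 u\<^sub>2. t (\<epsilon> u\<^sub>2) \<otimes>\<^bsub>U\<^esub> u\<^sub>1) = u) \<and>
      \<comment> \<open>\<open>\<Delta>\<close> is a unital algebra morphism into \<open>U \<times>\<^sub>A U\<close>\<close>
      \<Delta> ` carrier U \<subseteq> takeuchi H \<and>
      (\<forall>u\<in>carrier U. \<forall>v\<in>carrier U. \<Delta> (u \<otimes>\<^bsub>U\<^esub> v) = takeuchi_mult H (\<Delta> u) (\<Delta> v)) \<and>
      \<Delta> \<one>\<^bsub>U\<^esub> = \<one>\<^bsub>U\<^esub> \<boxtimes>\<^bsub>T\<^esub> \<one>\<^bsub>U\<^esub> \<and>
      (\<forall>u\<in>carrier U. \<forall>v\<in>carrier U.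
         \<epsilon> (u \<otimes>\<^bsub>U\<^esub> s (\<epsilon> v)) = \<epsilon> (u \<otimes>\<^bsub>U\<^esub> v) \<and> \<epsilon> (u \<otimes>\<^bsub>U\<^esub> t (\<epsilon> v)) = \<epsilon> (u \<otimes>\<^bsub>U\<^esub> v)))"

definition hopf_algebroid :: "'k ring \<Rightarrow> ('k, 'u, 'a) hopf_algebroid \<Rightarrow> bool" where
  "hopf_algebroid K H \<longleftrightarrow>
     (let U = total_alg H; A = base_alg H; \<Delta> = coproduct H; S = antipode H; T = atensor H in
      left_bialgebroid K H \<and>
      S \<in> alg_hom K (op_alg U) U \<and>
      (\<forall>u\<in>carrier U. S (S u) = u) \<and>
      (\<forall>a\<in>carrier A. S (tgt H a) = src H a) \<and>
      (\<forall>u\<in>carrier U.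
         tsum T (\<Delta> u) (\<lambda>u\<^sub>1 u\<^sub>2. tsum T (\<Delta> (S u\<^sub>1)) (\<lambda>w\<^sub>1 w\<^sub>2. (w\<^sub>1 \<otimes>\<^bsub>U\<^esub> u\<^sub>2) \<boxtimes>\<^bsub>T\<^esub> w\<^sub>2))
           = \<one>\<^bsub>U\<^esub> \<boxtimes>\<^bsub>T\<^esub> S u) \<and>
      (\<forall>u\<in>carrier U.
         tsum T (\<Delta> u) (\<lambda>u\<^sub>1 u\<^sub>2. tsum T (\<Delta> (S u\<^sub>2)) (\<lambda>w\<^sub>1 w\<^sub>2. w\<^sub>1 \<boxtimes>\<^bsub>T\<^esub> (w\<^sub>2 \<otimes>\<^bsub>U\<^esub> u\<^sub>1)))
           = S u \<boxtimes>\<^bsub>T\<^esub> \<one>\<^bsub>U\<^esub>))"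

definition HAlg :: "'k ring \<Rightarrow> ('k, 'u, 'a) hopf_algebroid set" where
  "HAlg K = {H. hopf_algebroid K H}"

text \<open>The space of pairs of linear maps compatible with source, target, antipode and counit.\<close>

definition hopf_V ::
  "'k ring \<Rightarrow> ('k, 'u, 'a) hopf_algebroid \<Rightarrow> ('k, 'v, 'b) hopf_algebroid \<Rightarrow>
   (('u \<Rightarrow> 'v) \<times> ('a \<Rightarrow> 'b)) set" where
  "hopf_V K H H' = {(F, f).
     F \<in> linear_maps K (total_alg H) (total_alg H') \<and> f \<in> linear_maps K (base_alg H) (base_alg H') \<and>
     (\<forall>a\<in>carrier (base_alg H). F (src H a) = src H' (f a)) \<and>
     (\<forall>a\<in>carrier (base_alg H). F (tgt H a) = tgt H' (f a)) \<and>
     (\<forall>u\<in>carrier (total_alg H). F (antipode H u) = antipode H' (F u)) \<and>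
     (\<forall>u\<in>carrier (total_alg H). f (augmentation H u) = augmentation H' (F u))}"

definition halg_hom ::
  "'k ring \<Rightarrow> ('k, 'u, 'a) hopf_algebroid \<Rightarrow> ('k, 'v, 'b) hopf_algebroid \<Rightarrow>
   (('u \<Rightarrow> 'v) \<times> ('a \<Rightarrow> 'b)) set" where
  "halg_hom K H H' = {(F, f) \<in> hopf_V K H H'.
     F \<in> alg_hom K (total_alg H) (total_alg H') \<and> f \<in> alg_hom K (base_alg H) (base_alg H') \<and>
     (\<forall>u\<in>carrier (total_alg H).
        coproduct H' (F u) = tensor_map (atensor H) (atensor H') F F (coproduct H u))}"

definition halg_comp ::
  "('k, 'u, 'a) hopf_algebroid \<Rightarrow> ('k, 'v, 'b) hopf_algebroid \<Rightarrow> ('k, 'w, 'c) hopf_algebroid \<Rightarrow>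
   ('u \<Rightarrow> 'v) \<times> ('a \<Rightarrow> 'b) \<Rightarrow> ('v \<Rightarrow> 'w) \<times> ('b \<Rightarrow> 'c) \<Rightarrow> ('u \<Rightarrow> 'w) \<times> ('a \<Rightarrow> 'c)" where
  "halg_comp H H' H'' p q =
     (compose (carrier (total_alg H)) (fst q) (fst p), compose (carrier (base_alg H)) (snd q) (snd p))"

definition halg_id :: "('k, 'u, 'a) hopf_algebroid \<Rightarrow> ('u \<Rightarrow> 'u) \<times> ('a \<Rightarrow> 'a)" where
  "halg_id H = ((\<lambda>u\<in>carrier (total_alg H). u), (\<lambda>a\<in>carrier (base_alg H). a))"


section \<open>Measurings\<close>

definition alg_measuring ::
  "'k ring \<Rightarrow> ('k, 'c) coalgebra \<Rightarrow> ('k, 'r) module \<Rightarrow> ('k, 's) module \<Rightarrow> ('c \<Rightarrow> 'r \<Rightarrow> 's) \<Rightarrow> bool" where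
  "alg_measuring K C R S \<psi> \<longleftrightarrow>
     \<psi> \<in> linear_maps K C (Vect K R S) \<and>
     (\<forall>x\<in>carrier C. \<forall>a\<in>carrier R. \<forall>b\<in>carrier R.
        \<psi> x (a \<otimes>\<^bsub>R\<^esub> b) = tsum S (comult C x) (\<lambda>x\<^sub>1 x\<^sub>2. \<psi> x\<^sub>1 a \<otimes>\<^bsub>S\<^esub> \<psi> x\<^sub>2 b)) \<and>
     (\<forall>x\<in>carrier C. \<psi> x \<one>\<^bsub>R\<^esub> = counit C x \<odot>\<^bsub>S\<^esub> \<one>\<^bsub>S\<^esub>)"

text \<open>In the compatibility with the coproducts the sum over \<open>u\<close> is taken outermost: for a single
  \<open>x\<^sub>1 \<otimes> x\<^sub>2\<close> the map \<open>u\<^sub>1 \<otimes> u\<^sub>2 \<mapsto> \<Psi>(x\<^sub>1)(u\<^sub>1) \<otimes> \<Psi>(x\<^sub>2)(u\<^sub>2)\<close> need not be balanced over the base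
  algebra, but the sum over the coproduct of \<open>x\<close> is, by cocommutativity.\<close>

definition hopf_measuring ::
  "'k ring \<Rightarrow> ('k, 'u, 'a) hopf_algebroid \<Rightarrow> ('k, 'v, 'b) hopf_algebroid \<Rightarrow> ('k, 'c) coalgebra \<Rightarrow>
   ('c \<Rightarrow> 'u \<Rightarrow> 'v) \<Rightarrow> ('c \<Rightarrow> 'a \<Rightarrow> 'b) \<Rightarrow> bool" where
  "hopf_measuring K H H' C \<Psi> \<psi> \<longleftrightarrow>
     cocoalgebra K C \<and>
     alg_measuring K C (total_alg H) (total_alg H') \<Psi> \<and>
     alg_measuring K C (base_alg H) (base_alg H') \<psi> \<and>
     (\<forall>x\<in>carrier C. (\<Psi> x, \<psi> x) \<in> hopf_V K H H') \<and>
     (\<forall>x\<in>carrier C. \<forall>u\<in>carrier (total_alg H).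
        coproduct H' (\<Psi> x u) =
          tsum (atensor H') (coproduct H u) (\<lambda>u\<^sub>1 u\<^sub>2.
            tsum (atensor H') (comult C x) (\<lambda>x\<^sub>1 x\<^sub>2. \<Psi> x\<^sub>1 u\<^sub>1 \<boxtimes>\<^bsub>atensor H'\<^esub> \<Psi> x\<^sub>2 u\<^sub>2)))"

text \<open>Universality of a cocommutative measuring \<open>(\<Phi>, \<phi>) : M \<rightarrow> V(H, H')\<close> with respect to all
  cocommutative coalgebras whose carrier is a subset of the type \<open>'c\<close>. As HOL cannot quantify over
  types inside a formula, the type of the test coalgebras is a parameter; the universal property
  in the usual sense is the conjunction of all its instances.\<close>

definition universal_measuring ::
  "'c itself \<Rightarrow> 'k ring \<Rightarrow> ('k, 'u, 'a) hopf_algebroid \<Rightarrow> ('k, 'v, 'b) hopf_algebroid \<Rightarrow>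
   ('k, 'm) coalgebra \<Rightarrow> ('m \<Rightarrow> 'u \<Rightarrow> 'v) \<Rightarrow> ('m \<Rightarrow> 'a \<Rightarrow> 'b) \<Rightarrow> bool" where
  "universal_measuring _ K H H' M \<Phi> \<phi> \<longleftrightarrow>
     hopf_measuring K H H' M \<Phi> \<phi> \<and>
     (\<forall>(C :: ('k, 'c) coalgebra) \<Psi> \<psi>. hopf_measuring K H H' C \<Psi> \<psi> \<longrightarrow>
        (\<exists>!\<xi>. \<xi> \<in> cocoalg_hom K C M \<and>
              \<Psi> = compose (carrier C) \<Phi> \<xi> \<and> \<psi> = compose (carrier C) \<phi> \<xi>))"

text \<open>The coalgebra map into \<open>(M, \<Phi>, \<phi>)\<close> induced by a measuring \<open>(\<Psi>, \<psi>)\<close> by \<open>C\<close>.\<close>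

definition induced_hom ::
  "'k ring \<Rightarrow> ('k, 'c) coalgebra \<Rightarrow> ('c \<Rightarrow> 'u \<Rightarrow> 'v) \<Rightarrow> ('c \<Rightarrow> 'a \<Rightarrow> 'b) \<Rightarrow>
   ('k, 'm) coalgebra \<Rightarrow> ('m \<Rightarrow> 'u \<Rightarrow> 'v) \<Rightarrow> ('m \<Rightarrow> 'a \<Rightarrow> 'b) \<Rightarrow> 'c \<Rightarrow> 'm" where
  "induced_hom K C \<Psi> \<psi> M \<Phi> \<phi> =
     (THE \<xi>. \<xi> \<in> cocoalg_hom K C M \<and>
             \<Psi> = compose (carrier C) \<Phi> \<xi> \<and> \<psi> = compose (carrier C) \<phi> \<xi>)"

text \<open>\<open>x \<otimes> x' \<mapsto> \<Phi>'(x') \<circ> \<Phi>(x)\<close>\<close>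

definition comp_measuring ::
  "'k ring \<Rightarrow> ('k, 'c) coalgebra \<Rightarrow> ('k, 'd) coalgebra \<Rightarrow>
   ('k, 'r) module \<Rightarrow> ('k, 't) module \<Rightarrow>
   ('c \<Rightarrow> 'r \<Rightarrow> 's) \<Rightarrow> ('d \<Rightarrow> 's \<Rightarrow> 't) \<Rightarrow> ('c, 'd) tensor \<Rightarrow> 'r \<Rightarrow> 't" where
  "comp_measuring K C D R R'' \<Phi> \<Phi>' =
     (\<lambda>z\<in>carrier (ktensor K C D).
        tsum (Vect K R R'') z (\<lambda>x x'. compose (carrier R) (\<Phi>' x') (\<Phi> x)))"

text \<open>\<open>c \<mapsto> c F\<close>\<close>

definition scalar_measuring ::
  "'k ring \<Rightarrow> ('k, 'r) module \<Rightarrow> ('k, 's) module \<Rightarrow> ('r \<Rightarrow> 's) \<Rightarrow> 'k \<Rightarrow> 'r \<Rightarrow> 's" where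
  "scalar_measuring K R S F = (\<lambda>c\<in>carrier K. c \<odot>\<^bsub>Vect K R S\<^esub> F)"

definition Mc_comp ::
  "'k ring \<Rightarrow>
   (('k, 'u, 'a) hopf_algebroid \<Rightarrow> ('k, 'u, 'a) hopf_algebroid \<Rightarrow> ('k, 'm) coalgebra) \<Rightarrow>
   (('k, 'u, 'a) hopf_algebroid \<Rightarrow> ('k, 'u, 'a) hopf_algebroid \<Rightarrow> 'm \<Rightarrow> 'u \<Rightarrow> 'u) \<Rightarrow>
   (('k, 'u, 'a) hopf_algebroid \<Rightarrow> ('k, 'u, 'a) hopf_algebroid \<Rightarrow> 'm \<Rightarrow> 'a \<Rightarrow> 'a) \<Rightarrow>
   ('k, 'u, 'a) hopf_algebroid \<Rightarrow> ('k, 'u, 'a) hopf_algebroid \<Rightarrow> ('k, 'u, 'a) hopf_algebroid \<Rightarrow>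
   ('m, 'm) tensor \<Rightarrow> 'm" where
  "Mc_comp K Mc \<Phi> \<phi> H H' H'' =
     induced_hom K (tensor_coalg K (Mc H H') (Mc H' H''))
       (comp_measuring K (Mc H H') (Mc H' H'') (total_alg H) (total_alg H'') (\<Phi> H H') (\<Phi> H' H''))
       (comp_measuring K (Mc H H') (Mc H' H'') (base_alg H) (base_alg H'') (\<phi> H H') (\<phi> H' H''))
       (Mc H H'') (\<Phi> H H'') (\<phi> H H'')"

text \<open>The coalgebra map \<open>k \<rightarrow> M\<^sub>c(H, H')\<close> induced by the measuring \<open>c \<mapsto> (c F, c f)\<close>.\<close>

definition Mc_point ::
  "'k ring \<Rightarrow>
   (('k, 'u, 'a) hopf_algebroid \<Rightarrow> ('k, 'u, 'a) hopf_algebroid \<Rightarrow> ('k, 'm) coalgebra) \<Rightarrow>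
   (('k, 'u, 'a) hopf_algebroid \<Rightarrow> ('k, 'u, 'a) hopf_algebroid \<Rightarrow> 'm \<Rightarrow> 'u \<Rightarrow> 'u) \<Rightarrow>
   (('k, 'u, 'a) hopf_algebroid \<Rightarrow> ('k, 'u, 'a) hopf_algebroid \<Rightarrow> 'm \<Rightarrow> 'a \<Rightarrow> 'a) \<Rightarrow>
   ('k, 'u, 'a) hopf_algebroid \<Rightarrow> ('k, 'u, 'a) hopf_algebroid \<Rightarrow> ('u \<Rightarrow> 'u) \<times> ('a \<Rightarrow> 'a) \<Rightarrow>
   'k \<Rightarrow> 'm" where
  "Mc_point K Mc \<Phi> \<phi> H H' p =
     induced_hom K (unit_coalg K)
       (scalar_measuring K (total_alg H) (total_alg H') (fst p))
       (scalar_measuring K (base_alg H) (base_alg H') (snd p))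
       (Mc H H') (\<Phi> H H') (\<phi> H H')"

definition Mc_unit ::
  "'k ring \<Rightarrow>
   (('k, 'u, 'a) hopf_algebroid \<Rightarrow> ('k, 'u, 'a) hopf_algebroid \<Rightarrow> ('k, 'm) coalgebra) \<Rightarrow>
   (('k, 'u, 'a) hopf_algebroid \<Rightarrow> ('k, 'u, 'a) hopf_algebroid \<Rightarrow> 'm \<Rightarrow> 'u \<Rightarrow> 'u) \<Rightarrow>
   (('k, 'u, 'a) hopf_algebroid \<Rightarrow> ('k, 'u, 'a) hopf_algebroid \<Rightarrow> 'm \<Rightarrow> 'a \<Rightarrow> 'a) \<Rightarrow>
   ('k, 'u, 'a) hopf_algebroid \<Rightarrow> 'k \<Rightarrow> 'm" where
  "Mc_unit K Mc \<Phi> \<phi> H = Mc_point K Mc \<Phi> \<phi> H H (halg_id H)"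

end

theory Submission
  imports Defs
begin

text \<open>By cocommutativity, a measuring of Hopf algebroids over \<open>x\<close> gives a map
  \<open>u \<otimes> v \<mapsto> \<Sum> \<Psi>(x\<^sub>1)(u) \<otimes> \<Psi>(x\<^sub>2)(v)\<close> that is balanced over the base algebra, so it extends to
  \<open>U \<otimes>\<^sub>A U\<close>, and composites of measurings are again measurings, now by the tensor product of the two
  coalgebras. The universal property yields the composition maps and reduces every equation between
  coalgebra maps into \<open>M\<^sub>c(H, H')\<close> to the equality of the induced measurings, where associativity and
  the unit laws are those of composition of functions. A coalgebra map \<open>k \<rightarrow> M\<^sub>c(H, H')\<close> is a
  grouplike element, and a measuring evaluated at a grouplike element is a morphism of Hopf
  algebroids; this identifies the underlying category.\<close>

section \<open>Sums indexed by a tensor\<close>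

text \<open>A tensor is a coset of formal integer combinations, and a Sweedler sum reads one
  arbitrarily chosen representative, so it cannot be computed directly. Each identity is therefore
  treated in one way: both sides are shown to be linear in the tensor and are compared on pure
  tensors, where the universal property of the quotient evaluates the sum.

  A second obstacle is the extensionality convention for linear maps, coalgebra maps and measurings,
  which composition and change of arguments disturb. The predicates \<open>lin\<close>,
  \<open>chom\<close>, \<open>pmeas\<close>, \<open>hpmeas\<close> and \<open>hhom\<close> speak
  only of values on the carriers; the extensional notions return where the universal property is
  invoked.

  Universality is available for test coalgebras on four types only: scalars, elements of the
  measuring coalgebras, and their double and triple tensors. Where a tensor factor k would lead
  outside these types, a fixed grouplike element is inserted instead; this insertion is itself a
  coalgebra map.\<close>

definition frag_lift :: "('p, 'z) monoid_scheme \<Rightarrow> ('i \<Rightarrow>\<^sub>0 int) \<Rightarrow> ('i \<Rightarrow> 'p) \<Rightarrow> 'p" where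
  "frag_lift G f \<beta> = finprod G (\<lambda>i. \<beta> i [^]\<^bsub>G\<^esub> Poly_Mapping.lookup f i) (Poly_Mapping.keys f)"

definition tensor_rep :: "('m, 'n) tensor \<Rightarrow> ('m \<times> 'n) \<Rightarrow>\<^sub>0 int" where
  "tensor_rep t = (SOME f. f \<in> t)"

text \<open>Separates the choice of a representative from the extension of \<open>\<beta>\<close> to
  formal sums. Only the extension is additive by construction; independence of the choice is a
  matter of the relations divided out.\<close>

lemma tensor_lift_eq: "tensor_lift G t \<beta> = frag_lift G (tensor_rep t) (case_prod \<beta>)"
  unfolding tensor_lift_def frag_lift_def tensor_rep_def Let_def by (simp add: case_prod_unfold)

text \<open>Works on the fold relation rather than on products, so the values need not lie in any
  carrier. Congruence of Sweedler sums then costs nothing but agreement on the support.\<close>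

lemma foldSetD_cong:
  assumes "(A, z) \<in> foldSetD D f e" "\<And>a. a \<in> A \<Longrightarrow> f a = g a"
  shows "(A, z) \<in> foldSetD D g e"
  using assms
proof (induction A z rule: foldSetD.induct)
  case (insertI x A y)
  then show ?case using foldSetD.insertI[of x A g y D e] by auto
qed (rule foldSetD.emptyI)

lemma frag_lift_cong:
  assumes "\<And>i. i \<in> Poly_Mapping.keys f \<Longrightarrow> \<beta> i = \<gamma> i"
  shows "frag_lift G f \<beta> = frag_lift G f \<gamma>"
proof -
  let ?p = "\<lambda>\<beta> i. \<beta> i [^]\<^bsub>G\<^esub> Poly_Mapping.lookup f i"
  have "(Poly_Mapping.keys f, z) \<in> foldSetD (carrier G) (monoid.mult G \<circ> ?p \<beta>) \<one>\<^bsub>G\<^esub> \<longleftrightarrow>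
    (Poly_Mapping.keys f, z) \<in> foldSetD (carrier G) (monoid.mult G \<circ> ?p \<gamma>) \<one>\<^bsub>G\<^esub>" for z
    using assms by (auto elim!: foldSetD_cong)
  then show ?thesis by (simp add: frag_lift_def finprod_def foldD_def)
qed

section \<open>Extension of maps to formal integer combinations in a commutative group\<close>

context comm_group
begin

text \<open>Enlarging the index set adds only zero exponents. Formal sums with different supports
  can thus be compared over the union of their supports.\<close>

lemma frag_lift_superset:
  assumes "finite B" "Poly_Mapping.keys f \<subseteq> B" "\<beta> \<in> B \<rightarrow> carrier G"
  shows "frag_lift G f \<beta> = finprod G (\<lambda>i. \<beta> i [^] Poly_Mapping.lookup f i) B"
  unfolding frag_lift_def
  by (rule finprod_mono_neutral_cong_left) (use assms in \<open>auto simp: in_keys_iff\<close>)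

lemma frag_lift_closed [simp]:
  assumes "Poly_Mapping.keys f \<subseteq> S" "\<beta> \<in> S \<rightarrow> carrier G"
  shows "frag_lift G f \<beta> \<in> carrier G"
  unfolding frag_lift_def using assms by (intro finprod_closed) auto

lemma frag_lift_add:
  assumes "Poly_Mapping.keys f \<subseteq> S" "Poly_Mapping.keys g \<subseteq> S" "\<beta> \<in> S \<rightarrow> carrier G"
  shows "frag_lift G (f + g) \<beta> = frag_lift G f \<beta> \<otimes> frag_lift G g \<beta>"
proof -
  let ?B = "Poly_Mapping.keys f \<union> Poly_Mapping.keys g"
  have B: "finite ?B" "\<beta> \<in> ?B \<rightarrow> carrier G" using assms by auto
  have k: "Poly_Mapping.keys (f + g) \<subseteq> ?B" by (rule keys_add)
  have "frag_lift G (f + g) \<beta>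
      = finprod G (\<lambda>i. \<beta> i [^] Poly_Mapping.lookup f i \<otimes> \<beta> i [^] Poly_Mapping.lookup g i) ?B"
    unfolding frag_lift_superset[OF B(1) k B(2)]
    by (rule finprod_cong') (use B in \<open>auto simp: Poly_Mapping.lookup_add int_pow_mult Pi_iff\<close>)
  also have "\<dots> = frag_lift G f \<beta> \<otimes> frag_lift G g \<beta>"
    using B frag_lift_superset[OF B(1) _ B(2), of f] frag_lift_superset[OF B(1) _ B(2), of g]
    by (subst finprod_multf) auto
  finally show ?thesis .
qed

lemma frag_lift_zero [simp]: "frag_lift G 0 \<beta> = \<one>"
  by (simp add: frag_lift_def)

text \<open>Additivity with \<open>g\<close> cancelled. Differences matter because
  \<open>frag_induction\<close> generates formal sums by them and because the tensor relators are
  differences.\<close>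

lemma frag_lift_diff:
  assumes "Poly_Mapping.keys f \<subseteq> S" "Poly_Mapping.keys g \<subseteq> S" "\<beta> \<in> S \<rightarrow> carrier G"
  shows "frag_lift G (f - g) \<beta> = frag_lift G f \<beta> \<otimes> inv (frag_lift G g \<beta>)"
proof -
  have k: "Poly_Mapping.keys (f - g) \<subseteq> S" using keys_diff[of f g] assms by blast
  have "frag_lift G f \<beta> = frag_lift G (f - g) \<beta> \<otimes> frag_lift G g \<beta>"
    using frag_lift_add[OF k assms(2,3)] by simp
  then show ?thesis using k assms by (simp add: inv_solve_right)
qed

lemma frag_lift_of [simp]:
  assumes "\<beta> i \<in> carrier G"
  shows "frag_lift G (frag_of i) \<beta> = \<beta> i"
  using assms by (simp add: frag_lift_def)

lemma frag_lift_mult: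
  assumes "Poly_Mapping.keys f \<subseteq> S" "\<beta> \<in> S \<rightarrow> carrier G" "\<gamma> \<in> S \<rightarrow> carrier G"
  shows "frag_lift G f (\<lambda>i. \<beta> i \<otimes> \<gamma> i) = frag_lift G f \<beta> \<otimes> frag_lift G f \<gamma>"
proof -
  have "frag_lift G f (\<lambda>i. \<beta> i \<otimes> \<gamma> i)
     = finprod G (\<lambda>i. \<beta> i [^] Poly_Mapping.lookup f i \<otimes> \<gamma> i [^] Poly_Mapping.lookup f i) (Poly_Mapping.keys f)"
    unfolding frag_lift_def
    by (rule finprod_cong') (use assms in \<open>auto simp: int_pow_distrib Pi_iff subset_iff\<close>)
  then show ?thesis
    unfolding frag_lift_def using assms by (subst (asm) finprod_multf) auto
qed

lemma frag_lift_hom: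
  assumes "Poly_Mapping.keys f \<subseteq> S" "\<beta> \<in> S \<rightarrow> carrier G" "h \<in> hom G H" "comm_group H"
  shows "h (frag_lift G f \<beta>) = frag_lift H f (\<lambda>i. h (\<beta> i))"
proof -
  interpret H: comm_group H by fact
  interpret h: group_hom G H h using assms by unfold_locales auto
  have hb: "(\<lambda>i. h (\<beta> i)) \<in> S \<rightarrow> carrier H"
  proof
    fix i assume "i \<in> S"
    then have "\<beta> i \<in> carrier G" using assms(2) by auto
    then show "h (\<beta> i) \<in> carrier H" by (rule h.hom_closed)
  qed
  \<comment> \<open>\<open>frag_induction\<close> passes no support information to its hypotheses,
    so the inclusion of the keys is carried along in the statement.\<close>
  have "Poly_Mapping.keys f \<subseteq> S \<and> ?thesis"
    using assms(1)
  proof (induction rule: frag_induction)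
    case (diff a b)
    then show ?case
      using assms hb keys_diff[of a b] by (auto simp: frag_lift_diff[where S = S] H.frag_lift_diff[where S = S])
  qed (use assms hb in \<open>auto simp: Pi_iff\<close>)
  then show ?thesis by simp
qed

lemma frag_lift_swap:
  assumes "Poly_Mapping.keys f \<subseteq> S" "Poly_Mapping.keys g \<subseteq> S'"
    "\<And>i j. i \<in> S \<Longrightarrow> j \<in> S' \<Longrightarrow> \<beta> i j \<in> carrier G"
  shows "frag_lift G f (\<lambda>i. frag_lift G g (\<beta> i)) = frag_lift G g (\<lambda>j. frag_lift G f (\<lambda>i. \<beta> i j))"
proof -
  have c: "frag_lift G g (\<beta> i) \<in> carrier G" if "i \<in> S" for i
    using that assms by (intro frag_lift_closed) auto
  have c': "frag_lift G f (\<lambda>i. \<beta> i j) \<in> carrier G"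
    if "Poly_Mapping.keys f \<subseteq> S" "j \<in> S'" for j f
    using that assms by (intro frag_lift_closed) auto
  have "Poly_Mapping.keys f \<subseteq> S \<and> ?thesis"
    using assms(1)
  proof (induction rule: frag_induction)
    case zero
    have "frag_lift G g (\<lambda>j. \<one>) = \<one>"
      unfolding frag_lift_def by (rule finprod_one_eqI) auto
    then show ?case by simp
  next
    case (one i)
    have "frag_lift G g (\<lambda>j. frag_lift G (frag_of i) (\<lambda>i. \<beta> i j)) = frag_lift G g (\<beta> i)"
      using one assms by (intro frag_lift_cong) auto
    then show ?case using c[OF one] one by simp
  next
    case (diff a b)
    let ?a = "\<lambda>f j. frag_lift G f (\<lambda>i. \<beta> i j)"
    have ab: "Poly_Mapping.keys (a - b) \<subseteq> S" using diff keys_diff[of a b] by blast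
    \<comment> \<open>Writing \<open>a\<close> as \<open>(a - b) + b\<close> gives a product of two
      families, to which \<open>frag_lift_mult\<close> applies; the sum over \<open>a - b\<close> is
      then found by solving for that factor.\<close>
    have "frag_lift G g (?a a) = frag_lift G g (\<lambda>j. ?a (a - b) j \<otimes> ?a b j)"
    proof (rule frag_lift_cong)
      fix j assume "j \<in> Poly_Mapping.keys g"
      then show "?a a j = ?a (a - b) j \<otimes> ?a b j"
        using frag_lift_add[OF ab, of b "\<lambda>i. \<beta> i j"] diff assms(2,3) by auto
    qed
    also have "\<dots> = frag_lift G g (?a (a - b)) \<otimes> frag_lift G g (?a b)"
      using c' ab diff assms by (intro frag_lift_mult[where S = S']) auto
    finally have "frag_lift G g (?a (a - b)) = frag_lift G g (?a a) \<otimes> inv (frag_lift G g (?a b))"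
      using c' ab diff assms by (auto simp: inv_solve_right Pi_iff)
    moreover have "frag_lift G (a - b) (\<lambda>i. frag_lift G g (\<beta> i))
       = frag_lift G a (\<lambda>i. frag_lift G g (\<beta> i)) \<otimes> inv (frag_lift G b (\<lambda>i. frag_lift G g (\<beta> i)))"
      using diff c by (intro frag_lift_diff[where S = S]) auto
    ultimately show ?case using diff ab by simp
  qed
  then show ?thesis by simp
qed

end


section \<open>Sweedler sums over a fixed tensor\<close>

lemma tsum_eq: "tsum P t \<beta> = frag_lift (add_monoid P) (tensor_rep t) (case_prod \<beta>)"
  by (simp add: tsum_def tensor_lift_eq)

text \<open>All that a sum over a fixed tensor asks for: the chosen representative is supported on
  the carriers. The relations divided out do not enter, so one set of rules covers tensor products
  over the ground ring and over a base algebra.\<close>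

definition is_tensor ::
  "('k, ('m, 'n) tensor, 'z) module_scheme \<Rightarrow> ('k, 'm, 'x) module_scheme \<Rightarrow> ('k, 'n, 'y) module_scheme \<Rightarrow> bool" where
  "is_tensor T M N \<longleftrightarrow>
     (\<forall>t\<in>carrier T. Poly_Mapping.keys (tensor_rep t) \<subseteq> carrier M \<times> carrier N)"

lemma tsum_cong:
  assumes "is_tensor T M N" "t \<in> carrier T"
    "\<And>m n. m \<in> carrier M \<Longrightarrow> n \<in> carrier N \<Longrightarrow> \<beta> m n = \<gamma> m n"
  shows "tsum P t \<beta> = tsum P t \<gamma>"
  unfolding tsum_eq by (rule frag_lift_cong) (use assms in \<open>auto simp: is_tensor_def\<close>)

context abelian_group
begin

lemma tsum_closed:
  assumes "is_tensor T M N" "t \<in> carrier T"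
    "\<And>m n. m \<in> carrier M \<Longrightarrow> n \<in> carrier N \<Longrightarrow> \<beta> m n \<in> carrier G"
  shows "tsum G t \<beta> \<in> carrier G"
  unfolding tsum_eq case_prod_unfold
  by (rule add.frag_lift_closed[where S = "carrier M \<times> carrier N"])
     (use assms abelian_group.a_comm_group in \<open>auto simp: is_tensor_def Pi_iff\<close>)

lemma tsum_fun_add:
  assumes "is_tensor T M N" "t \<in> carrier T"
    "\<And>m n. m \<in> carrier M \<Longrightarrow> n \<in> carrier N \<Longrightarrow> \<beta> m n \<in> carrier G"
    "\<And>m n. m \<in> carrier M \<Longrightarrow> n \<in> carrier N \<Longrightarrow> \<gamma> m n \<in> carrier G"
  shows "tsum G t (\<lambda>m n. \<beta> m n \<oplus> \<gamma> m n) = tsum G t \<beta> \<oplus> tsum G t \<gamma>"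
  unfolding tsum_eq case_prod_unfold
  by (rule add.frag_lift_mult[where S = "carrier M \<times> carrier N"])
     (use assms abelian_group.a_comm_group in \<open>auto simp: is_tensor_def Pi_iff\<close>)

lemma tsum_hom:
  assumes "is_tensor T M N" "t \<in> carrier T"
    "\<And>m n. m \<in> carrier M \<Longrightarrow> n \<in> carrier N \<Longrightarrow> \<beta> m n \<in> carrier G"
    "h \<in> hom (add_monoid G) (add_monoid P)" "abelian_group P"
  shows "h (tsum G t \<beta>) = tsum P t (\<lambda>m n. h (\<beta> m n))"
  unfolding tsum_eq case_prod_unfold
  by (rule add.frag_lift_hom[where S = "carrier M \<times> carrier N"])
     (use assms abelian_group.a_comm_group in \<open>auto simp: is_tensor_def Pi_iff\<close>)

lemma tsum_swap:
  assumes "is_tensor T M N" "t \<in> carrier T" "is_tensor T' M' N'" "t' \<in> carrier T'"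
    "\<And>m n m' n'. m \<in> carrier M \<Longrightarrow> n \<in> carrier N \<Longrightarrow> m' \<in> carrier M' \<Longrightarrow> n' \<in> carrier N' \<Longrightarrow>
       \<beta> m n m' n' \<in> carrier G"
  shows "tsum G t (\<lambda>m n. tsum G t' (\<beta> m n)) = tsum G t' (\<lambda>m' n'. tsum G t (\<lambda>m n. \<beta> m n m' n'))"
  unfolding tsum_eq case_prod_unfold
  by (rule add.frag_lift_swap[where S = "carrier M \<times> carrier N" and S' = "carrier M' \<times> carrier N'"
        and \<beta> = "\<lambda>i j. \<beta> (fst i) (snd i) (fst j) (snd j)"])
     (use assms abelian_group.a_comm_group in \<open>auto simp: is_tensor_def Pi_iff\<close>)

end

section \<open>Balanced tensor products\<close>

lemma finprod_struct_cong:
  "carrier G = carrier H \<Longrightarrow> monoid.mult G = monoid.mult H \<Longrightarrow> one G = one H \<Longrightarrow> finprod G f A = finprod H f A"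
  by (simp add: finprod_def)

lemma int_pow_struct_cong:
  "carrier G = carrier H \<Longrightarrow> monoid.mult G = monoid.mult H \<Longrightarrow> one G = one H \<Longrightarrow>
   x [^]\<^bsub>G\<^esub> (n::int) = x [^]\<^bsub>H\<^esub> n"
  by (simp add: int_pow_def nat_pow_def m_inv_def Let_def)

text \<open>A sum reads only carrier, multiplication and unit. The quotient group in which scalar
  multiplication of \<open>balanced_tensor\<close> is defined and the additive group of the
  resulting module agree in these fields without being the same record.\<close>

lemma tensor_lift_struct_cong:
  "carrier G = carrier H \<Longrightarrow> monoid.mult G = monoid.mult H \<Longrightarrow> one G = one H \<Longrightarrow>
   tensor_lift G t \<beta> = tensor_lift H t \<beta>"
  unfolding tensor_lift_def Let_def
  by (simp add: finprod_struct_cong[of G H] int_pow_struct_cong[of G H])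

text \<open>Isolates the additive structure. Scalar multiplication on the quotient is itself given
  by a sum over a tensor, so the universal property must be available before the module axioms can
  be addressed.\<close>

locale balanced_pair = M: abelian_group M + N: abelian_group N
  for M :: "('k, 'm, 'x) module_scheme" and N :: "('k, 'n, 'y) module_scheme" +
  fixes A :: "'a set" and r :: "'a \<Rightarrow> 'm \<Rightarrow> 'm" and l :: "'a \<Rightarrow> 'n \<Rightarrow> 'n"
  assumes r_closed: "a \<in> A \<Longrightarrow> m \<in> carrier M \<Longrightarrow> r a m \<in> carrier M"
    and l_closed: "a \<in> A \<Longrightarrow> n \<in> carrier N \<Longrightarrow> l a n \<in> carrier N"
begin

abbreviation "T \<equiv> balanced_tensor M N A r l"
abbreviation "F \<equiv> free_Abelian_group (carrier M \<times> carrier N)"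
abbreviation "Rel \<equiv> generate F (tensor_relators M N A r l)"

sublocale F: comm_group F by (rule abelian_free_Abelian_group)

lemma relators_subset: "tensor_relators M N A r l \<subseteq> carrier F"
proof -
  have "frag_of p \<in> carrier F" if "p \<in> carrier M \<times> carrier N" for p using that by simp
  moreover have "x - y \<in> carrier F" if "x \<in> carrier F" "y \<in> carrier F" for x y
    using that keys_diff[of x y] by auto
  ultimately show ?thesis
    unfolding tensor_relators_def using r_closed l_closed
    by (auto simp del: carrier_free_Abelian_group_iff)
qed

lemma Rel_subgroup: "subgroup Rel F"
  using relators_subset by (rule F.generate_is_subgroup)

lemma Rel_normal: "Rel \<lhd> F"
  by (simp add: F.normal_iff_subgroup Rel_subgroup)

lemma tensor_simps:
  "carrier T = carrier (F Mod Rel)" "add T = monoid.mult (F Mod Rel)" "zero T = one (F Mod Rel)"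
  by (simp_all add: balanced_tensor_def tensor_group_def Let_def)

lemma T_comm_group: "comm_group (add_monoid T)"
proof -
  interpret Q: comm_group "F Mod Rel" by (rule F.abelian_FactGroup[OF Rel_subgroup])
  show ?thesis
  proof (rule comm_groupI)
    show "\<exists>y\<in>carrier (add_monoid T). y \<otimes>\<^bsub>add_monoid T\<^esub> x = \<one>\<^bsub>add_monoid T\<^esub>"
      if "x \<in> carrier (add_monoid T)" for x
      using that Q.l_inv_ex by (simp add: tensor_simps)
  qed (simp_all only: tensor_simps monoid.simps partial_object.simps Q.m_closed Q.one_closed
        Q.m_assoc Q.l_one, metis Q.m_comm)
qed

lemma T_abelian_group: "abelian_group T"
  using T_comm_group comm_group.axioms(1)
  by (auto simp: abelian_group_def abelian_monoid_def abelian_group_axioms_def)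

sublocale T: abelian_group T by (rule T_abelian_group)

lemma pure_tensor_eq: "m \<boxtimes>\<^bsub>T\<^esub> n = Rel #>\<^bsub>F\<^esub> frag_of (m, n)"
  by (auto simp: pure_tensor_def tensor_simps r_coset_def)

lemma pure_closed [simp, intro]: "m \<in> carrier M \<Longrightarrow> n \<in> carrier N \<Longrightarrow> m \<boxtimes>\<^bsub>T\<^esub> n \<in> carrier T"
  unfolding pure_tensor_eq tensor_simps carrier_FactGroup by (rule imageI) simp

lemma coset_hom: "(\<lambda>f. Rel #>\<^bsub>F\<^esub> f) \<in> hom F (add_monoid T)"
  using normal.r_coset_hom_Mod[OF Rel_normal] by (auto simp: hom_def tensor_simps)

lemma coset_eqI:
  assumes "f \<in> carrier F" "g \<in> carrier F" "f - g \<in> Rel"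
  shows "Rel #>\<^bsub>F\<^esub> f = Rel #>\<^bsub>F\<^esub> g"
proof -
  have "f \<in> Rel #>\<^bsub>F\<^esub> g"
    unfolding r_coset_def using assms by (auto intro!: bexI[of _ "f - g"])
  then show ?thesis using F.repr_independence[OF _ _ Rel_subgroup] assms by metis
qed

lemma coset_frag_add:
  assumes "f \<in> carrier F" "g \<in> carrier F"
  shows "Rel #>\<^bsub>F\<^esub> (f + g) = (Rel #>\<^bsub>F\<^esub> f) \<oplus>\<^bsub>T\<^esub> (Rel #>\<^bsub>F\<^esub> g)"
  using hom_mult[OF coset_hom assms] by simp

lemma pure_add_left:
  assumes "m \<in> carrier M" "m' \<in> carrier M" "n \<in> carrier N"
  shows "(m \<oplus>\<^bsub>M\<^esub> m') \<boxtimes>\<^bsub>T\<^esub> n = m \<boxtimes>\<^bsub>T\<^esub> n \<oplus>\<^bsub>T\<^esub> m' \<boxtimes>\<^bsub>T\<^esub> n"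
proof -
  have "frag_of (m \<oplus>\<^bsub>M\<^esub> m', n) - (frag_of (m, n) + frag_of (m', n)) \<in> Rel"
    unfolding diff_diff_eq[symmetric]
    by (rule generate.incl) (use assms in \<open>auto simp: tensor_relators_def\<close>)
  moreover have "frag_of (m, n) + frag_of (m', n) \<in> carrier F"
    using F.m_closed[of "frag_of (m, n)" "frag_of (m', n)"] assms by simp
  ultimately have "Rel #>\<^bsub>F\<^esub> frag_of (m \<oplus>\<^bsub>M\<^esub> m', n) = Rel #>\<^bsub>F\<^esub> (frag_of (m, n) + frag_of (m', n))"
    using assms by (intro coset_eqI) auto
  then show ?thesis using assms by (simp add: pure_tensor_eq coset_frag_add)
qed

lemma pure_add_right:
  assumes "m \<in> carrier M" "n \<in> carrier N" "n' \<in> carrier N"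
  shows "m \<boxtimes>\<^bsub>T\<^esub> (n \<oplus>\<^bsub>N\<^esub> n') = m \<boxtimes>\<^bsub>T\<^esub> n \<oplus>\<^bsub>T\<^esub> m \<boxtimes>\<^bsub>T\<^esub> n'"
proof -
  have "frag_of (m, n \<oplus>\<^bsub>N\<^esub> n') - (frag_of (m, n) + frag_of (m, n')) \<in> Rel"
    unfolding diff_diff_eq[symmetric]
    by (rule generate.incl) (use assms in \<open>auto simp: tensor_relators_def\<close>)
  moreover have "frag_of (m, n) + frag_of (m, n') \<in> carrier F"
    using F.m_closed[of "frag_of (m, n)" "frag_of (m, n')"] assms by simp
  ultimately have "Rel #>\<^bsub>F\<^esub> frag_of (m, n \<oplus>\<^bsub>N\<^esub> n') = Rel #>\<^bsub>F\<^esub> (frag_of (m, n) + frag_of (m, n'))"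
    using assms by (intro coset_eqI) auto
  then show ?thesis using assms by (simp add: pure_tensor_eq coset_frag_add)
qed

lemma pure_balanced:
  assumes "a \<in> A" "m \<in> carrier M" "n \<in> carrier N"
  shows "r a m \<boxtimes>\<^bsub>T\<^esub> n = m \<boxtimes>\<^bsub>T\<^esub> l a n"
  unfolding pure_tensor_eq
proof (rule coset_eqI)
  show "frag_of (r a m, n) - frag_of (m, l a n) \<in> Rel"
    by (rule generate.incl) (use assms in \<open>auto simp: tensor_relators_def\<close>)
qed (use assms r_closed l_closed in auto)

text \<open>Cosets are inhabited, so the choice operator returns a member, and a coset is the
  translate of the subgroup by any of its members.\<close>

lemma tensor_rep:
  assumes "t \<in> carrier T"
  shows "Poly_Mapping.keys (tensor_rep t) \<subseteq> carrier M \<times> carrier N" "t = Rel #>\<^bsub>F\<^esub> tensor_rep t"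
proof -
  obtain f where f: "f \<in> carrier F" "t = Rel #>\<^bsub>F\<^esub> f"
    using assms unfolding tensor_simps carrier_FactGroup by auto
  have "f \<in> t"
    unfolding f using F.rcos_self[OF f(1) Rel_subgroup] .
  then have m: "tensor_rep t \<in> t" unfolding tensor_rep_def by (rule someI)
  have "t \<subseteq> carrier F"
    unfolding f by (rule F.r_coset_subset_G) (use subgroup.subset[OF Rel_subgroup] f in auto)
  then have c: "tensor_rep t \<in> carrier F" using m by blast
  then show "Poly_Mapping.keys (tensor_rep t) \<subseteq> carrier M \<times> carrier N" by simp
  show "t = Rel #>\<^bsub>F\<^esub> tensor_rep t"
    using F.repr_independence[OF _ _ Rel_subgroup, of "tensor_rep t" f] m f by simp
qed

lemma is_tensor_balanced: "is_tensor T M N"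
  using tensor_rep by (simp add: is_tensor_def)

text \<open>Pure tensors generate: every element is the coset of a formal sum, and formal sums arise
  from generators by differences, which homomorphisms respect.\<close>

lemma hom_ext:
  assumes h: "h \<in> hom (add_monoid T) (add_monoid P)" "g \<in> hom (add_monoid T) (add_monoid P)"
    and P: "abelian_group P" and t: "t \<in> carrier T"
    and eq: "\<And>m n. m \<in> carrier M \<Longrightarrow> n \<in> carrier N \<Longrightarrow> h (m \<boxtimes>\<^bsub>T\<^esub> n) = g (m \<boxtimes>\<^bsub>T\<^esub> n)"
  shows "h t = g t"
proof -
  interpret P: abelian_group P by fact
  interpret h: group_hom "add_monoid T" "add_monoid P" h
    using h T.a_group P.a_group by (simp add: group_hom_def group_hom_axioms_def)
  interpret g: group_hom "add_monoid T" "add_monoid P" g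
    using h T.a_group P.a_group by (simp add: group_hom_def group_hom_axioms_def)
  have "h (Rel #>\<^bsub>F\<^esub> f) = g (Rel #>\<^bsub>F\<^esub> f)" if "Poly_Mapping.keys f \<subseteq> carrier M \<times> carrier N" for f
  proof (rule free_Abelian_group_induct[OF that])
    have "Rel #>\<^bsub>F\<^esub> 0 = \<zero>\<^bsub>T\<^esub>"
      using F.coset_join2[OF _ Rel_subgroup, of 0] subgroup.one_closed[OF Rel_subgroup]
      by (simp add: tensor_simps)
    then show "h (Rel #>\<^bsub>F\<^esub> 0) = g (Rel #>\<^bsub>F\<^esub> 0)" using h.hom_one g.hom_one by simp
  next
    fix x y assume xy: "Poly_Mapping.keys x \<subseteq> carrier M \<times> carrier N" "Poly_Mapping.keys y \<subseteq> carrier M \<times> carrier N"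
      and IH: "h (Rel #>\<^bsub>F\<^esub> x) = g (Rel #>\<^bsub>F\<^esub> x)" "h (Rel #>\<^bsub>F\<^esub> y) = g (Rel #>\<^bsub>F\<^esub> y)"
    interpret c: group_hom F "add_monoid T" "\<lambda>f. Rel #>\<^bsub>F\<^esub> f"
      using coset_hom T.a_group F.is_group by (simp add: group_hom_def group_hom_axioms_def)
    have xy': "x \<in> carrier F" "y \<in> carrier F" using xy by auto
    note cl = c.hom_closed[OF xy'(1)] c.hom_closed[OF xy'(2)]
    have "Rel #>\<^bsub>F\<^esub> (x - y) = (Rel #>\<^bsub>F\<^esub> x) \<otimes>\<^bsub>add_monoid T\<^esub> inv\<^bsub>add_monoid T\<^esub> (Rel #>\<^bsub>F\<^esub> y)"
      using c.hom_mult[of x "- y"] c.hom_inv[OF xy'(2)] xy by simp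
    then show "h (Rel #>\<^bsub>F\<^esub> (x - y)) = g (Rel #>\<^bsub>F\<^esub> (x - y))"
      using h.hom_mult[OF cl(1) group.inv_closed[OF T.a_group cl(2)]]
        g.hom_mult[OF cl(1) group.inv_closed[OF T.a_group cl(2)]] h.hom_inv[OF cl(2)] g.hom_inv[OF cl(2)] IH
      by simp
  next
    fix p assume "p \<in> carrier M \<times> carrier N"
    then show "h (Rel #>\<^bsub>F\<^esub> frag_of p) = g (Rel #>\<^bsub>F\<^esub> frag_of p)" using eq pure_tensor_eq by auto
  qed
  then show ?thesis using tensor_rep[OF t] by metis
qed

text \<open>Universal property of the quotient. The extension of \<open>\<beta>\<close> to the free
  abelian group kills the relators, hence the subgroup they generate, so its value at the chosen
  representative is its value at any other.\<close>

lemma tsum_hom_pure: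
  assumes P: "abelian_group P"
    and closed: "\<And>m n. m \<in> carrier M \<Longrightarrow> n \<in> carrier N \<Longrightarrow> \<beta> m n \<in> carrier P"
    and add1: "\<And>m m' n. m \<in> carrier M \<Longrightarrow> m' \<in> carrier M \<Longrightarrow> n \<in> carrier N \<Longrightarrow>
                 \<beta> (m \<oplus>\<^bsub>M\<^esub> m') n = \<beta> m n \<oplus>\<^bsub>P\<^esub> \<beta> m' n"
    and add2: "\<And>m n n'. m \<in> carrier M \<Longrightarrow> n \<in> carrier N \<Longrightarrow> n' \<in> carrier N \<Longrightarrow>
                 \<beta> m (n \<oplus>\<^bsub>N\<^esub> n') = \<beta> m n \<oplus>\<^bsub>P\<^esub> \<beta> m n'"
    and bal: "\<And>a m n. a \<in> A \<Longrightarrow> m \<in> carrier M \<Longrightarrow> n \<in> carrier N \<Longrightarrow> \<beta> (r a m) n = \<beta> m (l a n)"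
  shows "(\<lambda>t. tsum P t \<beta>) \<in> hom (add_monoid T) (add_monoid P)"
    and "\<And>m n. m \<in> carrier M \<Longrightarrow> n \<in> carrier N \<Longrightarrow> tsum P (m \<boxtimes>\<^bsub>T\<^esub> n) \<beta> = \<beta> m n"
proof -
  interpret P: abelian_group P by fact
  let ?S = "carrier M \<times> carrier N"
  let ?E = "\<lambda>f. frag_lift (add_monoid P) f (case_prod \<beta>)"
  have b: "case_prod \<beta> \<in> ?S \<rightarrow> carrier P" using closed by auto
  have E: "?E \<in> hom F (add_monoid P)"
    using b P.add.frag_lift_closed[OF _ b] P.add.frag_lift_add[OF _ _ b] by (auto simp: hom_def)
  interpret E: group_hom F "add_monoid P" ?E
    using E F.is_group P.a_group by (simp add: group_hom_def group_hom_axioms_def)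
  have Ed: "?E (f - g) = ?E f \<ominus>\<^bsub>P\<^esub> ?E g" if "f \<in> carrier F" "g \<in> carrier F" for f g
    using P.add.frag_lift_diff[OF _ _ b, of f g] that by (simp add: a_minus_def a_inv_def)
  have Ef: "?E (frag_of (m, n)) = \<beta> m n" if "m \<in> carrier M" "n \<in> carrier N" for m n
    using P.add.frag_lift_of[of "case_prod \<beta>" "(m, n)"] that closed by simp
  have Fc: "frag_of (m, n) \<in> carrier F" if "m \<in> carrier M" "n \<in> carrier N" for m n using that by simp
  have Fd: "x - y \<in> carrier F" if "x \<in> carrier F" "y \<in> carrier F" for x y
    using that keys_diff[of x y] by auto
  \<comment> \<open>The shape that an additivity relator takes once \<open>?E\<close> has been
    evaluated and \<open>\<beta>\<close> expanded. With four free arguments it serves additivity in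
    either factor.\<close>
  have z: "\<beta> m n \<oplus>\<^bsub>P\<^esub> \<beta> m' n' \<ominus>\<^bsub>P\<^esub> \<beta> m n \<ominus>\<^bsub>P\<^esub> \<beta> m' n' = \<zero>\<^bsub>P\<^esub>"
    if "m \<in> carrier M" "n \<in> carrier N" "m' \<in> carrier M" "n' \<in> carrier N" for m n m' n'
    using closed[OF that(1,2)] closed[OF that(3,4)] by (simp add: P.minus_eq P.a_ac P.r_neg P.r_neg1 P.r_neg2)
  have ker: "tensor_relators M N A r l \<subseteq> kernel F (add_monoid P) ?E"
    using relators_subset
    unfolding tensor_relators_def kernel_def
    by (auto simp del: carrier_free_Abelian_group_iff
        simp: Ed Ef Fc Fd add1 add2 bal z[unfolded P.minus_eq] closed r_closed l_closed P.minus_eq P.r_neg)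
  have sub: "Rel \<subseteq> kernel F (add_monoid P) ?E"
    by (rule F.generate_subgroup_incl[OF ker E.subgroup_kernel])
  \<comment> \<open>The chosen representative of the coset of \<open>f\<close> is
    \<open>n + f\<close> for some \<open>n\<close> in the subgroup of relations, where
    \<open>?E\<close> vanishes.\<close>
  have coset: "?E (tensor_rep (Rel #>\<^bsub>F\<^esub> f)) = ?E f" if f: "f \<in> carrier F" for f
  proof -
    have "Rel #>\<^bsub>F\<^esub> f \<in> carrier T" using hom_in_carrier[OF coset_hom f] by simp
    from tensor_rep[OF this] have t: "tensor_rep (Rel #>\<^bsub>F\<^esub> f) \<in> carrier F"
      "Rel #>\<^bsub>F\<^esub> f = Rel #>\<^bsub>F\<^esub> tensor_rep (Rel #>\<^bsub>F\<^esub> f)" by auto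
    have "tensor_rep (Rel #>\<^bsub>F\<^esub> f) \<in> Rel #>\<^bsub>F\<^esub> f"
      using F.rcos_self[OF t(1) Rel_subgroup] t(2) by simp
    then obtain n where n: "n \<in> Rel" "tensor_rep (Rel #>\<^bsub>F\<^esub> f) = n + f"
      by (auto simp: r_coset_def)
    have "?E n = \<one>\<^bsub>add_monoid P\<^esub>" "n \<in> carrier F" using n sub by (auto simp: kernel_def)
    then show ?thesis using E.hom_mult[of n f] n f E.hom_closed[OF f] by simp
  qed
  show "(\<lambda>t. tsum P t \<beta>) \<in> hom (add_monoid T) (add_monoid P)"
  proof (rule homI)
    fix t t' assume tt: "t \<in> carrier (add_monoid T)" "t' \<in> carrier (add_monoid T)"
    let ?f = "tensor_rep t" and ?g = "tensor_rep t'"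
    have fg: "?f \<in> carrier F" "?g \<in> carrier F" using tensor_rep tt by auto
    have "t \<oplus>\<^bsub>T\<^esub> t' = Rel #>\<^bsub>F\<^esub> (?f + ?g)"
      using coset_frag_add[OF fg] tensor_rep tt by simp
    moreover have "?f + ?g \<in> carrier F" using F.m_closed[OF fg] by simp
    ultimately show "tsum P (t \<otimes>\<^bsub>add_monoid T\<^esub> t') \<beta> = tsum P t \<beta> \<otimes>\<^bsub>add_monoid P\<^esub> tsum P t' \<beta>"
      using E.hom_mult[OF fg] coset by (simp add: tsum_eq)
  next
    fix t assume "t \<in> carrier (add_monoid T)"
    then show "tsum P t \<beta> \<in> carrier (add_monoid P)"
      using P.tsum_closed[OF is_tensor_balanced] closed by auto
  qed
  show "tsum P (m \<boxtimes>\<^bsub>T\<^esub> n) \<beta> = \<beta> m n" if "m \<in> carrier M" "n \<in> carrier N" for m n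
    using coset[OF Fc[OF that]] Ef[OF that] by (simp add: tsum_eq pure_tensor_eq)
qed

text \<open>The definition uses a sum in the quotient group; read as a Sweedler sum in the tensor
  product itself it falls under \<open>tsum_hom_pure\<close>.\<close>

lemma smult_tensor:
  "c \<odot>\<^bsub>T\<^esub> t = tsum T t (\<lambda>m n. (c \<odot>\<^bsub>M\<^esub> m) \<boxtimes>\<^bsub>T\<^esub> n)"
proof -
  have "c \<odot>\<^bsub>T\<^esub> t = tensor_lift (F Mod Rel) t (\<lambda>m n. (c \<odot>\<^bsub>M\<^esub> m) \<boxtimes>\<^bsub>T\<^esub> n)"
    unfolding pure_tensor_eq by (simp add: balanced_tensor_def tensor_group_def Let_def)
  also have "\<dots> = tsum T t (\<lambda>m n. (c \<odot>\<^bsub>M\<^esub> m) \<boxtimes>\<^bsub>T\<^esub> n)"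
    unfolding tsum_def by (rule tensor_lift_struct_cong) (simp_all add: tensor_simps)
  finally show ?thesis .
qed

end

section \<open>Linear and multilinear maps\<close>

text \<open>Linear maps without the extensionality convention of \<^const>\<open>linear_maps\<close>.\<close>

definition lin ::
  "'k ring \<Rightarrow> ('k, 'v, 'x) module_scheme \<Rightarrow> ('k, 'w, 'y) module_scheme \<Rightarrow> ('v \<Rightarrow> 'w) \<Rightarrow> bool" where
  "lin K V W f \<longleftrightarrow> module K V \<and> module K W \<and>
     (\<forall>x\<in>carrier V. f x \<in> carrier W) \<and>
     (\<forall>x\<in>carrier V. \<forall>y\<in>carrier V. f (x \<oplus>\<^bsub>V\<^esub> y) = f x \<oplus>\<^bsub>W\<^esub> f y) \<and>
     (\<forall>c\<in>carrier K. \<forall>x\<in>carrier V. f (c \<odot>\<^bsub>V\<^esub> x) = c \<odot>\<^bsub>W\<^esub> f x)"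

text \<open>The module structures belong to the predicate, so a single bilinearity fact is all that
  the rules for sums have to be given.\<close>

definition bilin ::
  "'k ring \<Rightarrow> ('k, 'v, 'x) module_scheme \<Rightarrow> ('k, 'w, 'y) module_scheme \<Rightarrow> ('k, 'p, 'z) module_scheme \<Rightarrow>
   ('v \<Rightarrow> 'w \<Rightarrow> 'p) \<Rightarrow> bool" where
  "bilin K V W P \<beta> \<longleftrightarrow> module K V \<and> module K W \<and> module K P \<and>
     (\<forall>y\<in>carrier W. lin K V P (\<lambda>x. \<beta> x y)) \<and> (\<forall>x\<in>carrier V. lin K W P (\<beta> x))"

lemma linI:
  assumes "module K V" "module K W" "\<And>x. x \<in> carrier V \<Longrightarrow> f x \<in> carrier W"
    "\<And>x y. x \<in> carrier V \<Longrightarrow> y \<in> carrier V \<Longrightarrow> f (x \<oplus>\<^bsub>V\<^esub> y) = f x \<oplus>\<^bsub>W\<^esub> f y"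
    "\<And>c x. c \<in> carrier K \<Longrightarrow> x \<in> carrier V \<Longrightarrow> f (c \<odot>\<^bsub>V\<^esub> x) = c \<odot>\<^bsub>W\<^esub> f x"
  shows "lin K V W f"
  using assms by (simp add: lin_def)

lemma lin_closed: "lin K V W f \<Longrightarrow> x \<in> carrier V \<Longrightarrow> f x \<in> carrier W"
  by (simp add: lin_def)

lemma lin_add: "lin K V W f \<Longrightarrow> x \<in> carrier V \<Longrightarrow> y \<in> carrier V \<Longrightarrow> f (x \<oplus>\<^bsub>V\<^esub> y) = f x \<oplus>\<^bsub>W\<^esub> f y"
  by (simp add: lin_def)

lemma lin_smult: "lin K V W f \<Longrightarrow> c \<in> carrier K \<Longrightarrow> x \<in> carrier V \<Longrightarrow> f (c \<odot>\<^bsub>V\<^esub> x) = c \<odot>\<^bsub>W\<^esub> f x"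
  by (simp add: lin_def)

lemma lin_module: "lin K V W f \<Longrightarrow> module K V" "lin K V W f \<Longrightarrow> module K W"
  by (simp_all add: lin_def)

lemma module_abelian_group: "module K V \<Longrightarrow> abelian_group V"
  by (simp add: module_def)

lemma module_cring: "module K V \<Longrightarrow> cring K"
  by (simp add: module_def)

lemma lin_hom: "lin K V W f \<Longrightarrow> f \<in> hom (add_monoid V) (add_monoid W)"
  by (auto simp: lin_def hom_def)

lemma linear_maps_lin: "f \<in> linear_maps K V W \<Longrightarrow> module K V \<Longrightarrow> module K W \<Longrightarrow> lin K V W f"
  unfolding linear_maps_def lin_def by (auto simp: PiE_def Pi_def)

lemma linear_maps_iff:
  "module K V \<Longrightarrow> module K W \<Longrightarrow> f \<in> linear_maps K V W \<longleftrightarrow> lin K V W f \<and> f \<in> extensional (carrier V)"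
  by (auto simp: linear_maps_def lin_def PiE_def)

lemma lin_linear_maps: "lin K V W f \<Longrightarrow> restrict f (carrier V) \<in> linear_maps K V W"
proof -
  assume f: "lin K V W f"
  interpret module K V using f by (rule lin_module)
  show ?thesis using f unfolding linear_maps_def lin_def by simp
qed

lemma lin_extensional_linear_maps:
  assumes "lin K V W f" "f \<in> extensional (carrier V)"
  shows "f \<in> linear_maps K V W"
  using lin_linear_maps[OF assms(1)] assms(2) by (simp add: extensional_restrict)

lemma lin_id: "module K V \<Longrightarrow> lin K V V (\<lambda>x. x)"
  by (simp add: lin_def)

lemma lin_compose: "lin K V W f \<Longrightarrow> lin K W X g \<Longrightarrow> lin K V X (\<lambda>x. g (f x))"
  by (simp add: lin_def)

lemma lin_cong:
  assumes "lin K V W f" "\<And>x. x \<in> carrier V \<Longrightarrow> f x = g x"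
  shows "lin K V W g"
proof -
  interpret module K V using assms lin_module by blast
  show ?thesis using assms by (simp add: lin_def)
qed

lemma bilin_lin1: "bilin K V W P \<beta> \<Longrightarrow> y \<in> carrier W \<Longrightarrow> lin K V P (\<lambda>x. \<beta> x y)"
  by (simp add: bilin_def)

lemma bilin_lin2: "bilin K V W P \<beta> \<Longrightarrow> x \<in> carrier V \<Longrightarrow> lin K W P (\<beta> x)"
  by (simp add: bilin_def)

lemma bilin_closed: "bilin K V W P \<beta> \<Longrightarrow> x \<in> carrier V \<Longrightarrow> y \<in> carrier W \<Longrightarrow> \<beta> x y \<in> carrier P"
  by (simp add: bilin_def lin_def)

lemma bilin_module: "bilin K V W P \<beta> \<Longrightarrow> module K V" "bilin K V W P \<beta> \<Longrightarrow> module K W"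
  "bilin K V W P \<beta> \<Longrightarrow> module K P"
  by (simp_all add: bilin_def)

lemma bilinI:
  assumes "module K V" "module K W" "module K P"
    "\<And>y. y \<in> carrier W \<Longrightarrow> lin K V P (\<lambda>x. \<beta> x y)" "\<And>x. x \<in> carrier V \<Longrightarrow> lin K W P (\<lambda>y. \<beta> x y)"
  shows "bilin K V W P \<beta>"
  using assms by (simp add: bilin_def)

lemma bilin_swap: "bilin K V W P \<beta> \<Longrightarrow> bilin K W V P (\<lambda>y x. \<beta> x y)"
  by (simp add: bilin_def)

lemma bilin_comp:
  assumes b: "bilin K V W P \<beta>" and f: "lin K V' V f" and g: "lin K W' W g"
  shows "bilin K V' W' P (\<lambda>x y. \<beta> (f x) (g y))"
proof (rule bilinI)
  show "lin K V' P (\<lambda>x. \<beta> (f x) (g y))" if "y \<in> carrier W'" for y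
    using lin_compose[OF f bilin_lin1[OF b lin_closed[OF g that]]] .
  show "lin K W' P (\<lambda>y. \<beta> (f x) (g y))" if "x \<in> carrier V'" for x
    using lin_compose[OF g bilin_lin2[OF b lin_closed[OF f that]]] .
qed (rule lin_module(1)[OF f] lin_module(1)[OF g] bilin_module(3)[OF b])+

section \<open>Interaction of Sweedler sums with linear maps\<close>

lemma lin_tsum:
  assumes "is_tensor T M N" "t \<in> carrier T"
    "\<And>m n. m \<in> carrier M \<Longrightarrow> n \<in> carrier N \<Longrightarrow> \<beta> m n \<in> carrier P"
    "lin K P Q h"
  shows "h (tsum P t \<beta>) = tsum Q t (\<lambda>m n. h (\<beta> m n))"
  using abelian_group.tsum_hom[OF _ assms(1-3) lin_hom[OF assms(4)]] lin_module[OF assms(4)]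
  by (simp add: module_abelian_group)

text \<open>With the tensor fixed, the sum is a finite integer combination of linear maps, whichever
  representative is read.\<close>

lemma lin_tsum_fun:
  assumes T: "is_tensor T M N" "t \<in> carrier T" and V: "module K V" "module K P"
    and l: "\<And>m n. m \<in> carrier M \<Longrightarrow> n \<in> carrier N \<Longrightarrow> lin K V P (\<lambda>x. \<beta> x m n)"
  shows "lin K V P (\<lambda>x. tsum P t (\<beta> x))"
proof -
  interpret P: module K P by fact
  interpret V: module K V by fact
  have c: "\<beta> x m n \<in> carrier P" if "x \<in> carrier V" "m \<in> carrier M" "n \<in> carrier N" for x m n
    using l[OF that(2,3)] that(1) by (rule lin_closed)
  show ?thesis
  proof (rule linI[OF V])
    show "tsum P t (\<beta> x) \<in> carrier P" if "x \<in> carrier V" for x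
      using P.tsum_closed[OF T] c that by auto
  next
    fix x y assume xy: "x \<in> carrier V" "y \<in> carrier V"
    have "tsum P t (\<beta> (x \<oplus>\<^bsub>V\<^esub> y)) = tsum P t (\<lambda>m n. \<beta> x m n \<oplus>\<^bsub>P\<^esub> \<beta> y m n)"
      by (rule tsum_cong[OF T]) (use l lin_add xy in fastforce)
    also have "\<dots> = tsum P t (\<beta> x) \<oplus>\<^bsub>P\<^esub> tsum P t (\<beta> y)"
      using c xy by (intro P.tsum_fun_add[OF T])
    finally show "tsum P t (\<beta> (x \<oplus>\<^bsub>V\<^esub> y)) = tsum P t (\<beta> x) \<oplus>\<^bsub>P\<^esub> tsum P t (\<beta> y)" .
  next
    fix k x assume x: "k \<in> carrier K" "x \<in> carrier V"
    have k: "lin K P P (\<lambda>p. k \<odot>\<^bsub>P\<^esub> p)"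
      by (rule linI[OF V(2) V(2)]) (use x in \<open>simp_all add: P.smult_r_distr P.R.m_comm flip: P.smult_assoc1\<close>)
    have "tsum P t (\<beta> (k \<odot>\<^bsub>V\<^esub> x)) = tsum P t (\<lambda>m n. k \<odot>\<^bsub>P\<^esub> \<beta> x m n)"
      by (rule tsum_cong[OF T]) (use l lin_smult x in fastforce)
    also have "\<dots> = k \<odot>\<^bsub>P\<^esub> tsum P t (\<beta> x)"
      using lin_tsum[OF T _ k, of "\<beta> x"] c x by simp
    finally show "tsum P t (\<beta> (k \<odot>\<^bsub>V\<^esub> x)) = k \<odot>\<^bsub>P\<^esub> tsum P t (\<beta> x)" .
  qed
qed

section \<open>Tensor products of modules\<close>

text \<open>By \<open>scalars\<close> each scalar acts on both sides like an element of
  \<open>A\<close>, so balancing over \<open>A\<close> forces balancing over the ground ring. For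
  \<open>ktensor\<close> that element is the scalar itself; for a Hopf algebroid it is the scalar
  times the unit of the base algebra. \<open>r_smult\<close> lets scaling of the left factor pass to
  the quotient.\<close>

locale module_pair = M: module K M + N: module K N
  for K :: "'k ring" and M :: "('k, 'm, 'x) module_scheme" and N :: "('k, 'n, 'y) module_scheme" +
  fixes A :: "'a set" and r :: "'a \<Rightarrow> 'm \<Rightarrow> 'm" and l :: "'a \<Rightarrow> 'n \<Rightarrow> 'n"
  assumes r_closed': "a \<in> A \<Longrightarrow> m \<in> carrier M \<Longrightarrow> r a m \<in> carrier M"
    and l_closed': "a \<in> A \<Longrightarrow> n \<in> carrier N \<Longrightarrow> l a n \<in> carrier N"
    and r_smult: "c \<in> carrier K \<Longrightarrow> a \<in> A \<Longrightarrow> m \<in> carrier M \<Longrightarrow> c \<odot>\<^bsub>M\<^esub> r a m = r a (c \<odot>\<^bsub>M\<^esub> m)"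
    and scalars: "c \<in> carrier K \<Longrightarrow> \<exists>a\<in>A. (\<forall>m\<in>carrier M. r a m = c \<odot>\<^bsub>M\<^esub> m) \<and>
                    (\<forall>n\<in>carrier N. l a n = c \<odot>\<^bsub>N\<^esub> n)"
begin

sublocale balanced_pair M N A r l
  by unfold_locales (auto simp: r_closed' l_closed')

lemma smult_hom:
  assumes "c \<in> carrier K"
  shows "(\<lambda>t. c \<odot>\<^bsub>T\<^esub> t) \<in> hom (add_monoid T) (add_monoid T)"
    and "m \<in> carrier M \<Longrightarrow> n \<in> carrier N \<Longrightarrow> c \<odot>\<^bsub>T\<^esub> (m \<boxtimes>\<^bsub>T\<^esub> n) = (c \<odot>\<^bsub>M\<^esub> m) \<boxtimes>\<^bsub>T\<^esub> n"
proof -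
  let ?\<beta> = "\<lambda>m n. (c \<odot>\<^bsub>M\<^esub> m) \<boxtimes>\<^bsub>T\<^esub> n"
  have 1: "?\<beta> (m \<oplus>\<^bsub>M\<^esub> m') n = ?\<beta> m n \<oplus>\<^bsub>T\<^esub> ?\<beta> m' n"
    if "m \<in> carrier M" "m' \<in> carrier M" "n \<in> carrier N" for m m' n
    using that assms by (simp add: M.smult_r_distr pure_add_left)
  have 2: "?\<beta> m (n \<oplus>\<^bsub>N\<^esub> n') = ?\<beta> m n \<oplus>\<^bsub>T\<^esub> ?\<beta> m n'"
    if "m \<in> carrier M" "n \<in> carrier N" "n' \<in> carrier N" for m n n'
    using that assms by (simp add: pure_add_right)
  have 3: "?\<beta> (r a m) n = ?\<beta> m (l a n)"
    if "a \<in> A" "m \<in> carrier M" "n \<in> carrier N" for a m n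
    using that assms by (simp add: r_smult pure_balanced)
  have 0: "?\<beta> m n \<in> carrier T" if "m \<in> carrier M" "n \<in> carrier N" for m n
    using that assms by simp
  note u = tsum_hom_pure[of T ?\<beta>, OF T_abelian_group 0 1 2 3]
  show "(\<lambda>t. c \<odot>\<^bsub>T\<^esub> t) \<in> hom (add_monoid T) (add_monoid T)"
    unfolding smult_tensor by (rule u(1))
  show "m \<in> carrier M \<Longrightarrow> n \<in> carrier N \<Longrightarrow> c \<odot>\<^bsub>T\<^esub> (m \<boxtimes>\<^bsub>T\<^esub> n) = (c \<odot>\<^bsub>M\<^esub> m) \<boxtimes>\<^bsub>T\<^esub> n"
    unfolding smult_tensor by (rule u(2))
qed

lemma T_add_hom:
  assumes "f \<in> hom (add_monoid T) (add_monoid T)" "g \<in> hom (add_monoid T) (add_monoid T)"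
  shows "(\<lambda>t. f t \<oplus>\<^bsub>T\<^esub> g t) \<in> hom (add_monoid T) (add_monoid T)"
  using assms unfolding hom_def by (auto simp: Pi_iff T.a_ac)

text \<open>For fixed scalars, the laws not already contained in \<open>smult_hom\<close> equate two
  additive endomorphisms, so they can be checked on pure tensors, where they are axioms of
  \<open>M\<close>.\<close>

lemma T_module: "module K T"
proof (rule moduleI)
  have closed: "a \<odot>\<^bsub>T\<^esub> x \<in> carrier T" if "a \<in> carrier K" "x \<in> carrier T" for a x
    using hom_in_carrier[OF smult_hom(1)[OF that(1)]] that by simp
  show "cring K" by (rule M.R.is_cring)
  show "abelian_group T" by (rule T_abelian_group)
  show "a \<odot>\<^bsub>T\<^esub> x \<in> carrier T" if "a \<in> carrier K" "x \<in> carrier T" for a x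
    using that by (rule closed)
  show "a \<odot>\<^bsub>T\<^esub> (x \<oplus>\<^bsub>T\<^esub> y) = a \<odot>\<^bsub>T\<^esub> x \<oplus>\<^bsub>T\<^esub> a \<odot>\<^bsub>T\<^esub> y"
    if "a \<in> carrier K" "x \<in> carrier T" "y \<in> carrier T" for a x y
    using hom_mult[OF smult_hom(1)[OF that(1)]] that by simp
  show "(a \<oplus>\<^bsub>K\<^esub> b) \<odot>\<^bsub>T\<^esub> x = a \<odot>\<^bsub>T\<^esub> x \<oplus>\<^bsub>T\<^esub> b \<odot>\<^bsub>T\<^esub> x"
    if ab: "a \<in> carrier K" "b \<in> carrier K" and x: "x \<in> carrier T" for a b x
  proof (rule hom_ext[OF _ _ T_abelian_group x])
    show "(\<lambda>x. (a \<oplus>\<^bsub>K\<^esub> b) \<odot>\<^bsub>T\<^esub> x) \<in> hom (add_monoid T) (add_monoid T)"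
      by (rule smult_hom(1)[OF M.R.add.m_closed[OF ab]])
    show "(\<lambda>x. a \<odot>\<^bsub>T\<^esub> x \<oplus>\<^bsub>T\<^esub> b \<odot>\<^bsub>T\<^esub> x) \<in> hom (add_monoid T) (add_monoid T)"
      by (rule T_add_hom[OF smult_hom(1)[OF ab(1)] smult_hom(1)[OF ab(2)]])
    show "(a \<oplus>\<^bsub>K\<^esub> b) \<odot>\<^bsub>T\<^esub> (m \<boxtimes>\<^bsub>T\<^esub> n) = a \<odot>\<^bsub>T\<^esub> (m \<boxtimes>\<^bsub>T\<^esub> n) \<oplus>\<^bsub>T\<^esub> b \<odot>\<^bsub>T\<^esub> (m \<boxtimes>\<^bsub>T\<^esub> n)"
      if "m \<in> carrier M" "n \<in> carrier N" for m n
      by (simp only: smult_hom(2)[OF _ that] ab M.R.add.m_closed M.smult_l_distr that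
          pure_add_left M.smult_closed)
  qed
  show "(a \<otimes>\<^bsub>K\<^esub> b) \<odot>\<^bsub>T\<^esub> x = a \<odot>\<^bsub>T\<^esub> (b \<odot>\<^bsub>T\<^esub> x)"
    if ab: "a \<in> carrier K" "b \<in> carrier K" and x: "x \<in> carrier T" for a b x
  proof (rule hom_ext[OF _ _ T_abelian_group x])
    show "(\<lambda>x. (a \<otimes>\<^bsub>K\<^esub> b) \<odot>\<^bsub>T\<^esub> x) \<in> hom (add_monoid T) (add_monoid T)"
      by (rule smult_hom(1)[OF M.R.m_closed[OF ab]])
    show "(\<lambda>x. a \<odot>\<^bsub>T\<^esub> (b \<odot>\<^bsub>T\<^esub> x)) \<in> hom (add_monoid T) (add_monoid T)"
      using hom_compose[OF smult_hom(1)[OF ab(2)] smult_hom(1)[OF ab(1)]] by (simp add: comp_def)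
    show "(a \<otimes>\<^bsub>K\<^esub> b) \<odot>\<^bsub>T\<^esub> (m \<boxtimes>\<^bsub>T\<^esub> n) = a \<odot>\<^bsub>T\<^esub> (b \<odot>\<^bsub>T\<^esub> (m \<boxtimes>\<^bsub>T\<^esub> n))"
      if "m \<in> carrier M" "n \<in> carrier N" for m n
      by (simp only: smult_hom(2) ab M.R.m_closed M.smult_assoc1 that M.smult_closed)
  qed
  show "\<one>\<^bsub>K\<^esub> \<odot>\<^bsub>T\<^esub> x = x" if x: "x \<in> carrier T" for x
  proof (rule hom_ext[OF _ _ T_abelian_group x])
    show "(\<lambda>x. \<one>\<^bsub>K\<^esub> \<odot>\<^bsub>T\<^esub> x) \<in> hom (add_monoid T) (add_monoid T)"
      by (rule smult_hom(1)[OF M.R.one_closed])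
    show "(\<lambda>x. x) \<in> hom (add_monoid T) (add_monoid T)" by (simp add: hom_def)
    show "\<one>\<^bsub>K\<^esub> \<odot>\<^bsub>T\<^esub> (m \<boxtimes>\<^bsub>T\<^esub> n) = m \<boxtimes>\<^bsub>T\<^esub> n" if "m \<in> carrier M" "n \<in> carrier N" for m n
      by (simp only: smult_hom(2) M.R.one_closed that M.smult_one)
  qed
qed

sublocale T: module K T by (rule T_module)

text \<open>Scaling is defined on the left factor; the scalar crosses to the right factor in the
  guise of an element of \<open>A\<close>.\<close>

lemma pure_smult_right:
  assumes "c \<in> carrier K" "m \<in> carrier M" "n \<in> carrier N"
  shows "m \<boxtimes>\<^bsub>T\<^esub> (c \<odot>\<^bsub>N\<^esub> n) = c \<odot>\<^bsub>T\<^esub> (m \<boxtimes>\<^bsub>T\<^esub> n)"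
proof -
  obtain a where "a \<in> A" "r a m = c \<odot>\<^bsub>M\<^esub> m" "l a n = c \<odot>\<^bsub>N\<^esub> n"
    using scalars[OF assms(1)] assms by blast
  then show ?thesis using pure_balanced[of a m n] assms by (simp add: smult_hom(2))
qed

lemma bilin_pure: "bilin K M N T (\<lambda>m n. m \<boxtimes>\<^bsub>T\<^esub> n)"
  by (intro bilinI linI M.module_axioms N.module_axioms T_module)
    (simp_all add: pure_add_left pure_add_right pure_smult_right smult_hom)

lemma lin_ext:
  assumes f: "lin K T P f" and g: "lin K T P g"
    and eq: "\<And>m n. m \<in> carrier M \<Longrightarrow> n \<in> carrier N \<Longrightarrow> f (m \<boxtimes>\<^bsub>T\<^esub> n) = g (m \<boxtimes>\<^bsub>T\<^esub> n)"
    and t: "t \<in> carrier T"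
  shows "f t = g t"
  using hom_ext[OF lin_hom[OF f] lin_hom[OF g] module_abelian_group[OF lin_module(2)[OF f]] t] eq .

lemma tsum_lift:
  assumes b: "bilin K M N P \<beta>"
    and bal: "\<And>a m n. a \<in> A \<Longrightarrow> m \<in> carrier M \<Longrightarrow> n \<in> carrier N \<Longrightarrow> \<beta> (r a m) n = \<beta> m (l a n)"
  shows "lin K T P (\<lambda>t. tsum P t \<beta>)"
    and "\<And>m n. m \<in> carrier M \<Longrightarrow> n \<in> carrier N \<Longrightarrow> tsum P (m \<boxtimes>\<^bsub>T\<^esub> n) \<beta> = \<beta> m n"
proof -
  interpret P: module K P by (rule bilin_module(3)[OF b])
  note u = tsum_hom_pure[of P \<beta>, OF P.abelian_group_axioms bilin_closed[OF b]
      lin_add[OF bilin_lin1[OF b]] lin_add[OF bilin_lin2[OF b]] bal]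
  show pure: "\<And>m n. m \<in> carrier M \<Longrightarrow> n \<in> carrier N \<Longrightarrow> tsum P (m \<boxtimes>\<^bsub>T\<^esub> n) \<beta> = \<beta> m n"
    by (rule u(2))
  have h: "(\<lambda>t. tsum P t \<beta>) \<in> hom (add_monoid T) (add_monoid P)" by (rule u(1))
  show "lin K T P (\<lambda>t. tsum P t \<beta>)"
  proof (rule linI[OF T_module P.module_axioms])
    fix x y assume "x \<in> carrier T" "y \<in> carrier T"
    then show "tsum P (x \<oplus>\<^bsub>T\<^esub> y) \<beta> = tsum P x \<beta> \<oplus>\<^bsub>P\<^esub> tsum P y \<beta>"
      using hom_mult[OF h] by simp
  next
    fix c x assume c: "c \<in> carrier K" "x \<in> carrier T"
    have k: "(\<lambda>p. c \<odot>\<^bsub>P\<^esub> p) \<in> hom (add_monoid P) (add_monoid P)"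
      using c by (auto simp: hom_def P.smult_r_distr)
    \<comment> \<open>Homogeneity is once more an equation between additive maps of
      \<open>x\<close>, so pure tensors suffice.\<close>
    show "tsum P (c \<odot>\<^bsub>T\<^esub> x) \<beta> = c \<odot>\<^bsub>P\<^esub> tsum P x \<beta>"
    proof (rule hom_ext[where P = P and h = "\<lambda>x. tsum P (c \<odot>\<^bsub>T\<^esub> x) \<beta>" and g = "\<lambda>x. c \<odot>\<^bsub>P\<^esub> tsum P x \<beta>"])
      show "(\<lambda>x. tsum P (c \<odot>\<^bsub>T\<^esub> x) \<beta>) \<in> hom (add_monoid T) (add_monoid P)"
        using hom_compose[OF smult_hom(1)[OF c(1)] h] by (simp add: comp_def)
      show "(\<lambda>x. c \<odot>\<^bsub>P\<^esub> tsum P x \<beta>) \<in> hom (add_monoid T) (add_monoid P)"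
        using hom_compose[OF h k] by (simp add: comp_def)
    qed (use c lin_smult[OF bilin_lin1[OF b]] pure in \<open>simp_all add: P.abelian_group_axioms smult_hom(2)\<close>)
  qed (use hom_in_carrier[OF h] in simp)
qed

lemma tsum_pure_id:
  assumes "t \<in> carrier T"
  shows "tsum T t (\<lambda>m n. m \<boxtimes>\<^bsub>T\<^esub> n) = t"
proof -
  note u = tsum_lift[OF bilin_pure, OF pure_balanced]
  show ?thesis
    by (rule lin_ext[OF u(1) lin_id]) (use assms T_module u(2) in auto)
qed

end

lemma tsum_struct_cong:
  "carrier G = carrier H \<Longrightarrow> add G = add H \<Longrightarrow> zero G = zero H \<Longrightarrow> tsum G t \<beta> = tsum H t \<beta>"
  unfolding tsum_def by (rule tensor_lift_struct_cong) simp_all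

lemma ktensor_module_pair:
  assumes "module K M" "module K N"
  shows "module_pair K M N (carrier K) (smult M) (smult N)"
proof -
  interpret M: module K M by fact
  interpret N: module K N by fact
  show ?thesis
    by unfold_locales (auto simp: M.R.m_comm simp flip: M.smult_assoc1)
qed

context
  fixes K :: "'k ring" and M :: "('k, 'm, 'x) module_scheme" and N :: "('k, 'n, 'y) module_scheme"
  assumes MN: "module K M" "module K N"
begin

interpretation module_pair K M N "carrier K" "smult M" "smult N"
  by (rule ktensor_module_pair[OF MN])

lemma ktensor_module: "module K (ktensor K M N)"
  unfolding ktensor_def by (rule T_module)

lemma is_tensor_ktensor: "is_tensor (ktensor K M N) M N"
  unfolding ktensor_def by (rule is_tensor_balanced)

lemma kpure_closed: "m \<in> carrier M \<Longrightarrow> n \<in> carrier N \<Longrightarrow> m \<boxtimes>\<^bsub>ktensor K M N\<^esub> n \<in> carrier (ktensor K M N)"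
  unfolding ktensor_def by (rule pure_closed)

lemma bilin_kpure: "bilin K M N (ktensor K M N) (\<lambda>m n. m \<boxtimes>\<^bsub>ktensor K M N\<^esub> n)"
  unfolding ktensor_def by (rule bilin_pure)

lemma ktensor_lin_ext:
  assumes "lin K (ktensor K M N) P f" "lin K (ktensor K M N) P g"
    "\<And>m n. m \<in> carrier M \<Longrightarrow> n \<in> carrier N \<Longrightarrow> f (m \<boxtimes>\<^bsub>ktensor K M N\<^esub> n) = g (m \<boxtimes>\<^bsub>ktensor K M N\<^esub> n)"
    "t \<in> carrier (ktensor K M N)"
  shows "f t = g t"
  using lin_ext[of P f g t] assms unfolding ktensor_def by blast

lemma tsum_kpure_id:
  "t \<in> carrier (ktensor K M N) \<Longrightarrow> tsum (ktensor K M N) t (\<lambda>m n. m \<boxtimes>\<^bsub>ktensor K M N\<^esub> n) = t"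
  unfolding ktensor_def by (rule tsum_pure_id)

end

section \<open>Linear maps out of tensor products over the ground ring\<close>

lemma lin_ktsum:
  assumes b: "bilin K M N P \<beta>"
  shows "lin K (ktensor K M N) P (\<lambda>t. tsum P t \<beta>)"
    and tsum_kpure: "\<And>m n. m \<in> carrier M \<Longrightarrow> n \<in> carrier N \<Longrightarrow> tsum P (m \<boxtimes>\<^bsub>ktensor K M N\<^esub> n) \<beta> = \<beta> m n"
proof -
  interpret module_pair K M N "carrier K" "smult M" "smult N"
    by (rule ktensor_module_pair) (rule bilin_module[OF b])+
  have bal: "\<beta> (a \<odot>\<^bsub>M\<^esub> m) n = \<beta> m (a \<odot>\<^bsub>N\<^esub> n)" 
    if "a \<in> carrier K" "m \<in> carrier M" "n \<in> carrier N" for a m n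
    using lin_smult[OF bilin_lin1[OF b]] lin_smult[OF bilin_lin2[OF b]] that by simp
  show "lin K (ktensor K M N) P (\<lambda>t. tsum P t \<beta>)"
    "\<And>m n. m \<in> carrier M \<Longrightarrow> n \<in> carrier N \<Longrightarrow> tsum P (m \<boxtimes>\<^bsub>ktensor K M N\<^esub> n) \<beta> = \<beta> m n"
    unfolding ktensor_def using tsum_lift[OF b bal] by blast+
qed

lemma lin_ktsum_arg:
  assumes "lin K V (ktensor K M N) g" "bilin K M N P \<beta>"
  shows "lin K V P (\<lambda>x. tsum P (g x) \<beta>)"
  using lin_compose[OF assms(1) lin_ktsum(1)[OF assms(2)]] .

lemma lin_kpure1: 
  assumes "lin K V M f" "module K N" "n \<in> carrier N"
  shows "lin K V (ktensor K M N) (\<lambda>x. f x \<boxtimes>\<^bsub>ktensor K M N\<^esub> n)"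
  by (rule lin_compose[OF assms(1) bilin_lin1[OF bilin_kpure]]) (rule lin_module(2)[OF assms(1)] assms)+

lemma lin_kpure2: 
  assumes "lin K V N f" "module K M" "m \<in> carrier M"
  shows "lin K V (ktensor K M N) (\<lambda>x. m \<boxtimes>\<^bsub>ktensor K M N\<^esub> f x)"
  by (rule lin_compose[OF assms(1) bilin_lin2[OF bilin_kpure]]) (rule lin_module(2)[OF assms(1)] assms)+


lemma lin_tensor_map:
  assumes f: "lin K M M' f" and g: "lin K N N' g"
  shows "lin K (ktensor K M N) (ktensor K M' N') (tensor_map (ktensor K M N) (ktensor K M' N') f g)"
    and tensor_map_pure: "\<And>m n. m \<in> carrier M \<Longrightarrow> n \<in> carrier N \<Longrightarrow>
      tensor_map (ktensor K M N) (ktensor K M' N') f g (m \<boxtimes>\<^bsub>ktensor K M N\<^esub> n) = f m \<boxtimes>\<^bsub>ktensor K M' N'\<^esub> g n"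
proof -
  have b: "bilin K M N (ktensor K M' N') (\<lambda>x y. f x \<boxtimes>\<^bsub>ktensor K M' N'\<^esub> g y)"
    by (rule bilin_comp[OF bilin_kpure f g]) (rule lin_module(2)[OF f] lin_module(2)[OF g])+
  show "lin K (ktensor K M N) (ktensor K M' N') (tensor_map (ktensor K M N) (ktensor K M' N') f g)"
    by (rule lin_cong[OF lin_ktsum(1)[OF b]]) (simp add: tensor_map_def)
  show "tensor_map (ktensor K M N) (ktensor K M' N') f g (m \<boxtimes>\<^bsub>ktensor K M N\<^esub> n) = f m \<boxtimes>\<^bsub>ktensor K M' N'\<^esub> g n"
    if "m \<in> carrier M" "n \<in> carrier N" for m n
    using that tsum_kpure[OF b] kpure_closed[OF lin_module(1)[OF f] lin_module(1)[OF g]]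
    by (simp add: tensor_map_def)
qed

section \<open>Coalgebras\<close>

lemma ground_module: "cring K \<Longrightarrow> module K (ground K)"
proof -
  assume "cring K"
  then interpret cring K .
  have "abelian_group (ground K)"
    by (rule abelian_groupI) (auto simp: ground_def a_ac intro: l_neg)
  then show ?thesis
    by (intro moduleI) (auto simp: ground_def cring_axioms l_distr r_distr m_assoc)
qed

text \<open>A coalgebra is a larger record than its underlying module, so
  \<open>tensor_coalg\<close> and the \<open>ktensor\<close> it is built on are different HOL
  objects. The relation compares exactly the fields that make up the module structure.\<close>

definition same_module ::
  "('k, 'v, 'x) module_scheme \<Rightarrow> ('k, 'v, 'y) module_scheme \<Rightarrow> bool" where
  "same_module V V' \<longleftrightarrow> carrier V = carrier V' \<and> add V = add V' \<and> zero V = zero V' \<and> smult V = smult V'"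

lemma same_module_refl: "same_module V V"
  by (simp add: same_module_def)

lemma same_module_sym: "same_module V V' \<Longrightarrow> same_module V' V"
  by (simp add: same_module_def)

text \<open>A genuine equality, because the construction reads nothing beyond the fields compared by
  \<open>same_module\<close>. Iterated tensor products formed from coalgebras and from bare modules
  therefore coincide.\<close>

lemma same_module_ktensor:
  "same_module M M' \<Longrightarrow> same_module N N' \<Longrightarrow> ktensor K M N = ktensor K M' N'"
  unfolding ktensor_def balanced_tensor_def tensor_group_def tensor_relators_def same_module_def
  by simp

lemma same_module_module:
  assumes "same_module V V'" "module K V" shows "module K V'"
proof -
  interpret module K V by fact
  have e: "carrier V' = carrier V" "add V' = add V" "zero V' = zero V" "smult V' = smult V"
    using assms(1) by (simp_all add: same_module_def)
  have "abelian_group V'"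
    by (rule abelian_groupI; unfold e) (auto simp: M.a_ac intro: M.l_neg)
  then show ?thesis
    by (intro moduleI) (simp_all add: e R.is_cring smult_l_distr smult_r_distr smult_assoc1)
qed

lemma same_module_lin:
  assumes "same_module V V'" "same_module W W'" "lin K V W f" shows "lin K V' W' f"
  using assms same_module_module[OF assms(1) lin_module(1)[OF assms(3)]]
    same_module_module[OF assms(2) lin_module(2)[OF assms(3)]]
  by (simp add: same_module_def lin_def)

lemma same_module_tsum: "same_module V V' \<Longrightarrow> tsum V t \<beta> = tsum V' t \<beta>"
  by (rule tsum_struct_cong) (simp_all add: same_module_def)

text \<open>The expressions in three Sweedler legs to which coassociativity can be applied; see
  \<open>coassoc_sum\<close>. Fixing one leg leaves a bilinear map that can be summed over the other
  two.\<close>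

definition trilin ::
  "'k ring \<Rightarrow> ('k, 'u, 'x) module_scheme \<Rightarrow> ('k, 'v, 'x1) module_scheme \<Rightarrow> ('k, 'w, 'x2) module_scheme \<Rightarrow>
   ('k, 'p, 'z) module_scheme \<Rightarrow> ('u \<Rightarrow> 'v \<Rightarrow> 'w \<Rightarrow> 'p) \<Rightarrow> bool" where
  "trilin K U V W P \<tau> \<longleftrightarrow> module K U \<and> module K V \<and> module K W \<and> module K P \<and>
     (\<forall>y\<in>carrier V. \<forall>z\<in>carrier W. lin K U P (\<lambda>x. \<tau> x y z)) \<and>
     (\<forall>x\<in>carrier U. \<forall>z\<in>carrier W. lin K V P (\<lambda>y. \<tau> x y z)) \<and>
     (\<forall>x\<in>carrier U. \<forall>y\<in>carrier V. lin K W P (\<lambda>z. \<tau> x y z))"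

lemma trilin_assoc_pure:
  assumes m: "module K X" "module K Y" "module K Z"
  shows "trilin K X Y Z (ktensor K X (ktensor K Y Z))
    (\<lambda>x y z. x \<boxtimes>\<^bsub>ktensor K X (ktensor K Y Z)\<^esub> (y \<boxtimes>\<^bsub>ktensor K Y Z\<^esub> z))"
  unfolding trilin_def using m
  by (auto intro!: ktensor_module lin_kpure1 lin_kpure2 lin_id kpure_closed)

lemma trilin_left:
  assumes t: "trilin K X Y Z P \<tau>"
  shows "bilin K (ktensor K X Y) Z P (\<lambda>w z. tsum P w (\<lambda>x y. \<tau> x y z))"
    "\<And>z. z \<in> carrier Z \<Longrightarrow> bilin K X Y P (\<lambda>x y. \<tau> x y z)"
proof -
  show b: "bilin K X Y P (\<lambda>x y. \<tau> x y z)" if "z \<in> carrier Z" for z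
    using t that by (auto simp: trilin_def intro!: bilinI)
  show "bilin K (ktensor K X Y) Z P (\<lambda>w z. tsum P w (\<lambda>x y. \<tau> x y z))"
    using t by (auto simp: trilin_def intro!: bilinI lin_ktsum b lin_tsum_fun[OF is_tensor_ktensor] ktensor_module)
qed

lemma trilin_right:
  assumes t: "trilin K X Y Z P \<tau>"
  shows "bilin K X (ktensor K Y Z) P (\<lambda>x w. tsum P w (\<tau> x))"
    "\<And>x. x \<in> carrier X \<Longrightarrow> bilin K Y Z P (\<tau> x)"
proof -
  show b: "bilin K Y Z P (\<tau> x)" if "x \<in> carrier X" for x
    using t that by (auto simp: trilin_def intro!: bilinI)
  show "bilin K X (ktensor K Y Z) P (\<lambda>x w. tsum P w (\<tau> x))"
    using t by (auto simp: trilin_def intro!: bilinI lin_ktsum b lin_tsum_fun[OF is_tensor_ktensor] ktensor_module)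
qed

context
  fixes K :: "'k ring" and X :: "('k, 'm, 'x) module_scheme" and Y :: "('k, 'n, 'y) module_scheme"
    and Z :: "('k, 'p, 'z) module_scheme"
  assumes m: "module K X" "module K Y" "module K Z"
begin


lemma lin_tensor_assoc: "lin K (ktensor K (ktensor K X Y) Z) (ktensor K X (ktensor K Y Z)) (tensor_assoc (ktensor K X (ktensor K Y Z)) (ktensor K Y Z))"
  unfolding tensor_assoc_def
  by (rule lin_ktsum(1)[OF trilin_left(1)[OF trilin_assoc_pure[OF m]]])

lemma tensor_assoc_pure_right:
  assumes "w \<in> carrier (ktensor K X Y)" "z \<in> carrier Z"
  shows "tensor_assoc (ktensor K X (ktensor K Y Z)) (ktensor K Y Z) (w \<boxtimes>\<^bsub>ktensor K (ktensor K X Y) Z\<^esub> z) = tsum (ktensor K X (ktensor K Y Z)) w (\<lambda>x y. x \<boxtimes>\<^bsub>ktensor K X (ktensor K Y Z)\<^esub> (y \<boxtimes>\<^bsub>ktensor K Y Z\<^esub> z))"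
  unfolding tensor_assoc_def
  by (rule lin_ktsum(2)[OF trilin_left(1)[OF trilin_assoc_pure[OF m]] assms])

lemma tensor_assoc_pure:
  assumes "x \<in> carrier X" "y \<in> carrier Y" "z \<in> carrier Z"
  shows "tensor_assoc (ktensor K X (ktensor K Y Z)) (ktensor K Y Z) ((x \<boxtimes>\<^bsub>ktensor K X Y\<^esub> y) \<boxtimes>\<^bsub>ktensor K (ktensor K X Y) Z\<^esub> z) = x \<boxtimes>\<^bsub>ktensor K X (ktensor K Y Z)\<^esub> (y \<boxtimes>\<^bsub>ktensor K Y Z\<^esub> z)"
  using assms m
  by (simp add: tensor_assoc_pure_right kpure_closed
      tsum_kpure[OF trilin_left(2)[OF trilin_assoc_pure[OF m]]])

text \<open>Extensionality is used twice: the outer use reduces to a product of some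
  \<open>w\<close> with \<open>z\<close>, the inner one, for fixed \<open>z\<close>, to a pure
  tensor \<open>w\<close>.\<close>

lemma ktensor3_lin_ext:
  assumes f: "lin K (ktensor K (ktensor K X Y) Z) P f" and g: "lin K (ktensor K (ktensor K X Y) Z) P g" and t: "t \<in> carrier (ktensor K (ktensor K X Y) Z)"
    and eq: "\<And>x y z. x \<in> carrier X \<Longrightarrow> y \<in> carrier Y \<Longrightarrow> z \<in> carrier Z \<Longrightarrow>
      f ((x \<boxtimes>\<^bsub>ktensor K X Y\<^esub> y) \<boxtimes>\<^bsub>ktensor K (ktensor K X Y) Z\<^esub> z) = g ((x \<boxtimes>\<^bsub>ktensor K X Y\<^esub> y) \<boxtimes>\<^bsub>ktensor K (ktensor K X Y) Z\<^esub> z)"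
  shows "f t = g t"
proof (rule ktensor_lin_ext[OF _ _ f g _ t])
  fix w z assume w: "w \<in> carrier (ktensor K X Y)" and z: "z \<in> carrier Z"
  have l: "lin K (ktensor K X Y) (ktensor K (ktensor K X Y) Z) (\<lambda>w. w \<boxtimes>\<^bsub>ktensor K (ktensor K X Y) Z\<^esub> z)"
    by (rule lin_kpure1[OF lin_id]) (use m z ktensor_module in auto)
  show "f (w \<boxtimes>\<^bsub>ktensor K (ktensor K X Y) Z\<^esub> z) = g (w \<boxtimes>\<^bsub>ktensor K (ktensor K X Y) Z\<^esub> z)"
    by (rule ktensor_lin_ext[OF m(1,2) lin_compose[OF l f] lin_compose[OF l g] _ w]) (rule eq[OF _ _ z])
qed (use m ktensor_module in auto)

end

section \<open>Sweedler calculus in a coalgebra\<close>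

locale coalg =
  fixes K :: "'k ring" and C :: "('k, 'c) coalgebra"
  assumes coalgebra: "coalgebra K C"
begin

abbreviation "\<Delta> \<equiv> comult C"
abbreviation "\<epsilon> \<equiv> counit C"
abbreviation "CC \<equiv> ktensor K C C"

lemma C_module: "module K C"
  using coalgebra by (simp add: coalgebra_def Let_def)

sublocale C: module K C by (rule C_module)

lemma CC_module: "module K CC"
  by (rule ktensor_module[OF C_module C_module])

lemma lin_comult: "lin K C CC \<Delta>"
  using coalgebra by (intro linear_maps_lin C_module CC_module) (simp add: coalgebra_def Let_def)

lemma lin_counit: "lin K C (ground K) \<epsilon>"
  using coalgebra by (intro linear_maps_lin C_module ground_module C.R.is_cring) (simp add: coalgebra_def Let_def)

lemma comult_closed: "x \<in> carrier C \<Longrightarrow> \<Delta> x \<in> carrier CC"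
  by (rule lin_closed[OF lin_comult])

lemma counit_closed: "x \<in> carrier C \<Longrightarrow> \<epsilon> x \<in> carrier K"
  using lin_closed[OF lin_counit] by (simp add: ground_def)

lemma is_tensor_CC: "is_tensor CC C C"
  by (rule is_tensor_ktensor[OF C_module C_module])

lemma csum_closed:
  assumes "module K P" "x \<in> carrier C" "\<And>a b. a \<in> carrier C \<Longrightarrow> b \<in> carrier C \<Longrightarrow> \<beta> a b \<in> carrier P"
  shows "tsum P (\<Delta> x) \<beta> \<in> carrier P"
  using abelian_group.tsum_closed[OF module_abelian_group[OF assms(1)] is_tensor_CC comult_closed] assms by blast

lemma csum_cong:
  assumes "x \<in> carrier C" "\<And>a b. a \<in> carrier C \<Longrightarrow> b \<in> carrier C \<Longrightarrow> \<beta> a b = \<gamma> a b"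
  shows "tsum P (\<Delta> x) \<beta> = tsum P (\<Delta> x) \<gamma>"
  using assms by (intro tsum_cong[OF is_tensor_CC comult_closed])

lemma csum_lin:
  assumes "lin K P Q h" "x \<in> carrier C" "\<And>a b. a \<in> carrier C \<Longrightarrow> b \<in> carrier C \<Longrightarrow> \<beta> a b \<in> carrier P"
  shows "h (tsum P (\<Delta> x) \<beta>) = tsum Q (\<Delta> x) (\<lambda>a b. h (\<beta> a b))"
  using assms by (intro lin_tsum[OF is_tensor_CC comult_closed])

lemma lin_csum_fun:
  assumes "module K V" "module K P" "x \<in> carrier C"
    "\<And>a b. a \<in> carrier C \<Longrightarrow> b \<in> carrier C \<Longrightarrow> lin K V P (\<lambda>v. \<beta> v a b)"
  shows "lin K V P (\<lambda>v. tsum P (\<Delta> x) (\<beta> v))"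
  using assms by (intro lin_tsum_fun[OF is_tensor_CC comult_closed])

lemma lin_csum_arg:
  assumes "lin K V C g" "bilin K C C P \<beta>"
  shows "lin K V P (\<lambda>v. tsum P (\<Delta> (g v)) \<beta>)"
  by (rule lin_ktsum_arg[OF lin_compose[OF assms(1) lin_comult] assms(2)])

lemma lin_csum: "bilin K C C P \<beta> \<Longrightarrow> lin K C P (\<lambda>v. tsum P (\<Delta> v) \<beta>)"
  by (rule lin_csum_arg[OF lin_id[OF C_module]])

text \<open>The axiom is an identity in a triple tensor product and involves
  \<open>tensor_assoc\<close>. Applying to it the linear map induced by \<open>\<tau>\<close> turns
  it into a rewrite rule for arbitrary trilinear expressions.\<close>

lemma coassoc_sum:
  assumes t: "trilin K C C C P \<tau>" and x: "x \<in> carrier C"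
  shows "tsum P (\<Delta> x) (\<lambda>a b. tsum P (\<Delta> a) (\<lambda>c d. \<tau> c d b)) = tsum P (\<Delta> x) (\<lambda>a b. tsum P (\<Delta> b) (\<tau> a))"
proof -
  let ?L = "ktensor K CC C" and ?R = "ktensor K C CC"
  let ?h = "\<lambda>r. tsum P r (\<lambda>a w. tsum P w (\<tau> a))"
  note m = C_module C_module C_module
  note h = lin_ktsum[OF trilin_right(1)[OF t]]
  have ha: "lin K ?L P (\<lambda>r. ?h (tensor_assoc ?R CC r))"
    by (rule lin_compose[OF lin_tensor_assoc[OF m] h(1)])
  \<comment> \<open>Reassociation opens the coproduct of \<open>a\<close> into a sum of pure triple
    tensors, on which the map induced by \<open>\<tau>\<close> is known.\<close>
  have 1: "?h (tensor_assoc ?R CC (\<Delta> a \<boxtimes>\<^bsub>?L\<^esub> b)) = tsum P (\<Delta> a) (\<lambda>c d. \<tau> c d b)"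
    if ab: "a \<in> carrier C" "b \<in> carrier C" for a b
  proof -
    have "?h (tensor_assoc ?R CC (\<Delta> a \<boxtimes>\<^bsub>?L\<^esub> b)) = ?h (tsum ?R (\<Delta> a) (\<lambda>c d. c \<boxtimes>\<^bsub>?R\<^esub> (d \<boxtimes>\<^bsub>CC\<^esub> b)))"
      using ab by (simp add: tensor_assoc_pure_right[OF m] comult_closed)
    also have "\<dots> = tsum P (\<Delta> a) (\<lambda>c d. ?h (c \<boxtimes>\<^bsub>?R\<^esub> (d \<boxtimes>\<^bsub>CC\<^esub> b)))"
      using ab m CC_module by (intro csum_lin[OF h(1)] kpure_closed)
    also have "\<dots> = tsum P (\<Delta> a) (\<lambda>c d. \<tau> c d b)"
      using ab by (intro csum_cong) (simp_all add: h(2) kpure_closed[OF C_module C_module]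
          tsum_kpure[OF trilin_right(2)[OF t]])
    finally show ?thesis .
  qed
  have "?h (tensor_assoc ?R CC (tsum ?L (\<Delta> x) (\<lambda>a b. \<Delta> a \<boxtimes>\<^bsub>?L\<^esub> b)))
     = tsum P (\<Delta> x) (\<lambda>a b. ?h (tensor_assoc ?R CC (\<Delta> a \<boxtimes>\<^bsub>?L\<^esub> b)))"
    using x by (intro csum_lin[OF ha] kpure_closed comult_closed C_module CC_module)
  also have "\<dots> = tsum P (\<Delta> x) (\<lambda>a b. tsum P (\<Delta> a) (\<lambda>c d. \<tau> c d b))"
    using x 1 by (intro csum_cong)
  finally have L: "?h (tensor_assoc ?R CC (tsum ?L (\<Delta> x) (\<lambda>a b. \<Delta> a \<boxtimes>\<^bsub>?L\<^esub> b)))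
     = tsum P (\<Delta> x) (\<lambda>a b. tsum P (\<Delta> a) (\<lambda>c d. \<tau> c d b))" .
  have "?h (tsum ?R (\<Delta> x) (\<lambda>a b. a \<boxtimes>\<^bsub>?R\<^esub> \<Delta> b)) = tsum P (\<Delta> x) (\<lambda>a b. ?h (a \<boxtimes>\<^bsub>?R\<^esub> \<Delta> b))"
    using x by (intro csum_lin[OF h(1)] kpure_closed comult_closed C_module CC_module)
  also have "\<dots> = tsum P (\<Delta> x) (\<lambda>a b. tsum P (\<Delta> b) (\<tau> a))"
    using x by (intro csum_cong h(2) comult_closed)
  finally show ?thesis
    using L coalgebra x by (simp add: coalgebra_def Let_def)
qed

text \<open>The counit axioms pushed through \<open>g\<close>, so that a leg meeting the counit can
  be removed inside any linear expression.\<close>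

lemma counit_sum:
  assumes g: "lin K C P g" and x: "x \<in> carrier C"
  shows "tsum P (\<Delta> x) (\<lambda>a b. \<epsilon> a \<odot>\<^bsub>P\<^esub> g b) = g x" "tsum P (\<Delta> x) (\<lambda>a b. \<epsilon> b \<odot>\<^bsub>P\<^esub> g a) = g x"
proof -
  have "g (tsum C (\<Delta> x) (\<lambda>a b. \<epsilon> a \<odot>\<^bsub>C\<^esub> b)) = tsum P (\<Delta> x) (\<lambda>a b. g (\<epsilon> a \<odot>\<^bsub>C\<^esub> b))"
    using x counit_closed by (intro csum_lin[OF g]) auto
  also have "\<dots> = tsum P (\<Delta> x) (\<lambda>a b. \<epsilon> a \<odot>\<^bsub>P\<^esub> g b)"
    using x counit_closed by (intro csum_cong lin_smult[OF g]) auto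
  finally show "tsum P (\<Delta> x) (\<lambda>a b. \<epsilon> a \<odot>\<^bsub>P\<^esub> g b) = g x"
    using coalgebra x by (simp add: coalgebra_def Let_def)
  have "g (tsum C (\<Delta> x) (\<lambda>a b. \<epsilon> b \<odot>\<^bsub>C\<^esub> a)) = tsum P (\<Delta> x) (\<lambda>a b. g (\<epsilon> b \<odot>\<^bsub>C\<^esub> a))"
    using x counit_closed by (intro csum_lin[OF g]) auto
  also have "\<dots> = tsum P (\<Delta> x) (\<lambda>a b. \<epsilon> b \<odot>\<^bsub>P\<^esub> g a)"
    using x counit_closed by (intro csum_cong lin_smult[OF g]) auto
  finally show "tsum P (\<Delta> x) (\<lambda>a b. \<epsilon> b \<odot>\<^bsub>P\<^esub> g a) = g x"
    using coalgebra x by (simp add: coalgebra_def Let_def)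
qed

end

lemma csum_swap:
  assumes "coalg K C" "coalg K D" "x \<in> carrier C" "y \<in> carrier D" "module K P"
    "\<And>a b c d. a \<in> carrier C \<Longrightarrow> b \<in> carrier C \<Longrightarrow> c \<in> carrier D \<Longrightarrow> d \<in> carrier D \<Longrightarrow> \<beta> a b c d \<in> carrier P"
  shows "tsum P (comult C x) (\<lambda>a b. tsum P (comult D y) (\<beta> a b))
       = tsum P (comult D y) (\<lambda>c d. tsum P (comult C x) (\<lambda>a b. \<beta> a b c d))"
proof -
  interpret C: coalg K C by fact
  interpret D: coalg K D by fact
  interpret P: module K P by fact
  show ?thesis
    using assms by (intro P.tsum_swap[OF C.is_tensor_CC C.comult_closed D.is_tensor_CC D.comult_closed])
qed

locale cocoalg = coalg +
  assumes cocoalgebra: "cocoalgebra K C"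
begin

lemma cocomm_sum:
  assumes b: "bilin K C C P \<beta>" and x: "x \<in> carrier C"
  shows "tsum P (\<Delta> x) (\<lambda>a b. \<beta> b a) = tsum P (\<Delta> x) \<beta>"
proof -
  let ?h = "\<lambda>w. tsum P w \<beta>"
  have "?h (tsum CC (\<Delta> x) (\<lambda>a b. b \<boxtimes>\<^bsub>CC\<^esub> a)) = tsum P (\<Delta> x) (\<lambda>a b. ?h (b \<boxtimes>\<^bsub>CC\<^esub> a))"
    using x by (intro csum_lin[OF lin_ktsum(1)[OF b]] kpure_closed C_module)
  also have "\<dots> = tsum P (\<Delta> x) (\<lambda>a b. \<beta> b a)"
    using x by (intro csum_cong tsum_kpure[OF b])
  finally show ?thesis using cocoalgebra x by (simp add: cocoalgebra_def)
qed

end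

lemma cocoalgI: "cocoalgebra K C \<Longrightarrow> cocoalg K C"
  by (simp add: cocoalg_def coalg_def cocoalg_axioms_def cocoalgebra_def)

text \<open>Cocommutativity derives one counit law from the other. Coassociativity is requested as
  an identity of iterated sums, the form in which it is obtained for concrete coalgebras, and
  \<open>tensor_assoc\<close> is dealt with here once.\<close>

lemma cocoalgebraI:
  fixes C :: "('k, 'c) coalgebra"
  assumes m: "module K C" and d: "comult C \<in> linear_maps K C (ktensor K C C)"
    and e: "counit C \<in> linear_maps K C (ground K)"
    and coassoc: "\<And>x. x \<in> carrier C \<Longrightarrow>
      tsum (ktensor K C (ktensor K C C)) (comult C x) (\<lambda>a b. tsum (ktensor K C (ktensor K C C)) (comult C a)
        (\<lambda>c d. c \<boxtimes>\<^bsub>ktensor K C (ktensor K C C)\<^esub> (d \<boxtimes>\<^bsub>ktensor K C C\<^esub> b)))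
      = tsum (ktensor K C (ktensor K C C)) (comult C x) (\<lambda>a b. tsum (ktensor K C (ktensor K C C)) (comult C b)
        (\<lambda>c d. a \<boxtimes>\<^bsub>ktensor K C (ktensor K C C)\<^esub> (c \<boxtimes>\<^bsub>ktensor K C C\<^esub> d)))"
    and counit: "\<And>x. x \<in> carrier C \<Longrightarrow> tsum C (comult C x) (\<lambda>a b. counit C a \<odot>\<^bsub>C\<^esub> b) = x"
    and cocomm: "\<And>x. x \<in> carrier C \<Longrightarrow>
      tsum (ktensor K C C) (comult C x) (\<lambda>a b. b \<boxtimes>\<^bsub>ktensor K C C\<^esub> a) = comult C x"
  shows "cocoalgebra K C"
proof -
  let ?CC = "ktensor K C C" let ?L = "ktensor K ?CC C" and ?R = "ktensor K C ?CC"
  note mm = ktensor_module[OF m m]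
  interpret module K C by fact
  have l: "lin K C ?CC (comult C)" by (rule linear_maps_lin[OF d m mm])
  have le: "lin K C (ground K) (counit C)" by (rule linear_maps_lin[OF e m ground_module[OF R.is_cring]])
  have ec: "counit C a \<in> carrier K" if "a \<in> carrier C" for a
    using lin_closed[OF le that] by (simp add: ground_def)
  have it: "is_tensor ?CC C C" by (rule is_tensor_ktensor[OF m m])
  have c: "comult C x \<in> carrier ?CC" if "x \<in> carrier C" for x using lin_closed[OF l that] .
  have 1: "tensor_assoc ?R ?CC (tsum ?L (comult C x) (\<lambda>a b. comult C a \<boxtimes>\<^bsub>?L\<^esub> b))
     = tsum ?R (comult C x) (\<lambda>a b. a \<boxtimes>\<^bsub>?R\<^esub> comult C b)" if x: "x \<in> carrier C" for x
  proof -
    have "tensor_assoc ?R ?CC (tsum ?L (comult C x) (\<lambda>a b. comult C a \<boxtimes>\<^bsub>?L\<^esub> b))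
      = tsum ?R (comult C x) (\<lambda>a b. tensor_assoc ?R ?CC (comult C a \<boxtimes>\<^bsub>?L\<^esub> b))"
      using x m mm c by (intro lin_tsum[OF it c _ lin_tensor_assoc[OF m m m]] kpure_closed)
    also have "\<dots> = tsum ?R (comult C x) (\<lambda>a b. tsum ?R (comult C a)
        (\<lambda>c d. c \<boxtimes>\<^bsub>?R\<^esub> (d \<boxtimes>\<^bsub>?CC\<^esub> b)))"
      using x c by (intro tsum_cong[OF it c] tensor_assoc_pure_right[OF m m m])
    also have "\<dots> = tsum ?R (comult C x) (\<lambda>a b. tsum ?R (comult C b)
        (\<lambda>c d. a \<boxtimes>\<^bsub>?R\<^esub> (c \<boxtimes>\<^bsub>?CC\<^esub> d)))" by (rule coassoc[OF x])
    also have "\<dots> = tsum ?R (comult C x) (\<lambda>a b. a \<boxtimes>\<^bsub>?R\<^esub> comult C b)"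
    proof (rule tsum_cong[OF it c[OF x]])
      fix a b assume ab: "a \<in> carrier C" "b \<in> carrier C"
      have "a \<boxtimes>\<^bsub>?R\<^esub> (tsum ?CC (comult C b) (\<lambda>c d. c \<boxtimes>\<^bsub>?CC\<^esub> d))
        = tsum ?R (comult C b) (\<lambda>c d. a \<boxtimes>\<^bsub>?R\<^esub> (c \<boxtimes>\<^bsub>?CC\<^esub> d))"
        using ab m mm c by (intro lin_tsum[OF it c _ bilin_lin2[OF bilin_kpure]] kpure_closed)
      then show "tsum ?R (comult C b) (\<lambda>c d. a \<boxtimes>\<^bsub>?R\<^esub> (c \<boxtimes>\<^bsub>?CC\<^esub> d)) = a \<boxtimes>\<^bsub>?R\<^esub> comult C b"
        using tsum_kpure_id[OF m m c[OF ab(2)]] by simp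
    qed
    finally show ?thesis .
  qed
  \<comment> \<open>The given counit law is evaluated on the flipped coproduct, which
    cocommutativity identifies with the coproduct.\<close>
  have 2: "tsum C (comult C x) (\<lambda>a b. counit C b \<odot>\<^bsub>C\<^esub> a) = x" if x: "x \<in> carrier C" for x
  proof -
    have b: "bilin K C C C (\<lambda>a b. counit C a \<odot>\<^bsub>C\<^esub> b)"
      using le ec by (intro bilinI m linI)
        (auto simp: lin_def ground_def smult_l_distr smult_r_distr smult_assoc1 R.m_comm
          simp flip: smult_assoc1)
    have "tsum C (tsum ?CC (comult C x) (\<lambda>a b. b \<boxtimes>\<^bsub>?CC\<^esub> a)) (\<lambda>a b. counit C a \<odot>\<^bsub>C\<^esub> b)
       = tsum C (comult C x) (\<lambda>a b. tsum C (b \<boxtimes>\<^bsub>?CC\<^esub> a) (\<lambda>a b. counit C a \<odot>\<^bsub>C\<^esub> b))"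
      using x m by (intro lin_tsum[OF it c _ lin_ktsum(1)[OF b]] kpure_closed)
    also have "\<dots> = tsum C (comult C x) (\<lambda>a b. counit C b \<odot>\<^bsub>C\<^esub> a)"
      using x by (intro tsum_cong[OF it c] tsum_kpure[OF b])
    finally show ?thesis using counit[OF x] cocomm[OF x] by simp
  qed
  show ?thesis
    unfolding cocoalgebra_def coalgebra_def Let_def using 1 2 m d e counit cocomm by simp
qed

section \<open>Tensor products of cocommutative coalgebras\<close>

locale cocoalg_pair = C: cocoalg K C + D: cocoalg K D
  for K :: "'k ring" and C :: "('k, 'c) coalgebra" and D :: "('k, 'd) coalgebra"
begin

abbreviation "T \<equiv> ktensor K C D"
abbreviation "TT \<equiv> ktensor K T T"
abbreviation "CD \<equiv> tensor_coalg K C D"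

lemma T_module: "module K T"
  by (rule ktensor_module[OF C.C_module D.C_module])

lemma TT_module: "module K TT"
  by (rule ktensor_module[OF T_module T_module])

lemma same_T: "same_module T CD"
  by (simp add: same_module_def tensor_coalg_def module.defs coalgebra.defs Let_def)

lemma carrier_CD: "carrier CD = carrier T"
  using same_T by (simp add: same_module_def)

lemma CD_module: "module K CD"
  by (rule same_module_module[OF same_T T_module])

lemma CD_ktensor: "ktensor K CD CD = TT"
  by (rule same_module_ktensor[OF same_module_sym[OF same_T] same_module_sym[OF same_T]])

lemma T_closed: "x \<in> carrier C \<Longrightarrow> y \<in> carrier D \<Longrightarrow> x \<boxtimes>\<^bsub>T\<^esub> y \<in> carrier T"
  by (rule kpure_closed[OF C.C_module D.C_module])

lemma lin_T1: "y \<in> carrier D \<Longrightarrow> lin K C T (\<lambda>x. x \<boxtimes>\<^bsub>T\<^esub> y)"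
  by (rule bilin_lin1[OF bilin_kpure[OF C.C_module D.C_module]])

lemma lin_T2: "x \<in> carrier C \<Longrightarrow> lin K D T (\<lambda>y. x \<boxtimes>\<^bsub>T\<^esub> y)"
  by (rule bilin_lin2[OF bilin_kpure[OF C.C_module D.C_module]])

lemma bilin_sum2:
  assumes P: "module K P"
    and l1: "\<And>b c d. b \<in> carrier C \<Longrightarrow> c \<in> carrier D \<Longrightarrow> d \<in> carrier D \<Longrightarrow> lin K C P (\<lambda>a. \<beta> a b c d)"
    and l2: "\<And>a c d. a \<in> carrier C \<Longrightarrow> c \<in> carrier D \<Longrightarrow> d \<in> carrier D \<Longrightarrow> lin K C P (\<lambda>b. \<beta> a b c d)"
    and l3: "\<And>a b d. a \<in> carrier C \<Longrightarrow> b \<in> carrier C \<Longrightarrow> d \<in> carrier D \<Longrightarrow> lin K D P (\<lambda>c. \<beta> a b c d)"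
    and l4: "\<And>a b c. a \<in> carrier C \<Longrightarrow> b \<in> carrier C \<Longrightarrow> c \<in> carrier D \<Longrightarrow> lin K D P (\<lambda>d. \<beta> a b c d)"
  shows "bilin K C D P (\<lambda>x y. tsum P (C.\<Delta> x) (\<lambda>a b. tsum P (D.\<Delta> y) (\<lambda>c d. \<beta> a b c d)))"
proof (rule bilinI[OF C.C_module D.C_module P])
  fix y assume y: "y \<in> carrier D"
  have "bilin K C C P (\<lambda>a b. tsum P (D.\<Delta> y) (\<lambda>c d. \<beta> a b c d))"
    by (rule bilinI[OF C.C_module C.C_module P]; rule D.lin_csum_fun[OF C.C_module P y])
       (simp_all add: l1 l2)
  then show "lin K C P (\<lambda>x. tsum P (C.\<Delta> x) (\<lambda>a b. tsum P (D.\<Delta> y) (\<lambda>c d. \<beta> a b c d)))"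
    by (rule C.lin_csum)
next
  fix x assume x: "x \<in> carrier C"
  show "lin K D P (\<lambda>y. tsum P (C.\<Delta> x) (\<lambda>a b. tsum P (D.\<Delta> y) (\<lambda>c d. \<beta> a b c d)))"
    by (rule C.lin_csum_fun[OF D.C_module P x], rule D.lin_csum, rule bilinI[OF D.C_module D.C_module P])
       (simp_all add: l3 l4)
qed

lemma bilin_sum2_T:
  assumes b: "bilin K T T P \<beta>"
  shows "bilin K C D P (\<lambda>x y. tsum P (C.\<Delta> x) (\<lambda>a b. tsum P (D.\<Delta> y)
           (\<lambda>c d. \<beta> (a \<boxtimes>\<^bsub>T\<^esub> c) (b \<boxtimes>\<^bsub>T\<^esub> d))))"
  by (rule bilin_sum2[OF bilin_module(3)[OF b]];
      rule lin_compose[OF lin_T1 bilin_lin1[OF b]] lin_compose[OF lin_T1 bilin_lin2[OF b]]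
        lin_compose[OF lin_T2 bilin_lin1[OF b]] lin_compose[OF lin_T2 bilin_lin2[OF b]])
     (simp_all add: T_closed)

lemma bilin_TT: "bilin K T T TT (\<lambda>s t. s \<boxtimes>\<^bsub>TT\<^esub> t)"
  by (rule bilin_kpure[OF T_module T_module])

lemma comult_CD: "t \<in> carrier T \<Longrightarrow> comult CD t = tsum TT t (\<lambda>x y. tsum TT (C.\<Delta> x) (\<lambda>x\<^sub>1 x\<^sub>2.
             tsum TT (D.\<Delta> y) (\<lambda>y\<^sub>1 y\<^sub>2. (x\<^sub>1 \<boxtimes>\<^bsub>T\<^esub> y\<^sub>1) \<boxtimes>\<^bsub>TT\<^esub> (x\<^sub>2 \<boxtimes>\<^bsub>T\<^esub> y\<^sub>2))))"
  by (simp add: tensor_coalg_def module.defs coalgebra.defs Let_def)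

lemma lin_comult_T: "lin K T TT (comult CD)"
  by (rule lin_cong[OF lin_ktsum(1)[OF bilin_sum2_T[OF bilin_TT]]]) (simp add: comult_CD)

lemma comult_pure:
  assumes "x \<in> carrier C" "y \<in> carrier D"
  shows "comult CD (x \<boxtimes>\<^bsub>T\<^esub> y) = tsum TT (C.\<Delta> x) (\<lambda>x\<^sub>1 x\<^sub>2.
             tsum TT (D.\<Delta> y) (\<lambda>y\<^sub>1 y\<^sub>2. (x\<^sub>1 \<boxtimes>\<^bsub>T\<^esub> y\<^sub>1) \<boxtimes>\<^bsub>TT\<^esub> (x\<^sub>2 \<boxtimes>\<^bsub>T\<^esub> y\<^sub>2)))"
  using assms by (simp add: comult_CD T_closed tsum_kpure[OF bilin_sum2_T[OF bilin_TT]])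

lemma comult_T_closed: "t \<in> carrier T \<Longrightarrow> comult CD t \<in> carrier TT"
  by (rule lin_closed[OF lin_comult_T])

lemma is_tensor_TT: "is_tensor TT T T"
  by (rule is_tensor_ktensor[OF T_module T_module])

lemma lin_comult_sum: "bilin K T T P \<beta> \<Longrightarrow> lin K T P (\<lambda>t. tsum P (comult CD t) \<beta>)"
  by (rule lin_ktsum_arg[OF lin_comult_T])

text \<open>Linearity pushes \<open>\<beta>\<close> through both nested sums of
  \<open>comult_pure\<close>. The laws of the tensor coalgebra, and later those of composite
  measurings, are computed with this rule on pure tensors.\<close>

lemma comult_sum:
  assumes b: "bilin K T T P \<beta>" and xy: "x \<in> carrier C" "y \<in> carrier D"
  shows "tsum P (comult CD (x \<boxtimes>\<^bsub>T\<^esub> y)) \<beta> =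
    tsum P (C.\<Delta> x) (\<lambda>a b. tsum P (D.\<Delta> y) (\<lambda>c d. \<beta> (a \<boxtimes>\<^bsub>T\<^esub> c) (b \<boxtimes>\<^bsub>T\<^esub> d)))"
proof -
  let ?h = "\<lambda>w. tsum P w \<beta>"
  note h = lin_ktsum[OF b]
  have cl: "(a \<boxtimes>\<^bsub>T\<^esub> c) \<boxtimes>\<^bsub>TT\<^esub> (b \<boxtimes>\<^bsub>T\<^esub> d) \<in> carrier TT"
    if "a \<in> carrier C" "b \<in> carrier C" "c \<in> carrier D" "d \<in> carrier D" for a b c d
    using that by (intro kpure_closed[OF T_module T_module] T_closed)
  have "?h (comult CD (x \<boxtimes>\<^bsub>T\<^esub> y)) = tsum P (C.\<Delta> x) (\<lambda>a b. ?h (tsum TT (D.\<Delta> y)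
       (\<lambda>c d. (a \<boxtimes>\<^bsub>T\<^esub> c) \<boxtimes>\<^bsub>TT\<^esub> (b \<boxtimes>\<^bsub>T\<^esub> d))))"
    unfolding comult_pure[OF xy] using xy cl
    by (intro C.csum_lin[OF h(1)] D.csum_closed TT_module)
  also have "\<dots> = tsum P (C.\<Delta> x) (\<lambda>a b. tsum P (D.\<Delta> y) (\<lambda>c d. ?h ((a \<boxtimes>\<^bsub>T\<^esub> c) \<boxtimes>\<^bsub>TT\<^esub> (b \<boxtimes>\<^bsub>T\<^esub> d))))"
    using xy cl by (intro C.csum_cong D.csum_lin[OF h(1)])
  also have "\<dots> = tsum P (C.\<Delta> x) (\<lambda>a b. tsum P (D.\<Delta> y) (\<lambda>c d. \<beta> (a \<boxtimes>\<^bsub>T\<^esub> c) (b \<boxtimes>\<^bsub>T\<^esub> d)))"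
    using xy by (intro C.csum_cong D.csum_cong h(2) T_closed)
  finally show ?thesis .
qed

lemma bilin_counit: "bilin K C D (ground K) (\<lambda>x y. C.\<epsilon> x \<otimes>\<^bsub>K\<^esub> D.\<epsilon> y)"
proof (rule bilinI[OF C.C_module D.C_module])
  show g: "module K (ground K)" by (rule ground_module[OF C.C.R.is_cring])
  note e = C.lin_counit[unfolded lin_def] D.lin_counit[unfolded lin_def]
  show "lin K C (ground K) (\<lambda>x. C.\<epsilon> x \<otimes>\<^bsub>K\<^esub> D.\<epsilon> y)" if "y \<in> carrier D" for y
    using e that
    by (intro linI C.C_module g) (simp_all add: ground_def C.C.R.l_distr C.C.R.m_assoc)
  show "lin K D (ground K) (\<lambda>y. C.\<epsilon> x \<otimes>\<^bsub>K\<^esub> D.\<epsilon> y)" if "x \<in> carrier C" for x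
    using e that
    by (intro linI D.C_module g) (simp_all add: ground_def C.C.R.r_distr C.C.R.m_lcomm)
qed

lemma counit_CD: "t \<in> carrier T \<Longrightarrow> counit CD t = tsum (ground K) t (\<lambda>x y. C.\<epsilon> x \<otimes>\<^bsub>K\<^esub> D.\<epsilon> y)"
  by (simp add: tensor_coalg_def module.defs coalgebra.defs Let_def)

lemma lin_counit_T: "lin K T (ground K) (counit CD)"
  by (rule lin_cong[OF lin_ktsum(1)[OF bilin_counit]]) (simp add: counit_CD)

lemma counit_pure:
  "x \<in> carrier C \<Longrightarrow> y \<in> carrier D \<Longrightarrow> counit CD (x \<boxtimes>\<^bsub>T\<^esub> y) = C.\<epsilon> x \<otimes>\<^bsub>K\<^esub> D.\<epsilon> y"
  by (simp add: counit_CD T_closed tsum_kpure[OF bilin_counit])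

text \<open>On a pure tensor each side unfolds into four nested sums, two over \<open>C\<close> and
  two over \<open>D\<close>. Sums over different coalgebras commute, so coassociativity can be used
  in each factor separately and the nesting restored afterwards.\<close>

lemma coassoc_T:
  assumes s: "trilin K T T T P \<sigma>" and t: "t \<in> carrier T"
  shows "tsum P (comult CD t) (\<lambda>s u. tsum P (comult CD s) (\<lambda>v w. \<sigma> v w u))
       = tsum P (comult CD t) (\<lambda>s u. tsum P (comult CD u) (\<lambda>v w. \<sigma> s v w))" (is "?l t = ?r t")
proof -
  have P: "module K P" using s by (simp add: trilin_def)
  have s1: "lin K T P (\<lambda>u. \<sigma> u v w)" if "v \<in> carrier T" "w \<in> carrier T" for v w
    using s that by (simp add: trilin_def)
  have s2: "lin K T P (\<lambda>v. \<sigma> u v w)" if "u \<in> carrier T" "w \<in> carrier T" for u w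
    using s that by (simp add: trilin_def)
  have s3: "lin K T P (\<lambda>w. \<sigma> u v w)" if "u \<in> carrier T" "v \<in> carrier T" for u v
    using s that by (simp add: trilin_def)
  have sc: "\<sigma> u v w \<in> carrier P" if "u \<in> carrier T" "v \<in> carrier T" "w \<in> carrier T" for u v w
    using lin_closed[OF s1[OF that(2,3)] that(1)] .
  have b3: "bilin K T T P (\<lambda>v w. \<sigma> v w u)" if "u \<in> carrier T" for u
    by (rule bilinI[OF T_module T_module P]) (simp_all add: s1 s2 that)
  have b1: "bilin K T T P (\<sigma> u)" if "u \<in> carrier T" for u
    by (rule bilinI[OF T_module T_module P]) (simp_all add: s2 s3 that)
  have bl: "bilin K T T P (\<lambda>s u. tsum P (comult CD s) (\<lambda>v w. \<sigma> v w u))"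
    by (rule bilinI[OF T_module T_module P], rule lin_comult_sum, rule b3, assumption,
        rule lin_tsum_fun[OF is_tensor_TT comult_T_closed T_module P], assumption, rule s3)
  have br: "bilin K T T P (\<lambda>s u. tsum P (comult CD u) (\<lambda>v w. \<sigma> s v w))"
    by (rule bilinI[OF T_module T_module P],
        rule lin_tsum_fun[OF is_tensor_TT comult_T_closed T_module P], assumption, rule s1,
        assumption, assumption, rule lin_comult_sum, rule b1)
  show ?thesis
  proof (rule ktensor_lin_ext[OF C.C_module D.C_module lin_comult_sum[OF bl] lin_comult_sum[OF br] _ t])
    fix x y assume x: "x \<in> carrier C" and y: "y \<in> carrier D"
    let ?\<sigma> = "\<lambda>a b c d e f. \<sigma> (a \<boxtimes>\<^bsub>T\<^esub> d) (b \<boxtimes>\<^bsub>T\<^esub> e) (c \<boxtimes>\<^bsub>T\<^esub> f)"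
    have cl: "?\<sigma> a b c d e f \<in> carrier P"
      if "a \<in> carrier C" "b \<in> carrier C" "c \<in> carrier C" "d \<in> carrier D" "e \<in> carrier D" "f \<in> carrier D"
      for a b c d e f
      using that by (intro sc T_closed)
    have "?l (x \<boxtimes>\<^bsub>T\<^esub> y) = tsum P (C.\<Delta> x) (\<lambda>a b. tsum P (D.\<Delta> y) (\<lambda>c d.
        tsum P (comult CD (a \<boxtimes>\<^bsub>T\<^esub> c)) (\<lambda>v w. \<sigma> v w (b \<boxtimes>\<^bsub>T\<^esub> d))))"
      by (rule comult_sum[OF bl x y])
    also have "\<dots> = tsum P (C.\<Delta> x) (\<lambda>a b. tsum P (D.\<Delta> y) (\<lambda>c d.
        tsum P (C.\<Delta> a) (\<lambda>a' b'. tsum P (D.\<Delta> c) (\<lambda>c' d'. ?\<sigma> a' b' b c' d' d))))"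
      by (intro C.csum_cong D.csum_cong comult_sum[OF b3] x y T_closed)
    \<comment> \<open>The sum over the coproduct of \<open>y\<close> is independent of the one over
      the coproduct of \<open>a\<close> and moves inside it, which makes the two sums over
      \<open>D\<close> adjacent.\<close>
    also have "\<dots> = tsum P (C.\<Delta> x) (\<lambda>a b. tsum P (C.\<Delta> a) (\<lambda>a' b'. tsum P (D.\<Delta> y) (\<lambda>c d.
        tsum P (D.\<Delta> c) (\<lambda>c' d'. ?\<sigma> a' b' b c' d' d))))"
      by (intro C.csum_cong csum_swap[OF D.coalg_axioms C.coalg_axioms] x y P D.csum_closed cl)
    also have "\<dots> = tsum P (C.\<Delta> x) (\<lambda>a b. tsum P (C.\<Delta> a) (\<lambda>a' b'. tsum P (D.\<Delta> y) (\<lambda>c d.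
        tsum P (D.\<Delta> d) (\<lambda>c' d'. ?\<sigma> a' b' b c c' d'))))"
    proof (intro C.csum_cong D.coassoc_sum x y)
      fix a b a' b' assume "b \<in> carrier C" "a' \<in> carrier C" "b' \<in> carrier C"
      then show "trilin K D D D P (\<lambda>c d e. ?\<sigma> a' b' b c d e)"
        unfolding trilin_def using D.C_module P
        by (auto intro!: lin_compose[OF lin_T2 s1] lin_compose[OF lin_T2 s2] lin_compose[OF lin_T2 s3] T_closed)
    qed
    also have "\<dots> = tsum P (C.\<Delta> x) (\<lambda>a b. tsum P (C.\<Delta> b) (\<lambda>a' b'. tsum P (D.\<Delta> y) (\<lambda>c d.
        tsum P (D.\<Delta> d) (\<lambda>c' d'. ?\<sigma> a a' b' c c' d'))))"
    proof (rule C.coassoc_sum[OF _ x])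
      show "trilin K C C C P (\<lambda>a a' b'. tsum P (D.\<Delta> y) (\<lambda>c d. tsum P (D.\<Delta> d) (\<lambda>c' d'. ?\<sigma> a a' b' c c' d')))"
        unfolding trilin_def using C.C_module P y
        by (auto intro!: D.lin_csum_fun lin_compose[OF lin_T1 s1] lin_compose[OF lin_T1 s2]
            lin_compose[OF lin_T1 s3] T_closed)
    qed
    also have "\<dots> = tsum P (C.\<Delta> x) (\<lambda>a b. tsum P (D.\<Delta> y) (\<lambda>c d. tsum P (C.\<Delta> b) (\<lambda>a' b'.
        tsum P (D.\<Delta> d) (\<lambda>c' d'. ?\<sigma> a a' b' c c' d'))))"
      by (intro C.csum_cong csum_swap[OF C.coalg_axioms D.coalg_axioms] x y P D.csum_closed cl)
    also have "\<dots> = tsum P (C.\<Delta> x) (\<lambda>a b. tsum P (D.\<Delta> y) (\<lambda>c d.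
        tsum P (comult CD (b \<boxtimes>\<^bsub>T\<^esub> d)) (\<sigma> (a \<boxtimes>\<^bsub>T\<^esub> c))))"
      by (intro C.csum_cong D.csum_cong comult_sum[OF b1, symmetric] x y T_closed)
    also have "\<dots> = ?r (x \<boxtimes>\<^bsub>T\<^esub> y)"
      by (rule comult_sum[OF br x y, symmetric])
    finally show "?l (x \<boxtimes>\<^bsub>T\<^esub> y) = ?r (x \<boxtimes>\<^bsub>T\<^esub> y)" .
  qed
qed

lemma comult_counit_T:
  assumes "t \<in> carrier T"
  shows "tsum T (comult CD t) (\<lambda>s u. counit CD s \<odot>\<^bsub>T\<^esub> u) = t"
proof -
  interpret T: module K T by (rule T_module)
  have e: "counit CD s \<in> carrier K" if "s \<in> carrier T" for s
    using lin_closed[OF lin_counit_T that] by (simp add: ground_def)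
  have b: "bilin K T T T (\<lambda>s u. counit CD s \<odot>\<^bsub>T\<^esub> u)"
    using lin_counit_T e by (intro bilinI T_module linI)
      (auto simp: lin_def ground_def T.smult_l_distr T.smult_r_distr T.smult_assoc1 C.C.R.m_comm
          simp flip: T.smult_assoc1)
  show ?thesis
  proof (rule ktensor_lin_ext[OF C.C_module D.C_module lin_comult_sum[OF b] lin_id[OF T_module] _ assms])
    fix x y assume x: "x \<in> carrier C" and y: "y \<in> carrier D"
    have "tsum T (comult CD (x \<boxtimes>\<^bsub>T\<^esub> y)) (\<lambda>s u. counit CD s \<odot>\<^bsub>T\<^esub> u)
      = tsum T (C.\<Delta> x) (\<lambda>a b. tsum T (D.\<Delta> y) (\<lambda>c d. counit CD (a \<boxtimes>\<^bsub>T\<^esub> c) \<odot>\<^bsub>T\<^esub> (b \<boxtimes>\<^bsub>T\<^esub> d)))"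
      by (rule comult_sum[OF b x y])
    \<comment> \<open>The two counit values are separated: that of \<open>c\<close> stays outside
      the tensor, that of \<open>a\<close> goes into the left factor. The counit law of
      \<open>D\<close>, then that of \<open>C\<close>, can be applied.\<close>
    also have "\<dots> = tsum T (C.\<Delta> x) (\<lambda>a b. tsum T (D.\<Delta> y) (\<lambda>c d. D.\<epsilon> c \<odot>\<^bsub>T\<^esub> ((C.\<epsilon> a \<odot>\<^bsub>C\<^esub> b) \<boxtimes>\<^bsub>T\<^esub> d)))"
    proof (intro C.csum_cong D.csum_cong x y)
      fix a b c d assume "a \<in> carrier C" "b \<in> carrier C" "c \<in> carrier D" "d \<in> carrier D"
      then show "counit CD (a \<boxtimes>\<^bsub>T\<^esub> c) \<odot>\<^bsub>T\<^esub> (b \<boxtimes>\<^bsub>T\<^esub> d) = D.\<epsilon> c \<odot>\<^bsub>T\<^esub> ((C.\<epsilon> a \<odot>\<^bsub>C\<^esub> b) \<boxtimes>\<^bsub>T\<^esub> d)"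
        using C.counit_closed D.counit_closed
        by (simp add: counit_pure lin_smult[OF lin_T1] T.smult_assoc1 T_closed C.C.R.m_comm[of "C.\<epsilon> a"])
    qed
    also have "\<dots> = tsum T (C.\<Delta> x) (\<lambda>a b. (C.\<epsilon> a \<odot>\<^bsub>C\<^esub> b) \<boxtimes>\<^bsub>T\<^esub> y)"
      using C.counit_closed by (intro C.csum_cong D.counit_sum lin_T2 x y) auto
    also have "\<dots> = tsum T (C.\<Delta> x) (\<lambda>a b. C.\<epsilon> a \<odot>\<^bsub>T\<^esub> (b \<boxtimes>\<^bsub>T\<^esub> y))"
      using C.counit_closed by (intro C.csum_cong lin_smult[OF lin_T1] x y) auto
    also have "\<dots> = x \<boxtimes>\<^bsub>T\<^esub> y"
      by (rule C.counit_sum(1)[OF lin_T1[OF y] x])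
    finally show "tsum T (comult CD (x \<boxtimes>\<^bsub>T\<^esub> y)) (\<lambda>s u. counit CD s \<odot>\<^bsub>T\<^esub> u) = x \<boxtimes>\<^bsub>T\<^esub> y" .
  qed
qed

lemma cocomm_T:
  assumes "t \<in> carrier T"
  shows "tsum TT (comult CD t) (\<lambda>s u. u \<boxtimes>\<^bsub>TT\<^esub> s) = comult CD t"
proof -
  note b = bilin_swap[OF bilin_TT]
  have l: "lin K C TT (\<lambda>b. (b \<boxtimes>\<^bsub>T\<^esub> d) \<boxtimes>\<^bsub>TT\<^esub> s)" "lin K C TT (\<lambda>b. s \<boxtimes>\<^bsub>TT\<^esub> (b \<boxtimes>\<^bsub>T\<^esub> d))"
    if "d \<in> carrier D" "s \<in> carrier T" for s d
    using lin_compose[OF lin_T1 bilin_lin1[OF bilin_TT]] lin_compose[OF lin_T1 bilin_lin2[OF bilin_TT]] that by auto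
  have m: "lin K D TT (\<lambda>d. (b \<boxtimes>\<^bsub>T\<^esub> d) \<boxtimes>\<^bsub>TT\<^esub> s)" "lin K D TT (\<lambda>d. s \<boxtimes>\<^bsub>TT\<^esub> (b \<boxtimes>\<^bsub>T\<^esub> d))"
    if "b \<in> carrier C" "s \<in> carrier T" for s b
    using lin_compose[OF lin_T2 bilin_lin1[OF bilin_TT]] lin_compose[OF lin_T2 bilin_lin2[OF bilin_TT]] that by auto
  show ?thesis
  proof (rule ktensor_lin_ext[OF C.C_module D.C_module lin_comult_sum[OF b] lin_comult_T _ assms])
    fix x y assume x: "x \<in> carrier C" and y: "y \<in> carrier D"
    have "tsum TT (comult CD (x \<boxtimes>\<^bsub>T\<^esub> y)) (\<lambda>s u. u \<boxtimes>\<^bsub>TT\<^esub> s)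
      = tsum TT (C.\<Delta> x) (\<lambda>a b. tsum TT (D.\<Delta> y) (\<lambda>c d. (b \<boxtimes>\<^bsub>T\<^esub> d) \<boxtimes>\<^bsub>TT\<^esub> (a \<boxtimes>\<^bsub>T\<^esub> c)))"
      by (rule comult_sum[OF b x y])
    \<comment> \<open>The flip on the tensor coalgebra is performed one factor at a time, here in
      \<open>D\<close> and next in \<open>C\<close>.\<close>
    also have "\<dots> = tsum TT (C.\<Delta> x) (\<lambda>a b. tsum TT (D.\<Delta> y) (\<lambda>c d. (b \<boxtimes>\<^bsub>T\<^esub> c) \<boxtimes>\<^bsub>TT\<^esub> (a \<boxtimes>\<^bsub>T\<^esub> d)))"
      by (intro C.csum_cong D.cocomm_sum x y bilinI D.C_module TT_module m T_closed)
    also have "\<dots> = tsum TT (C.\<Delta> x) (\<lambda>a b. tsum TT (D.\<Delta> y) (\<lambda>c d. (a \<boxtimes>\<^bsub>T\<^esub> c) \<boxtimes>\<^bsub>TT\<^esub> (b \<boxtimes>\<^bsub>T\<^esub> d)))"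
      by (intro C.cocomm_sum x y bilinI C.C_module TT_module D.lin_csum_fun l T_closed)
    also have "\<dots> = comult CD (x \<boxtimes>\<^bsub>T\<^esub> y)" by (rule comult_pure[OF x y, symmetric])
    finally show "tsum TT (comult CD (x \<boxtimes>\<^bsub>T\<^esub> y)) (\<lambda>s u. u \<boxtimes>\<^bsub>TT\<^esub> s) = comult CD (x \<boxtimes>\<^bsub>T\<^esub> y)" .
  qed
qed

lemma cocoalgebra_CD: "cocoalgebra K CD"
proof (rule cocoalgebraI)
  show "module K CD" by (rule CD_module)
  have e: "comult CD \<in> extensional (carrier CD)" "counit CD \<in> extensional (carrier CD)"
    unfolding carrier_CD by (simp_all add: tensor_coalg_def module.defs coalgebra.defs Let_def)
  show "comult CD \<in> linear_maps K CD (ktensor K CD CD)"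
    unfolding CD_ktensor
    by (rule lin_extensional_linear_maps[OF same_module_lin[OF same_T _ lin_comult_T] e(1)])
       (simp add: same_module_def)
  show "counit CD \<in> linear_maps K CD (ground K)"
    by (rule lin_extensional_linear_maps[OF same_module_lin[OF same_T _ lin_counit_T] e(2)])
       (simp add: same_module_def)
  have 1: "ktensor K CD TT = ktensor K T TT"
    by (rule same_module_ktensor[OF same_module_sym[OF same_T]]) (simp add: same_module_def)
  fix t assume "t \<in> carrier CD"
  then have t: "t \<in> carrier T" by (simp add: carrier_CD)
  let ?R = "ktensor K T TT"
  show "tsum (ktensor K CD (ktensor K CD CD)) (comult CD t) (\<lambda>a b. tsum (ktensor K CD (ktensor K CD CD)) (comult CD a)
          (\<lambda>c d. c \<boxtimes>\<^bsub>ktensor K CD (ktensor K CD CD)\<^esub> (d \<boxtimes>\<^bsub>ktensor K CD CD\<^esub> b))) =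
        tsum (ktensor K CD (ktensor K CD CD)) (comult CD t) (\<lambda>a b. tsum (ktensor K CD (ktensor K CD CD)) (comult CD b)
          (\<lambda>c d. a \<boxtimes>\<^bsub>ktensor K CD (ktensor K CD CD)\<^esub> (c \<boxtimes>\<^bsub>ktensor K CD CD\<^esub> d)))"
    unfolding CD_ktensor 1 by (rule coassoc_T[OF trilin_assoc_pure[OF T_module T_module T_module] t])
  have "smult CD = smult T" using same_T by (simp add: same_module_def)
  then show "tsum CD (comult CD t) (\<lambda>a b. counit CD a \<odot>\<^bsub>CD\<^esub> b) = t"
    using comult_counit_T[OF t] by (simp flip: same_module_tsum[OF same_T])
  show "tsum (ktensor K CD CD) (comult CD t) (\<lambda>a b. b \<boxtimes>\<^bsub>ktensor K CD CD\<^esub> a) = comult CD t"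
    unfolding CD_ktensor by (rule cocomm_T[OF t])
qed

sublocale CD: cocoalg K CD
  by (rule cocoalgI[OF cocoalgebra_CD])

end

section \<open>Morphisms of cocommutative coalgebras\<close>

text \<open>The morphisms of \<^const>\<open>cocoalg_hom\<close> without the extensionality convention.\<close>

definition chom :: "'k ring \<Rightarrow> ('k, 'c) coalgebra \<Rightarrow> ('k, 'd) coalgebra \<Rightarrow> ('c \<Rightarrow> 'd) \<Rightarrow> bool" where
  "chom K C D f \<longleftrightarrow> cocoalg K C \<and> cocoalg K D \<and> lin K C D f \<and>
     (\<forall>x\<in>carrier C. comult D (f x) = tsum (ktensor K D D) (comult C x) (\<lambda>a b. f a \<boxtimes>\<^bsub>ktensor K D D\<^esub> f b)) \<and>
     (\<forall>x\<in>carrier C. counit D (f x) = counit C x)"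

lemma chom_cocoalg: "chom K C D f \<Longrightarrow> cocoalg K C" "chom K C D f \<Longrightarrow> cocoalg K D"
  by (simp_all add: chom_def)

lemma chom_lin: "chom K C D f \<Longrightarrow> lin K C D f"
  by (simp add: chom_def)

lemma chom_counit: "chom K C D f \<Longrightarrow> x \<in> carrier C \<Longrightarrow> counit D (f x) = counit C x"
  by (simp add: chom_def)

lemma chom_closed: "chom K C D f \<Longrightarrow> x \<in> carrier C \<Longrightarrow> f x \<in> carrier D"
  by (rule lin_closed[OF chom_lin])

lemma cocoalg_hom_chom:
  assumes "f \<in> cocoalg_hom K C D" shows "chom K C D f"
proof -
  have c: "cocoalg K C" "cocoalg K D" and l: "f \<in> linear_maps K C D"
    using assms by (auto simp: cocoalg_hom_def intro: cocoalgI)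
  interpret C: cocoalg K C by fact
  interpret D: cocoalg K D by fact
  show ?thesis
    unfolding chom_def
    using assms c linear_maps_lin[OF l C.C_module D.C_module] C.comult_closed
    by (auto simp: cocoalg_hom_def tensor_map_def)
qed

text \<open>\<open>\<beta>\<close> factors through the tensor square of \<open>D\<close>, where
  compatibility with coproducts is stated. As a rule it replaces a Sweedler sum over
  \<open>f x\<close> by one over \<open>x\<close>.\<close>

lemma chom_sum:
  assumes f: "chom K C D f" and b: "bilin K D D P \<beta>" and x: "x \<in> carrier C"
  shows "tsum P (comult D (f x)) \<beta> = tsum P (comult C x) (\<lambda>a b. \<beta> (f a) (f b))"
proof -
  interpret C: cocoalg K C by (rule chom_cocoalg(1)[OF f])
  interpret D: cocoalg K D by (rule chom_cocoalg(2)[OF f])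
  note h = lin_ktsum[OF b]
  have "tsum P (comult D (f x)) \<beta> = tsum P (tsum D.CC (C.\<Delta> x) (\<lambda>a b. f a \<boxtimes>\<^bsub>D.CC\<^esub> f b)) \<beta>"
    using f x by (simp add: chom_def)
  also have "\<dots> = tsum P (C.\<Delta> x) (\<lambda>a b. tsum P (f a \<boxtimes>\<^bsub>D.CC\<^esub> f b) \<beta>)"
    by (intro C.csum_lin[OF h(1)] x kpure_closed D.C_module chom_closed[OF f])
  also have "\<dots> = tsum P (C.\<Delta> x) (\<lambda>a b. \<beta> (f a) (f b))"
    by (intro C.csum_cong h(2) x chom_closed[OF f])
  finally show ?thesis .
qed

lemma chom_compose:
  assumes f: "chom K C D f" and g: "chom K D E g" shows "chom K C E (\<lambda>x. g (f x))"
proof -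
  interpret E: cocoalg K E by (rule chom_cocoalg(2)[OF g])
  have b: "bilin K D D E.CC (\<lambda>a b. g a \<boxtimes>\<^bsub>E.CC\<^esub> g b)"
    by (rule bilin_comp[OF bilin_kpure[OF E.C_module E.C_module] chom_lin[OF g] chom_lin[OF g]])
  show ?thesis
    using f g chom_cocoalg[OF f] chom_cocoalg[OF g] lin_compose[OF chom_lin[OF f] chom_lin[OF g]]
      chom_sum[OF f b] chom_closed[OF f]
    by (simp add: chom_def)
qed

lemma chom_cong:
  assumes f: "chom K C D f" and eq: "\<And>x. x \<in> carrier C \<Longrightarrow> f x = g x" shows "chom K C D g"
proof -
  interpret C: cocoalg K C by (rule chom_cocoalg(1)[OF f])
  have "tsum P (C.\<Delta> x) (\<lambda>a b. f a \<boxtimes>\<^bsub>P\<^esub> f b) = tsum P (C.\<Delta> x) (\<lambda>a b. g a \<boxtimes>\<^bsub>P\<^esub> g b)"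
    if "x \<in> carrier C" for x and P :: "('a, ('c, 'c) tensor) module"
    using that eq by (intro C.csum_cong) auto
  then show ?thesis
    using f eq lin_cong[OF chom_lin[OF f] eq] by (simp add: chom_def)
qed

lemma chom_id: "cocoalg K C \<Longrightarrow> chom K C C (\<lambda>x. x)"
proof -
  assume "cocoalg K C"
  then interpret cocoalg K C .
  show ?thesis
    using tsum_kpure_id[OF C_module C_module comult_closed] cocoalg_axioms lin_id[OF C_module]
    by (simp add: chom_def)
qed

lemma chom_restrict_cocoalg_hom:
  assumes f: "chom K C D f" shows "restrict f (carrier C) \<in> cocoalg_hom K C D"
proof -
  interpret C: cocoalg K C by (rule chom_cocoalg(1)[OF f])
  interpret D: cocoalg K D by (rule chom_cocoalg(2)[OF f])
  have g: "chom K C D (restrict f (carrier C))" by (rule chom_cong[OF f]) simp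
  then show ?thesis
    using lin_linear_maps[OF chom_lin[OF f]] C.cocoalgebra D.cocoalgebra C.comult_closed
    by (simp add: cocoalg_hom_def tensor_map_def chom_def)
qed

context cocoalg_pair
begin

lemma chom_from_tensorI:
  assumes E: "cocoalg K E" and f: "lin K T E f"
    and comult: "\<And>x y. x \<in> carrier C \<Longrightarrow> y \<in> carrier D \<Longrightarrow> comult E (f (x \<boxtimes>\<^bsub>T\<^esub> y)) =
      tsum (ktensor K E E) (C.\<Delta> x) (\<lambda>a b. tsum (ktensor K E E) (D.\<Delta> y)
        (\<lambda>c d. f (a \<boxtimes>\<^bsub>T\<^esub> c) \<boxtimes>\<^bsub>ktensor K E E\<^esub> f (b \<boxtimes>\<^bsub>T\<^esub> d)))"
    and counit: "\<And>x y. x \<in> carrier C \<Longrightarrow> y \<in> carrier D \<Longrightarrow>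
      counit E (f (x \<boxtimes>\<^bsub>T\<^esub> y)) = C.\<epsilon> x \<otimes>\<^bsub>K\<^esub> D.\<epsilon> y"
  shows "chom K CD E f"
proof -
  interpret E: cocoalg K E by fact
  have b: "bilin K T T E.CC (\<lambda>s t. f s \<boxtimes>\<^bsub>E.CC\<^esub> f t)"
    by (rule bilin_comp[OF bilin_kpure[OF E.C_module E.C_module] f f])
  have "comult E (f t) = tsum E.CC (comult CD t) (\<lambda>s t. f s \<boxtimes>\<^bsub>E.CC\<^esub> f t)" if "t \<in> carrier T" for t
    by (rule ktensor_lin_ext[OF C.C_module D.C_module lin_compose[OF f E.lin_comult] lin_comult_sum[OF b] _ that])
       (simp add: comult comult_sum[OF b])
  moreover have "counit E (f t) = counit CD t" if "t \<in> carrier T" for t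
    by (rule ktensor_lin_ext[OF C.C_module D.C_module lin_compose[OF f E.lin_counit] lin_counit_T _ that])
       (simp add: counit counit_pure)
  moreover have "lin K CD E f"
    by (rule same_module_lin[OF same_T _ f]) (simp add: same_module_def)
  ultimately show ?thesis
    using E CD.cocoalg_axioms by (simp add: chom_def carrier_CD)
qed

end

text \<open>The coproduct of the tensor coalgebra is assembled from those of its factors, so each
  morphism law is applied to its own sum while the other sum is held fixed.\<close>

lemma chom_tensor_map:
  assumes f: "chom K C C' f" and g: "chom K D D' g"
  shows "chom K (tensor_coalg K C D) (tensor_coalg K C' D') (tensor_map (ktensor K C D) (ktensor K C' D') f g)"
    and "\<And>x y. x \<in> carrier C \<Longrightarrow> y \<in> carrier D \<Longrightarrow>
      tensor_map (ktensor K C D) (ktensor K C' D') f g (x \<boxtimes>\<^bsub>ktensor K C D\<^esub> y) = f x \<boxtimes>\<^bsub>ktensor K C' D'\<^esub> g y"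
proof -
  interpret X: cocoalg_pair K C D
    by (intro cocoalg_pair.intro chom_cocoalg(1)[OF f] chom_cocoalg(1)[OF g])
  interpret Y: cocoalg_pair K C' D'
    by (intro cocoalg_pair.intro chom_cocoalg(2)[OF f] chom_cocoalg(2)[OF g])
  let ?F = "tensor_map X.T Y.T f g"
  show pure: "\<And>x y. x \<in> carrier C \<Longrightarrow> y \<in> carrier D \<Longrightarrow> ?F (x \<boxtimes>\<^bsub>X.T\<^esub> y) = f x \<boxtimes>\<^bsub>Y.T\<^esub> g y"
    by (rule tensor_map_pure[OF chom_lin[OF f] chom_lin[OF g]])
  have l: "lin K X.T Y.T ?F"
    by (rule lin_tensor_map(1)[OF chom_lin[OF f] chom_lin[OF g]])
  show "chom K X.CD Y.CD ?F"
  proof (rule X.chom_from_tensorI[OF Y.CD.cocoalg_axioms])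
    show "lin K X.T Y.CD ?F"
      by (rule same_module_lin[OF _ Y.same_T l]) (simp add: same_module_def)
    fix x y assume x: "x \<in> carrier C" and y: "y \<in> carrier D"
    note cl = chom_closed[OF f] chom_closed[OF g]
    show "counit Y.CD (?F (x \<boxtimes>\<^bsub>X.T\<^esub> y)) = X.C.\<epsilon> x \<otimes>\<^bsub>K\<^esub> X.D.\<epsilon> y"
      using x y by (simp add: pure Y.counit_pure cl chom_counit[OF f] chom_counit[OF g])
    have l1: "lin K C' Y.TT (\<lambda>a. (a \<boxtimes>\<^bsub>Y.T\<^esub> c) \<boxtimes>\<^bsub>Y.TT\<^esub> t)" "lin K C' Y.TT (\<lambda>a. t \<boxtimes>\<^bsub>Y.TT\<^esub> (a \<boxtimes>\<^bsub>Y.T\<^esub> c))"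
      if "c \<in> carrier D'" "t \<in> carrier Y.T" for t c
      using lin_compose[OF Y.lin_T1 bilin_lin1[OF Y.bilin_TT]] lin_compose[OF Y.lin_T1 bilin_lin2[OF Y.bilin_TT]] that
      by auto
    have l2: "lin K D' Y.TT (\<lambda>a. (c \<boxtimes>\<^bsub>Y.T\<^esub> a) \<boxtimes>\<^bsub>Y.TT\<^esub> t)" "lin K D' Y.TT (\<lambda>a. t \<boxtimes>\<^bsub>Y.TT\<^esub> (c \<boxtimes>\<^bsub>Y.T\<^esub> a))"
      if "c \<in> carrier C'" "t \<in> carrier Y.T" for t c
      using lin_compose[OF Y.lin_T2 bilin_lin1[OF Y.bilin_TT]] lin_compose[OF Y.lin_T2 bilin_lin2[OF Y.bilin_TT]] that
      by auto
    have "comult Y.CD (?F (x \<boxtimes>\<^bsub>X.T\<^esub> y)) = tsum Y.TT (Y.C.\<Delta> (f x)) (\<lambda>a b. tsum Y.TT (Y.D.\<Delta> (g y))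
        (\<lambda>c d. (a \<boxtimes>\<^bsub>Y.T\<^esub> c) \<boxtimes>\<^bsub>Y.TT\<^esub> (b \<boxtimes>\<^bsub>Y.T\<^esub> d)))"
      using x y by (simp add: pure Y.comult_pure cl)
    also have "\<dots> = tsum Y.TT (X.C.\<Delta> x) (\<lambda>a b. tsum Y.TT (Y.D.\<Delta> (g y))
        (\<lambda>c d. (f a \<boxtimes>\<^bsub>Y.T\<^esub> c) \<boxtimes>\<^bsub>Y.TT\<^esub> (f b \<boxtimes>\<^bsub>Y.T\<^esub> d)))"
      by (intro chom_sum[OF f] x y bilinI Y.C.C_module Y.TT_module Y.D.lin_csum_fun l1 Y.T_closed cl)
    also have "\<dots> = tsum Y.TT (X.C.\<Delta> x) (\<lambda>a b. tsum Y.TT (X.D.\<Delta> y)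
        (\<lambda>c d. (f a \<boxtimes>\<^bsub>Y.T\<^esub> g c) \<boxtimes>\<^bsub>Y.TT\<^esub> (f b \<boxtimes>\<^bsub>Y.T\<^esub> g d)))"
      by (intro X.C.csum_cong chom_sum[OF g] x y bilinI Y.D.C_module Y.TT_module l2 Y.T_closed cl)
    also have "\<dots> = tsum Y.TT (X.C.\<Delta> x) (\<lambda>a b. tsum Y.TT (X.D.\<Delta> y)
        (\<lambda>c d. ?F (a \<boxtimes>\<^bsub>X.T\<^esub> c) \<boxtimes>\<^bsub>Y.TT\<^esub> ?F (b \<boxtimes>\<^bsub>X.T\<^esub> d)))"
      by (intro X.C.csum_cong X.D.csum_cong x y) (simp add: pure)
    finally show "comult Y.CD (?F (x \<boxtimes>\<^bsub>X.T\<^esub> y)) = tsum (ktensor K Y.CD Y.CD) (X.C.\<Delta> x) (\<lambda>a b.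
        tsum (ktensor K Y.CD Y.CD) (X.D.\<Delta> y)
        (\<lambda>c d. ?F (a \<boxtimes>\<^bsub>X.T\<^esub> c) \<boxtimes>\<^bsub>ktensor K Y.CD Y.CD\<^esub> ?F (b \<boxtimes>\<^bsub>X.T\<^esub> d)))"
      unfolding Y.CD_ktensor .
  qed
qed

section \<open>Reassociation as a morphism of coalgebras\<close>

locale cocoalg_triple = C: cocoalg K C + D: cocoalg K D + E: cocoalg K E
  for K :: "'k ring" and C :: "('k, 'c) coalgebra" and D :: "('k, 'd) coalgebra" and E :: "('k, 'e) coalgebra"
begin

sublocale CD: cocoalg_pair K C D by unfold_locales
sublocale DE: cocoalg_pair K D E by unfold_locales
sublocale L: cocoalg_pair K "tensor_coalg K C D" E by unfold_locales
sublocale R: cocoalg_pair K C "tensor_coalg K D E" by unfold_locales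

abbreviation "R3 \<equiv> ktensor K C DE.T"
abbreviation "L3 \<equiv> ktensor K CD.T E"

text \<open>\<open>L.T\<close> is formed from the coalgebra on the double tensors, \<open>L3\<close>
  from the bare module. Coalgebra maps refer to the former, the laws of an enriched category to the
  latter.\<close>

lemma L_T: "L.T = L3"
  by (rule same_module_ktensor[OF same_module_sym[OF CD.same_T]]) (simp add: same_module_def)

lemma R_T: "R.T = R3"
  by (rule same_module_ktensor[OF _ same_module_sym[OF DE.same_T]]) (simp add: same_module_def)

lemma assoc_pure:
  "x \<in> carrier C \<Longrightarrow> y \<in> carrier D \<Longrightarrow> z \<in> carrier E \<Longrightarrow>
   tensor_assoc R3 DE.T ((x \<boxtimes>\<^bsub>CD.T\<^esub> y) \<boxtimes>\<^bsub>L.T\<^esub> z) = x \<boxtimes>\<^bsub>R.T\<^esub> (y \<boxtimes>\<^bsub>DE.T\<^esub> z)"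
  unfolding L_T R_T by (rule tensor_assoc_pure[OF C.C_module D.C_module E.C_module])

lemma lin_assoc: "lin K L.T R.T (tensor_assoc R3 DE.T)"
  unfolding L_T R_T by (rule lin_tensor_assoc[OF C.C_module D.C_module E.C_module])

lemma lin_assoc_coalg: "lin K L.CD R.CD (tensor_assoc R3 DE.T)"
  by (rule same_module_lin[OF L.same_T R.same_T lin_assoc])

lemma assoc_closed: "w \<in> carrier L.T \<Longrightarrow> tensor_assoc R3 DE.T w \<in> carrier R.T"
  by (rule lin_closed[OF lin_assoc])

text \<open>Uniqueness of induced maps compares coalgebra maps with a common source, so one
  bracketing of a triple composite has to be pulled back along the associator. On pure triple
  tensors both coproducts expand to the same threefold Sweedler sum.\<close>

lemma chom_assoc: "chom K L.CD R.CD (tensor_assoc R3 DE.T)"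
proof -
  let ?a = "tensor_assoc R3 DE.T"
  have b: "bilin K L.T L.T R.TT (\<lambda>s t. ?a s \<boxtimes>\<^bsub>R.TT\<^esub> ?a t)"
    by (rule bilin_comp[OF R.bilin_TT lin_assoc lin_assoc])
  have "comult R.CD (?a t) = tsum R.TT (comult L.CD t) (\<lambda>s t. ?a s \<boxtimes>\<^bsub>R.TT\<^esub> ?a t)"
    if t: "t \<in> carrier L3" for t
  proof (rule ktensor3_lin_ext[OF C.C_module D.C_module E.C_module
        lin_compose[OF lin_assoc R.lin_comult_T, unfolded L_T]
        L.lin_comult_sum[OF b, unfolded L_T] t])
    fix x y z assume x: "x \<in> carrier C" and y: "y \<in> carrier D" and z: "z \<in> carrier E"
    let ?p = "\<lambda>a c e. a \<boxtimes>\<^bsub>R.T\<^esub> (c \<boxtimes>\<^bsub>DE.T\<^esub> e)"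
    let ?q = "\<lambda>a c e. (a \<boxtimes>\<^bsub>CD.T\<^esub> c) \<boxtimes>\<^bsub>L.T\<^esub> e"
    have cd: "u \<in> carrier CD.T \<Longrightarrow> u \<in> carrier (tensor_coalg K C D)" for u by (simp add: CD.carrier_CD)
    have de: "u \<in> carrier DE.T \<Longrightarrow> u \<in> carrier (tensor_coalg K D E)" for u by (simp add: DE.carrier_CD)
    \<comment> \<open>The coproduct of a triple tensor first splits it over \<open>CD.T\<close> and
      \<open>E\<close>. With \<open>z\<close> fixed, what remains must be bilinear on
      \<open>CD.T\<close> before the coproduct of that factor can be expanded.\<close>
    have bq: "bilin K CD.T CD.T R.TT (\<lambda>u v. tsum R.TT (E.\<Delta> z) (\<lambda>e f. ?a (u \<boxtimes>\<^bsub>L.T\<^esub> e) \<boxtimes>\<^bsub>R.TT\<^esub> ?a (v \<boxtimes>\<^bsub>L.T\<^esub> f)))"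
    proof (intro bilinI CD.T_module R.TT_module E.lin_csum_fun z)
      have l: "lin K CD.T L.T (\<lambda>u. u \<boxtimes>\<^bsub>L.T\<^esub> e)" if "e \<in> carrier E" for e
        by (rule same_module_lin[OF same_module_sym[OF CD.same_T] _ L.lin_T1[OF that]]) (simp add: same_module_def)
      note l = lin_compose[OF l lin_assoc]
      show "lin K CD.T R.TT (\<lambda>x. ?a (x \<boxtimes>\<^bsub>L.T\<^esub> e) \<boxtimes>\<^bsub>R.TT\<^esub> ?a (v \<boxtimes>\<^bsub>L.T\<^esub> f))"
        if "e \<in> carrier E" "f \<in> carrier E" "v \<in> carrier CD.T" for v e f
        by (rule lin_compose[OF l bilin_lin1[OF R.bilin_TT]]) (intro that assoc_closed L.T_closed cd)+
      show "lin K CD.T R.TT (\<lambda>x. ?a (v \<boxtimes>\<^bsub>L.T\<^esub> e) \<boxtimes>\<^bsub>R.TT\<^esub> ?a (x \<boxtimes>\<^bsub>L.T\<^esub> f))"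
        if "e \<in> carrier E" "f \<in> carrier E" "v \<in> carrier CD.T" for v e f
        by (rule lin_compose[OF l bilin_lin2[OF R.bilin_TT]]) (intro that assoc_closed L.T_closed cd)+
    qed
    have br: "bilin K DE.T DE.T R.TT (\<lambda>u v. (a \<boxtimes>\<^bsub>R.T\<^esub> u) \<boxtimes>\<^bsub>R.TT\<^esub> (b \<boxtimes>\<^bsub>R.T\<^esub> v))"
      if "a \<in> carrier C" "b \<in> carrier C" for a b
    proof -
      have l: "lin K DE.T R.T (\<lambda>u. c \<boxtimes>\<^bsub>R.T\<^esub> u)" if "c \<in> carrier C" for c
        by (rule same_module_lin[OF same_module_sym[OF DE.same_T] _ R.lin_T2[OF that]]) (simp add: same_module_def)
      show ?thesis by (rule bilin_comp[OF R.bilin_TT l[OF that(1)] l[OF that(2)]])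
    qed
    have "tsum R.TT (comult L.CD (?q x y z)) (\<lambda>s t. ?a s \<boxtimes>\<^bsub>R.TT\<^esub> ?a t)
      = tsum R.TT (comult CD.CD (x \<boxtimes>\<^bsub>CD.T\<^esub> y)) (\<lambda>u v. tsum R.TT (E.\<Delta> z) (\<lambda>e f.
          ?a (u \<boxtimes>\<^bsub>L.T\<^esub> e) \<boxtimes>\<^bsub>R.TT\<^esub> ?a (v \<boxtimes>\<^bsub>L.T\<^esub> f)))"
      by (rule L.comult_sum[OF b cd[OF CD.T_closed[OF x y]] z])
    also have "\<dots> = tsum R.TT (C.\<Delta> x) (\<lambda>a b. tsum R.TT (D.\<Delta> y) (\<lambda>c d. tsum R.TT (E.\<Delta> z) (\<lambda>e f.
          ?a (?q a c e) \<boxtimes>\<^bsub>R.TT\<^esub> ?a (?q b d f))))"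
      by (rule CD.comult_sum[OF bq x y])
    also have "\<dots> = tsum R.TT (C.\<Delta> x) (\<lambda>a b. tsum R.TT (D.\<Delta> y) (\<lambda>c d. tsum R.TT (E.\<Delta> z) (\<lambda>e f.
          ?p a c e \<boxtimes>\<^bsub>R.TT\<^esub> ?p b d f)))"
      by (intro C.csum_cong D.csum_cong E.csum_cong x y z) (simp add: assoc_pure)
    also have "\<dots> = tsum R.TT (C.\<Delta> x) (\<lambda>a b. tsum R.TT (comult DE.CD (y \<boxtimes>\<^bsub>DE.T\<^esub> z))
        (\<lambda>u v. (a \<boxtimes>\<^bsub>R.T\<^esub> u) \<boxtimes>\<^bsub>R.TT\<^esub> (b \<boxtimes>\<^bsub>R.T\<^esub> v)))"
      by (intro C.csum_cong DE.comult_sum[symmetric] br x y z)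
    also have "\<dots> = comult R.CD (x \<boxtimes>\<^bsub>R.T\<^esub> (y \<boxtimes>\<^bsub>DE.T\<^esub> z))"
      by (rule R.comult_pure[OF x de[OF DE.T_closed[OF y z]], symmetric])
    finally show "comult R.CD (?a ((x \<boxtimes>\<^bsub>CD.T\<^esub> y) \<boxtimes>\<^bsub>L3\<^esub> z)) =
       tsum R.TT (comult L.CD ((x \<boxtimes>\<^bsub>CD.T\<^esub> y) \<boxtimes>\<^bsub>L3\<^esub> z)) (\<lambda>s t. ?a s \<boxtimes>\<^bsub>R.TT\<^esub> ?a t)"
      using assoc_pure[OF x y z] by (simp add: L_T)
  qed
  moreover have "counit R.CD (?a t) = counit L.CD t" if t: "t \<in> carrier L3" for t
  proof (rule ktensor3_lin_ext[OF C.C_module D.C_module E.C_module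
        lin_compose[OF lin_assoc R.lin_counit_T, unfolded L_T] L.lin_counit_T[unfolded L_T] t])
    fix x y z assume x: "x \<in> carrier C" and y: "y \<in> carrier D" and z: "z \<in> carrier E"
    have "counit R.CD (x \<boxtimes>\<^bsub>R.T\<^esub> (y \<boxtimes>\<^bsub>DE.T\<^esub> z)) = counit L.CD ((x \<boxtimes>\<^bsub>CD.T\<^esub> y) \<boxtimes>\<^bsub>L.T\<^esub> z)"
      using x y z C.counit_closed D.counit_closed E.counit_closed
      by (simp add: R.counit_pure L.counit_pure CD.carrier_CD DE.carrier_CD CD.counit_pure DE.counit_pure
          CD.T_closed DE.T_closed C.C.R.m_assoc)
    then show "counit R.CD (?a ((x \<boxtimes>\<^bsub>CD.T\<^esub> y) \<boxtimes>\<^bsub>L3\<^esub> z)) = counit L.CD ((x \<boxtimes>\<^bsub>CD.T\<^esub> y) \<boxtimes>\<^bsub>L3\<^esub> z)"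
      using assoc_pure[OF x y z] by (simp add: L_T)
  qed
  ultimately show ?thesis
    unfolding chom_def R.CD_ktensor L.carrier_CD L_T
    using L.CD.cocoalg_axioms R.CD.cocoalg_axioms lin_assoc_coalg by (simp add: L_T)
qed

end

section \<open>Grouplike elements\<close>

definition grouplike :: "'k ring \<Rightarrow> ('k, 'c) coalgebra \<Rightarrow> 'c \<Rightarrow> bool" where
  "grouplike K C g \<longleftrightarrow> cocoalg K C \<and> g \<in> carrier C \<and> comult C g = g \<boxtimes>\<^bsub>ktensor K C C\<^esub> g \<and> counit C g = \<one>\<^bsub>K\<^esub>"

lemma chom_grouplike:
  assumes f: "chom K C D f" and g: "grouplike K C g" shows "grouplike K D (f g)"
proof -
  interpret D: cocoalg K D by (rule chom_cocoalg(2)[OF f])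
  have b: "bilin K C C D.CC (\<lambda>a b. f a \<boxtimes>\<^bsub>D.CC\<^esub> f b)"
    by (rule bilin_comp[OF bilin_kpure[OF D.C_module D.C_module] chom_lin[OF f] chom_lin[OF f]])
  show ?thesis
    using f g D.cocoalg_axioms chom_closed[OF f] tsum_kpure[OF b] by (simp add: grouplike_def chom_def)
qed

lemma tsum_grouplike:
  "grouplike K C g \<Longrightarrow> bilin K C C P \<beta> \<Longrightarrow> tsum P (comult C g) \<beta> = \<beta> g g"
  by (simp add: grouplike_def tsum_kpure)

text \<open>The single-term coproduct of \<open>g\<close> leaves only the Sweedler sum over
  \<open>x\<close>, and its counit is the unit. This embeds \<open>D\<close> into the tensor
  coalgebra without passing through the tensor product of k with \<open>D\<close>.\<close>

lemma chom_grouplike_tensor: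
  assumes g: "grouplike K C g" and D: "cocoalg K D"
  shows "chom K D (tensor_coalg K C D) (\<lambda>x. g \<boxtimes>\<^bsub>ktensor K C D\<^esub> x)"
proof -
  interpret cocoalg_pair K C D using assms by (simp add: cocoalg_pair_def grouplike_def)
  have gc: "g \<in> carrier C" "C.\<epsilon> g = \<one>\<^bsub>K\<^esub>" using g by (simp_all add: grouplike_def)
  have "comult CD (g \<boxtimes>\<^bsub>T\<^esub> x) = tsum TT (D.\<Delta> x) (\<lambda>a b. (g \<boxtimes>\<^bsub>T\<^esub> a) \<boxtimes>\<^bsub>TT\<^esub> (g \<boxtimes>\<^bsub>T\<^esub> b))" if x: "x \<in> carrier D" for x
  proof -
    have b1: "bilin K C C TT (\<lambda>a b. tsum TT (D.\<Delta> x) (\<lambda>c d. (a \<boxtimes>\<^bsub>T\<^esub> c) \<boxtimes>\<^bsub>TT\<^esub> (b \<boxtimes>\<^bsub>T\<^esub> d)))"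
      by (intro bilinI C.C_module TT_module D.lin_csum_fun x bilin_comp[OF bilin_TT lin_T1 lin_T1, THEN bilin_lin1]
          bilin_comp[OF bilin_TT lin_T1 lin_T1, THEN bilin_lin2])
    show ?thesis using comult_pure[OF gc(1) x] tsum_grouplike[OF g b1] by simp
  qed
  then show ?thesis
    unfolding chom_def CD_ktensor
    using gc D CD.cocoalg_axioms same_module_lin[OF same_module_refl same_T lin_T2[OF gc(1)]] D.counit_closed
    by (simp add: counit_pure)
qed

lemma chom_tensor_grouplike:
  assumes g: "grouplike K D g" and C: "cocoalg K C"
  shows "chom K C (tensor_coalg K C D) (\<lambda>x. x \<boxtimes>\<^bsub>ktensor K C D\<^esub> g)"
proof -
  interpret cocoalg_pair K C D using assms by (simp add: cocoalg_pair_def grouplike_def)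
  have gc: "g \<in> carrier D" "D.\<epsilon> g = \<one>\<^bsub>K\<^esub>" using g by (simp_all add: grouplike_def)
  have "comult CD (x \<boxtimes>\<^bsub>T\<^esub> g) = tsum TT (C.\<Delta> x) (\<lambda>a b. (a \<boxtimes>\<^bsub>T\<^esub> g) \<boxtimes>\<^bsub>TT\<^esub> (b \<boxtimes>\<^bsub>T\<^esub> g))" if x: "x \<in> carrier C" for x
    unfolding comult_pure[OF x gc(1)]
    by (intro C.csum_cong x tsum_grouplike[OF g] bilin_comp[OF bilin_TT lin_T2 lin_T2])
  then show ?thesis
    unfolding chom_def CD_ktensor
    using gc C CD.cocoalg_axioms same_module_lin[OF same_module_refl same_T lin_T1[OF gc(1)]] C.counit_closed
    by (simp add: counit_pure)
qed

section \<open>The ground ring as a cocommutative coalgebra\<close>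

context
  fixes K :: "'k ring"
  assumes K: "cring K"
begin

interpretation K: cring K by (rule K)


lemma same_unit: "same_module (ground K) (unit_coalg K)"
  by (simp add: same_module_def unit_coalg_def module.defs coalgebra.defs)

lemma carrier_unit: "carrier (unit_coalg K) = carrier K"
  using same_unit by (simp add: same_module_def ground_def)

lemma unit_ktensor: "ktensor K (unit_coalg K) (unit_coalg K) = (ktensor K (ground K) (ground K))"
  by (rule same_module_ktensor[OF same_module_sym[OF same_unit] same_module_sym[OF same_unit]])

lemma bilin_kk: "bilin K (ground K) (ground K) (ktensor K (ground K) (ground K)) (\<lambda>a b. a \<boxtimes>\<^bsub>ktensor K (ground K) (ground K)\<^esub> b)"
  by (rule bilin_kpure[OF ground_module[OF K] ground_module[OF K]])

lemma cocoalgebra_unit: "cocoalgebra K (unit_coalg K)"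
proof (rule cocoalgebraI)
  have g: "module K (ground K)" by (rule ground_module[OF K])
  have kkm: "module K (ktensor K (ground K) (ground K))" by (rule ktensor_module[OF g g])
  have sm: "c \<odot>\<^bsub>ground K\<^esub> d = c \<otimes>\<^bsub>K\<^esub> d" "carrier (ground K) = carrier K" for c d by (simp_all add: ground_def)
  have d: "comult (unit_coalg K) c = c \<boxtimes>\<^bsub>ktensor K (ground K) (ground K)\<^esub> \<one>\<^bsub>K\<^esub>" if "c \<in> carrier K" for c
    using that by (simp add: unit_coalg_def module.defs coalgebra.defs)
  have e: "counit (unit_coalg K) c = c" if "c \<in> carrier K" for c
    using that by (simp add: unit_coalg_def module.defs coalgebra.defs)
  have o: "\<one>\<^bsub>K\<^esub> \<in> carrier (ground K)" by (simp add: sm)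
  have ld: "lin K (ground K) (ktensor K (ground K) (ground K)) (comult (unit_coalg K))"
    by (rule lin_cong[OF bilin_lin1[OF bilin_kk o]]) (simp add: sm d)
  have le: "lin K (ground K) (ground K) (counit (unit_coalg K))"
    by (rule lin_cong[OF lin_id[OF g]]) (simp add: sm e)
  \<comment> \<open>The coproduct of \<open>c\<close> is a single pure tensor, so every Sweedler sum
    over it collapses to one evaluation, at \<open>c\<close> and the unit.\<close>
  have us: "tsum P (comult (unit_coalg K) c) \<beta> = \<beta> c \<one>\<^bsub>K\<^esub>" if "bilin K (ground K) (ground K) P \<beta>" "c \<in> carrier K" for P \<beta> c
    using that o by (simp add: d sm tsum_kpure[OF that(1)])
  show "module K (unit_coalg K)" by (rule same_module_module[OF same_unit g])
  have ext: "comult (unit_coalg K) \<in> extensional (carrier (unit_coalg K))" "counit (unit_coalg K) \<in> extensional (carrier (unit_coalg K))"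
    unfolding carrier_unit by (simp_all add: unit_coalg_def module.defs coalgebra.defs)
  show "comult (unit_coalg K) \<in> linear_maps K (unit_coalg K) (ktensor K (unit_coalg K) (unit_coalg K))"
    unfolding unit_ktensor
    by (rule lin_extensional_linear_maps[OF same_module_lin[OF same_unit _ ld] ext(1)]) (simp add: same_module_def)
  show "counit (unit_coalg K) \<in> linear_maps K (unit_coalg K) (ground K)"
    by (rule lin_extensional_linear_maps[OF same_module_lin[OF same_unit _ le] ext(2)]) (simp add: same_module_def)
  fix c assume "c \<in> carrier (unit_coalg K)"
  then have c: "c \<in> carrier K" by (simp add: carrier_unit)
  let ?R = "ktensor K (ground K) (ktensor K (ground K) (ground K))"
  have R: "ktensor K (unit_coalg K) (ktensor K (ground K) (ground K)) = ?R"
    by (rule same_module_ktensor[OF same_module_sym[OF same_unit]]) (simp add: same_module_def)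
  note t = trilin_assoc_pure[OF g g g]
  have b1: "bilin K (ground K) (ground K) ?R (\<lambda>a b. tsum ?R (comult (unit_coalg K) a) (\<lambda>c d. c \<boxtimes>\<^bsub>?R\<^esub> (d \<boxtimes>\<^bsub>ktensor K (ground K) (ground K)\<^esub> b)))"
    by (rule bilin_comp[OF trilin_left(1)[OF t] ld lin_id[OF g]])
  have b2: "bilin K (ground K) (ground K) ?R (\<lambda>a b. tsum ?R (comult (unit_coalg K) b) (\<lambda>c d. a \<boxtimes>\<^bsub>?R\<^esub> (c \<boxtimes>\<^bsub>ktensor K (ground K) (ground K)\<^esub> d)))"
    by (rule bilin_comp[OF trilin_right(1)[OF t] lin_id[OF g] ld])
  have b1': "bilin K (ground K) (ground K) ?R (\<lambda>c d. c \<boxtimes>\<^bsub>?R\<^esub> (d \<boxtimes>\<^bsub>ktensor K (ground K) (ground K)\<^esub> \<one>\<^bsub>K\<^esub>))"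
    by (rule trilin_left(2)[OF t o])
  have b2': "bilin K (ground K) (ground K) ?R (\<lambda>a b. c \<boxtimes>\<^bsub>?R\<^esub> (a \<boxtimes>\<^bsub>ktensor K (ground K) (ground K)\<^esub> b))"
    by (rule trilin_right(2)[OF t]) (simp add: sm c)
  show "tsum (ktensor K (unit_coalg K) (ktensor K (unit_coalg K) (unit_coalg K))) (comult (unit_coalg K) c) (\<lambda>a b. tsum (ktensor K (unit_coalg K) (ktensor K (unit_coalg K) (unit_coalg K))) (comult (unit_coalg K) a)
          (\<lambda>c d. c \<boxtimes>\<^bsub>ktensor K (unit_coalg K) (ktensor K (unit_coalg K) (unit_coalg K))\<^esub> (d \<boxtimes>\<^bsub>ktensor K (unit_coalg K) (unit_coalg K)\<^esub> b))) =
        tsum (ktensor K (unit_coalg K) (ktensor K (unit_coalg K) (unit_coalg K))) (comult (unit_coalg K) c) (\<lambda>a b. tsum (ktensor K (unit_coalg K) (ktensor K (unit_coalg K) (unit_coalg K))) (comult (unit_coalg K) b)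
          (\<lambda>c d. a \<boxtimes>\<^bsub>ktensor K (unit_coalg K) (ktensor K (unit_coalg K) (unit_coalg K))\<^esub> (c \<boxtimes>\<^bsub>ktensor K (unit_coalg K) (unit_coalg K)\<^esub> d)))"
    unfolding unit_ktensor R using c by (simp add: us[OF b1] us[OF b2] us[OF b1'] us[OF b2'])
  have b3: "bilin K (ground K) (ground K) (ground K) (\<lambda>a b. counit (unit_coalg K) a \<odot>\<^bsub>ground K\<^esub> b)"
    by (intro bilinI linI g) (simp_all add: sm e, simp_all add: ground_def e K.l_distr K.r_distr K.m_assoc K.m_lcomm)
  have su: "smult (unit_coalg K) = smult (ground K)" using same_unit by (simp add: same_module_def)
  show "tsum (unit_coalg K) (comult (unit_coalg K) c) (\<lambda>a b. counit (unit_coalg K) a \<odot>\<^bsub>unit_coalg K\<^esub> b) = c"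
    unfolding su same_module_tsum[OF same_unit, symmetric] us[OF b3 c] using c by (simp add: sm e)
  \<comment> \<open>Cocommutativity for scalars: \<open>c\<close>, written as a multiple of the
    unit, crosses the tensor sign.\<close>
  have "\<one>\<^bsub>K\<^esub> \<boxtimes>\<^bsub>ktensor K (ground K) (ground K)\<^esub> (c \<odot>\<^bsub>ground K\<^esub> \<one>\<^bsub>K\<^esub>) = (c \<odot>\<^bsub>ground K\<^esub> \<one>\<^bsub>K\<^esub>) \<boxtimes>\<^bsub>ktensor K (ground K) (ground K)\<^esub> \<one>\<^bsub>K\<^esub>"
    using lin_smult[OF bilin_lin1[OF bilin_kk o] c o] lin_smult[OF bilin_lin2[OF bilin_kk o] c o] by simp
  then show "tsum (ktensor K (unit_coalg K) (unit_coalg K)) (comult (unit_coalg K) c) (\<lambda>a b. b \<boxtimes>\<^bsub>ktensor K (unit_coalg K) (unit_coalg K)\<^esub> a) = comult (unit_coalg K) c"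
    unfolding unit_ktensor us[OF bilin_swap[OF bilin_kk] c] using c by (simp add: d sm)
qed

lemma cocoalg_unit: "cocoalg K (unit_coalg K)"
  by (rule cocoalgI[OF cocoalgebra_unit])

lemma grouplike_unit: "grouplike K (unit_coalg K) \<one>\<^bsub>K\<^esub>"
  unfolding grouplike_def unit_ktensor carrier_unit using cocoalg_unit
  by (simp add: unit_coalg_def module.defs coalgebra.defs)

lemma comult_unit: "c \<in> carrier K \<Longrightarrow> comult (unit_coalg K) c = c \<boxtimes>\<^bsub>ktensor K (ground K) (ground K)\<^esub> \<one>\<^bsub>K\<^esub>"
  by (simp add: unit_coalg_def module.defs coalgebra.defs)

lemma counit_unit: "c \<in> carrier K \<Longrightarrow> counit (unit_coalg K) c = c"
  by (simp add: unit_coalg_def module.defs coalgebra.defs)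

end

section \<open>Hopf algebroids\<close>

lemma k_algebra_module: "k_algebra K R \<Longrightarrow> module K R"
  by (simp add: k_algebra_def)

lemma k_algebra_ring: "k_algebra K R \<Longrightarrow> ring R"
  by (simp add: k_algebra_def)

lemma k_algebra_smult:
  assumes "k_algebra K R" "c \<in> carrier K" "x \<in> carrier R" "y \<in> carrier R"
  shows "(c \<odot>\<^bsub>R\<^esub> x) \<otimes>\<^bsub>R\<^esub> y = c \<odot>\<^bsub>R\<^esub> (x \<otimes>\<^bsub>R\<^esub> y)" "x \<otimes>\<^bsub>R\<^esub> (c \<odot>\<^bsub>R\<^esub> y) = c \<odot>\<^bsub>R\<^esub> (x \<otimes>\<^bsub>R\<^esub> y)"
  using assms unfolding k_algebra_def by metis+

lemma bilin_mult:
  assumes R: "k_algebra K R" shows "bilin K R R R (\<lambda>x y. x \<otimes>\<^bsub>R\<^esub> y)"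
proof -
  interpret ring R by (rule k_algebra_ring[OF R])
  show ?thesis
    by (intro bilinI linI k_algebra_module[OF R]) (simp_all add: l_distr r_distr k_algebra_smult[OF R])
qed

lemma same_module_op_alg: "same_module (op_alg R) R"
  by (simp add: same_module_def op_alg_def)

lemma alg_hom_lin: "f \<in> alg_hom K R S \<Longrightarrow> module K R \<Longrightarrow> module K S \<Longrightarrow> lin K R S f"
  by (rule linear_maps_lin) (simp_all add: alg_hom_def)

section \<open>Structure maps and balanced tensor square of a Hopf algebroid\<close>

locale halg =
  fixes K :: "'k ring" and H :: "('k, 'u, 'a) hopf_algebroid"
  assumes hopf: "hopf_algebroid K H"
begin

abbreviation "U \<equiv> total_alg H"
abbreviation "A \<equiv> base_alg H"
abbreviation "T \<equiv> atensor H"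
abbreviation "s \<equiv> src H"
abbreviation "t \<equiv> tgt H"

lemma left_bialgebroid: "left_bialgebroid K H"
  using hopf by (simp add: hopf_algebroid_def Let_def)

lemma U_alg: "k_algebra K U" and A_alg: "k_algebra K A"
  using left_bialgebroid by (simp_all add: left_bialgebroid_def Let_def)

lemmas U_module = k_algebra_module[OF U_alg]
lemmas A_module = k_algebra_module[OF A_alg]

sublocale U: module K U by (rule U_module)
sublocale A: module K A by (rule A_module)
sublocale UR: ring U by (rule k_algebra_ring[OF U_alg])
sublocale AR: ring A by (rule k_algebra_ring[OF A_alg])

lemma lin_src: "lin K A U s"
  using left_bialgebroid by (intro alg_hom_lin A_module U_module) (simp add: left_bialgebroid_def Let_def)

lemma lin_tgt: "lin K A U t"
proof (rule same_module_lin[OF same_module_op_alg same_module_refl alg_hom_lin])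
  show "t \<in> alg_hom K (op_alg A) U" using left_bialgebroid by (simp add: left_bialgebroid_def Let_def)
qed (rule same_module_module[OF same_module_sym[OF same_module_op_alg] A_module] U_module)+

lemma src_one: "s \<one>\<^bsub>A\<^esub> = \<one>\<^bsub>U\<^esub>"
proof -
  have "s \<in> ring_hom A U" using left_bialgebroid by (simp add: left_bialgebroid_def Let_def alg_hom_def)
  then show ?thesis by (rule ring_hom_one)
qed

lemma tgt_one: "t \<one>\<^bsub>A\<^esub> = \<one>\<^bsub>U\<^esub>"
proof -
  have "t \<in> ring_hom (op_alg A) U" using left_bialgebroid by (simp add: left_bialgebroid_def Let_def alg_hom_def)
  from ring_hom_one[OF this] show ?thesis by (simp add: op_alg_def)
qed

lemma src_closed: "a \<in> carrier A \<Longrightarrow> s a \<in> carrier U"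
  by (rule lin_closed[OF lin_src])

lemma tgt_closed: "a \<in> carrier A \<Longrightarrow> t a \<in> carrier U"
  by (rule lin_closed[OF lin_tgt])

lemma lin_antipode: "lin K U U (antipode H)"
proof (rule same_module_lin[OF same_module_op_alg same_module_refl alg_hom_lin])
  show "antipode H \<in> alg_hom K (op_alg U) U" using hopf by (simp add: hopf_algebroid_def Let_def)
qed (rule same_module_module[OF same_module_sym[OF same_module_op_alg] U_module] U_module)+

lemma lin_augmentation: "lin K U A (augmentation H)"
  using left_bialgebroid by (intro linear_maps_lin A_module U_module) (simp add: left_bialgebroid_def Let_def)

sublocale UU: module_pair K U U "carrier A" "\<lambda>a u. t a \<otimes>\<^bsub>U\<^esub> u" "\<lambda>a u. s a \<otimes>\<^bsub>U\<^esub> u"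
proof unfold_locales
  fix c assume c: "c \<in> carrier K"
  show "\<exists>a\<in>carrier A. (\<forall>m\<in>carrier U. t a \<otimes>\<^bsub>U\<^esub> m = c \<odot>\<^bsub>U\<^esub> m) \<and> (\<forall>n\<in>carrier U. s a \<otimes>\<^bsub>U\<^esub> n = c \<odot>\<^bsub>U\<^esub> n)"
  proof (intro bexI conjI ballI)
    \<comment> \<open>The witness is \<open>c\<close> times the unit of \<open>A\<close>: source and
      target maps are linear and unital, so both send it to \<open>c\<close> times the unit of
      \<open>U\<close>.\<close>
    show "c \<odot>\<^bsub>A\<^esub> \<one>\<^bsub>A\<^esub> \<in> carrier A" using c by simp
    show "t (c \<odot>\<^bsub>A\<^esub> \<one>\<^bsub>A\<^esub>) \<otimes>\<^bsub>U\<^esub> m = c \<odot>\<^bsub>U\<^esub> m" "s (c \<odot>\<^bsub>A\<^esub> \<one>\<^bsub>A\<^esub>) \<otimes>\<^bsub>U\<^esub> m = c \<odot>\<^bsub>U\<^esub> m" if "m \<in> carrier U" for m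
      using c that by (simp_all add: lin_smult[OF lin_tgt] lin_smult[OF lin_src] tgt_one src_one k_algebra_smult[OF U_alg])
  qed
qed (simp_all add: tgt_closed src_closed k_algebra_smult[OF U_alg])

lemma atensor_eq: "T = UU.T"
  by (simp add: atensor_def Let_def)

lemma T_module: "module K T"
  unfolding atensor_eq by (rule UU.T_module)

lemma is_tensor_T: "is_tensor T U U"
  unfolding atensor_eq by (rule UU.is_tensor_balanced)

lemma bilin_T: "bilin K U U T (\<lambda>u v. u \<boxtimes>\<^bsub>T\<^esub> v)"
  unfolding atensor_eq by (rule UU.bilin_pure)

lemma T_closed: "u \<in> carrier U \<Longrightarrow> v \<in> carrier U \<Longrightarrow> u \<boxtimes>\<^bsub>T\<^esub> v \<in> carrier T"
  by (rule bilin_closed[OF bilin_T])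

lemma T_balanced:
  "a \<in> carrier A \<Longrightarrow> u \<in> carrier U \<Longrightarrow> v \<in> carrier U \<Longrightarrow> (t a \<otimes>\<^bsub>U\<^esub> u) \<boxtimes>\<^bsub>T\<^esub> v = u \<boxtimes>\<^bsub>T\<^esub> (s a \<otimes>\<^bsub>U\<^esub> v)"
  unfolding atensor_eq by (rule UU.pure_balanced)

lemma tsum_T_id: "w \<in> carrier T \<Longrightarrow> tsum T w (\<lambda>u v. u \<boxtimes>\<^bsub>T\<^esub> v) = w"
  unfolding atensor_eq by (rule UU.tsum_pure_id)

lemma T_lift:
  assumes "bilin K U U P \<beta>"
    and "\<And>a u v. a \<in> carrier A \<Longrightarrow> u \<in> carrier U \<Longrightarrow> v \<in> carrier U \<Longrightarrow> \<beta> (t a \<otimes>\<^bsub>U\<^esub> u) v = \<beta> u (s a \<otimes>\<^bsub>U\<^esub> v)"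
  shows "lin K T P (\<lambda>w. tsum P w \<beta>)"
    and "\<And>u v. u \<in> carrier U \<Longrightarrow> v \<in> carrier U \<Longrightarrow> tsum P (u \<boxtimes>\<^bsub>T\<^esub> v) \<beta> = \<beta> u v"
  unfolding atensor_eq using UU.tsum_lift[OF assms] by blast+

lemma lin_coproduct: "lin K U T (coproduct H)"
  using left_bialgebroid by (intro linear_maps_lin T_module U_module) (simp add: left_bialgebroid_def Let_def)

lemma coproduct_closed: "u \<in> carrier U \<Longrightarrow> coproduct H u \<in> carrier T"
  by (rule lin_closed[OF lin_coproduct])

end

lemma HAlg_halg: "H \<in> HAlg K \<Longrightarrow> halg K H"
  by (simp add: HAlg_def halg_def)

section \<open>Measurings\<close>

lemma Vect_module:
  assumes V: "module K V" and W: "module K W"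
  shows "module K (Vect K V W)"
proof -
  interpret V: module K V by fact
  interpret W: module K W by fact
  note lm = linear_maps_iff[OF V W]
  have add: "(\<lambda>x\<in>carrier V. f x \<oplus>\<^bsub>W\<^esub> g x) \<in> linear_maps K V W" if "f \<in> linear_maps K V W" "g \<in> linear_maps K V W" for f g
    using that V W by (auto simp: lm lin_def W.smult_r_distr W.M.a_ac)
  have smu: "(\<lambda>x\<in>carrier V. c \<odot>\<^bsub>W\<^esub> f x) \<in> linear_maps K V W" if "f \<in> linear_maps K V W" "c \<in> carrier K" for f c
    using that V W by (auto simp: lm lin_def W.smult_r_distr V.R.m_comm simp flip: W.smult_assoc1)
  have neg: "(\<lambda>x\<in>carrier V. \<ominus>\<^bsub>W\<^esub> f x) \<in> linear_maps K V W" if "f \<in> linear_maps K V W" for f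
    using that V W by (auto simp: lm lin_def W.smult_r_minus W.M.minus_add)
  have z: "(\<lambda>x\<in>carrier V. \<zero>\<^bsub>W\<^esub>) \<in> linear_maps K V W"
    using V W by (auto simp: lm lin_def)
  have cl: "f x \<in> carrier W" if "f \<in> linear_maps K V W" "x \<in> carrier V" for f x
    using that by (auto simp: lm lin_def)
  have ex: "f \<in> extensional (carrier V)" if "f \<in> linear_maps K V W" for f
    using that by (auto simp: lm)
  note eq = extensionalityI[where A = "carrier V"]
  show ?thesis
  proof (rule moduleI)
    show "cring K" by (rule V.R.is_cring)
    show "abelian_group (Vect K V W)"
    proof (rule abelian_groupI)
      fix f assume "f \<in> carrier (Vect K V W)"
      then show "\<exists>g\<in>carrier (Vect K V W). g \<oplus>\<^bsub>Vect K V W\<^esub> f = \<zero>\<^bsub>Vect K V W\<^esub>"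
        by (intro bexI[of _ "\<lambda>x\<in>carrier V. \<ominus>\<^bsub>W\<^esub> f x"])
          (auto simp: Vect_def neg cl W.M.l_neg intro!: restrict_ext)
    qed (auto simp: Vect_def add z cl ex W.M.a_ac intro!: eq)
  qed (auto simp: Vect_def add smu cl ex W.smult_l_distr W.smult_r_distr W.smult_assoc1 intro!: eq)
qed

lemma linear_maps_Vect_bilin:
  assumes V: "module K C" "module K R" "module K S" and \<psi>: "\<psi> \<in> linear_maps K C (Vect K R S)"
  shows "bilin K C R S \<psi>" "x \<in> carrier C \<Longrightarrow> \<psi> x \<in> extensional (carrier R)"
proof -
  have l: "\<psi> x \<in> linear_maps K R S" if "x \<in> carrier C" for x
    using \<psi> that by (auto simp: linear_maps_def[of _ C] Vect_def)
  then show "x \<in> carrier C \<Longrightarrow> \<psi> x \<in> extensional (carrier R)"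
    by (auto simp: linear_maps_def PiE_def)
  have l': "lin K R S (\<psi> x)" if "x \<in> carrier C" for x
    by (rule linear_maps_lin[OF l[OF that] V(2,3)])
  show "bilin K C R S \<psi>"
  proof (rule bilinI[OF V])
    fix u assume u: "u \<in> carrier R"
    show "lin K C S (\<lambda>x. \<psi> x u)"
      using \<psi> u lin_closed[OF l' u] by (intro linI V) (auto simp: linear_maps_def[of _ C] Vect_def)
  qed (rule l')
qed

text \<open>The inner restriction makes each value an element of \<open>Vect\<close>, the outer one
  makes the family itself extensional; the convention is imposed at both levels.\<close>

lemma bilin_linear_maps_Vect:
  assumes b: "bilin K C R S \<psi>"
  shows "(\<lambda>x\<in>carrier C. \<lambda>u\<in>carrier R. \<psi> x u) \<in> linear_maps K C (Vect K R S)"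
proof (rule lin_linear_maps)
  note m = bilin_module[OF b]
  interpret C: module K C by (rule m(1))
  show "lin K C (Vect K R S) (\<lambda>x. \<lambda>u\<in>carrier R. \<psi> x u)"
  proof (rule linI[OF m(1) Vect_module[OF m(2,3)]])
    fix x assume x: "x \<in> carrier C"
    show "(\<lambda>u\<in>carrier R. \<psi> x u) \<in> carrier (Vect K R S)"
      using lin_linear_maps[OF bilin_lin2[OF b x]] by (simp add: Vect_def)
  qed (auto simp: Vect_def lin_add[OF bilin_lin1[OF b]] lin_smult[OF bilin_lin1[OF b]] intro!: restrict_ext)
qed

text \<open>Algebra measurings evaluated at points, without the extensionality convention.\<close>

definition pmeas ::
  "'k ring \<Rightarrow> ('k, 'c) coalgebra \<Rightarrow> ('k, 'r) module \<Rightarrow> ('k, 's) module \<Rightarrow> ('c \<Rightarrow> 'r \<Rightarrow> 's) \<Rightarrow> bool" where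
  "pmeas K C R S \<psi> \<longleftrightarrow> bilin K C R S \<psi> \<and>
     (\<forall>x\<in>carrier C. \<forall>a\<in>carrier R. \<forall>b\<in>carrier R.
        \<psi> x (a \<otimes>\<^bsub>R\<^esub> b) = tsum S (comult C x) (\<lambda>x\<^sub>1 x\<^sub>2. \<psi> x\<^sub>1 a \<otimes>\<^bsub>S\<^esub> \<psi> x\<^sub>2 b)) \<and>
     (\<forall>x\<in>carrier C. \<psi> x \<one>\<^bsub>R\<^esub> = counit C x \<odot>\<^bsub>S\<^esub> \<one>\<^bsub>S\<^esub>)"

lemma pmeas_bilin: "pmeas K C R S \<psi> \<Longrightarrow> bilin K C R S \<psi>"
  by (simp add: pmeas_def)

lemma pmeas_mult: "pmeas K C R S \<psi> \<Longrightarrow> x \<in> carrier C \<Longrightarrow> a \<in> carrier R \<Longrightarrow> b \<in> carrier R \<Longrightarrow>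
    \<psi> x (a \<otimes>\<^bsub>R\<^esub> b) = tsum S (comult C x) (\<lambda>x\<^sub>1 x\<^sub>2. \<psi> x\<^sub>1 a \<otimes>\<^bsub>S\<^esub> \<psi> x\<^sub>2 b)"
  by (simp add: pmeas_def)

lemma pmeas_one: "pmeas K C R S \<psi> \<Longrightarrow> x \<in> carrier C \<Longrightarrow> \<psi> x \<one>\<^bsub>R\<^esub> = counit C x \<odot>\<^bsub>S\<^esub> \<one>\<^bsub>S\<^esub>"
  by (simp add: pmeas_def)

lemma alg_measuring_pmeas:
  assumes "module K C" "module K R" "module K S" "alg_measuring K C R S \<psi>"
  shows "pmeas K C R S \<psi>"
  using assms linear_maps_Vect_bilin(1)[OF assms(1-3)] by (simp add: alg_measuring_def pmeas_def)

lemma pmeas_alg_measuring: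
  assumes C: "coalg K C" and R: "k_algebra K R" and p: "pmeas K C R S \<psi>"
  shows "alg_measuring K C R S (\<lambda>x\<in>carrier C. \<lambda>u\<in>carrier R. \<psi> x u)"
proof -
  interpret coalg K C by fact
  interpret R: ring R by (rule k_algebra_ring[OF R])
  have "tsum S (\<Delta> x) (\<lambda>x\<^sub>1 x\<^sub>2. (\<lambda>x\<in>carrier C. \<lambda>u\<in>carrier R. \<psi> x u) x\<^sub>1 a \<otimes>\<^bsub>S\<^esub> (\<lambda>x\<in>carrier C. \<lambda>u\<in>carrier R. \<psi> x u) x\<^sub>2 b)
     = tsum S (\<Delta> x) (\<lambda>x\<^sub>1 x\<^sub>2. \<psi> x\<^sub>1 a \<otimes>\<^bsub>S\<^esub> \<psi> x\<^sub>2 b)"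
    if "x \<in> carrier C" "a \<in> carrier R" "b \<in> carrier R" for x a b
    using that by (intro csum_cong) auto
  then show ?thesis
    using p bilin_linear_maps_Vect[OF pmeas_bilin[OF p]] by (simp add: alg_measuring_def pmeas_def)
qed

lemma pmeas_chom:
  assumes p: "pmeas K D R S \<psi>" and f: "chom K C D f" and S: "k_algebra K S" and R: "k_algebra K R"
  shows "pmeas K C R S (\<lambda>x. \<psi> (f x))"
proof -
  have b: "bilin K D D S (\<lambda>x y. \<psi> x u \<otimes>\<^bsub>S\<^esub> \<psi> y v)" if "u \<in> carrier R" "v \<in> carrier R" for u v
    by (rule bilin_comp[OF bilin_mult[OF S] bilin_lin1[OF pmeas_bilin[OF p] that(1)] bilin_lin1[OF pmeas_bilin[OF p] that(2)]])
  have "bilin K C R S (\<lambda>x. \<psi> (f x))"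
    by (rule bilin_comp[OF pmeas_bilin[OF p] chom_lin[OF f] lin_id[OF k_algebra_module[OF R]]])
  then show ?thesis
    using p chom_closed[OF f] chom_sum[OF f b] chom_counit[OF f] by (simp add: pmeas_def)
qed

text \<open>Both measuring laws are linear in the element of the tensor coalgebra, so pure tensors
  suffice. There multiplicativity of \<open>\<psi>\<close> opens the coproduct of \<open>x\<close>,
  then that of \<open>\<psi>'\<close> opens the coproduct of \<open>y\<close>, and the four legs are
  paired exactly as in the tensor coalgebra.\<close>

lemma pmeas_compose:
  fixes C :: "('k, 'c) coalgebra" and D :: "('k, 'd) coalgebra"
  assumes CD: "cocoalg_pair K C D" and alg: "k_algebra K R" "k_algebra K S" "k_algebra K Q"
    and p: "pmeas K C R S \<psi>" and q: "pmeas K D S Q \<psi>'"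
    and b: "bilin K (ktensor K C D) R Q \<theta>"
    and pure: "\<And>x y u. x \<in> carrier C \<Longrightarrow> y \<in> carrier D \<Longrightarrow> u \<in> carrier R \<Longrightarrow>
      \<theta> (x \<boxtimes>\<^bsub>ktensor K C D\<^esub> y) u = \<psi>' y (\<psi> x u)"
  shows "pmeas K (tensor_coalg K C D) R Q \<theta>"
proof -
  interpret cocoalg_pair K C D by fact
  interpret R: ring R by (rule k_algebra_ring[OF alg(1)])
  interpret S: ring S by (rule k_algebra_ring[OF alg(2)])
  interpret Q: ring Q by (rule k_algebra_ring[OF alg(3)])
  interpret Qm: module K Q by (rule k_algebra_module[OF alg(3)])
  note pb = pmeas_bilin[OF p] and qb = pmeas_bilin[OF q]
  have 1: "bilin K CD R Q \<theta>"
  proof (rule bilinI[OF CD_module bilin_module(2,3)[OF b]])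
    show "lin K CD Q (\<lambda>z. \<theta> z u)" if "u \<in> carrier R" for u
      by (rule same_module_lin[OF same_T same_module_refl bilin_lin1[OF b that]])
    show "lin K R Q (\<theta> z)" if "z \<in> carrier CD" for z
      using bilin_lin2[OF b] that by (simp add: carrier_CD)
  qed
  have 2: "\<theta> z (u \<otimes>\<^bsub>R\<^esub> v) = tsum Q (comult CD z) (\<lambda>z\<^sub>1 z\<^sub>2. \<theta> z\<^sub>1 u \<otimes>\<^bsub>Q\<^esub> \<theta> z\<^sub>2 v)"
    if u: "u \<in> carrier R" and v: "v \<in> carrier R" and z: "z \<in> carrier T" for u v z
  proof -
    have bt: "bilin K T T Q (\<lambda>z\<^sub>1 z\<^sub>2. \<theta> z\<^sub>1 u \<otimes>\<^bsub>Q\<^esub> \<theta> z\<^sub>2 v)"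
      by (rule bilin_comp[OF bilin_mult[OF alg(3)] bilin_lin1[OF b u] bilin_lin1[OF b v]])
    show ?thesis
    proof (rule ktensor_lin_ext[OF C.C_module D.C_module bilin_lin1[OF b] lin_comult_sum[OF bt] _ z])
      fix x y assume x: "x \<in> carrier C" and y: "y \<in> carrier D"
      have "\<theta> (x \<boxtimes>\<^bsub>T\<^esub> y) (u \<otimes>\<^bsub>R\<^esub> v) = \<psi>' y (tsum S (C.\<Delta> x) (\<lambda>a b. \<psi> a u \<otimes>\<^bsub>S\<^esub> \<psi> b v))"
        using x y u v by (simp add: pure pmeas_mult[OF p])
      also have "\<dots> = tsum Q (C.\<Delta> x) (\<lambda>a b. \<psi>' y (\<psi> a u \<otimes>\<^bsub>S\<^esub> \<psi> b v))"
        using u v by (intro C.csum_lin[OF bilin_lin2[OF qb y]] x S.m_closed bilin_closed[OF pb])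
      also have "\<dots> = tsum Q (C.\<Delta> x) (\<lambda>a b. tsum Q (D.\<Delta> y) (\<lambda>c d. \<psi>' c (\<psi> a u) \<otimes>\<^bsub>Q\<^esub> \<psi>' d (\<psi> b v)))"
        using u v y by (intro C.csum_cong x pmeas_mult[OF q] bilin_closed[OF pb])
      also have "\<dots> = tsum Q (C.\<Delta> x) (\<lambda>a b. tsum Q (D.\<Delta> y) (\<lambda>c d.
          \<theta> (a \<boxtimes>\<^bsub>T\<^esub> c) u \<otimes>\<^bsub>Q\<^esub> \<theta> (b \<boxtimes>\<^bsub>T\<^esub> d) v))"
        using u v y by (intro C.csum_cong D.csum_cong x) (simp_all add: pure)
      also have "\<dots> = tsum Q (comult CD (x \<boxtimes>\<^bsub>T\<^esub> y)) (\<lambda>z\<^sub>1 z\<^sub>2. \<theta> z\<^sub>1 u \<otimes>\<^bsub>Q\<^esub> \<theta> z\<^sub>2 v)"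
        by (rule comult_sum[OF bt x y, symmetric])
      finally show "\<theta> (x \<boxtimes>\<^bsub>T\<^esub> y) (u \<otimes>\<^bsub>R\<^esub> v) = tsum Q (comult CD (x \<boxtimes>\<^bsub>T\<^esub> y)) (\<lambda>z\<^sub>1 z\<^sub>2. \<theta> z\<^sub>1 u \<otimes>\<^bsub>Q\<^esub> \<theta> z\<^sub>2 v)" .
    qed (use u v in simp)
  qed
  have l1: "lin K (ground K) Q (\<lambda>c. c \<odot>\<^bsub>Q\<^esub> \<one>\<^bsub>Q\<^esub>)"
    by (intro linI ground_module Qm.module_axioms module_cring[OF Qm.module_axioms])
       (simp_all add: ground_def Qm.smult_l_distr Qm.smult_assoc1)
  have 3: "\<theta> z \<one>\<^bsub>R\<^esub> = counit CD z \<odot>\<^bsub>Q\<^esub> \<one>\<^bsub>Q\<^esub>" if z: "z \<in> carrier T" for z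
  proof (rule ktensor_lin_ext[OF C.C_module D.C_module bilin_lin1[OF b R.one_closed] lin_compose[OF lin_counit_T l1] _ z])
    fix x y assume x: "x \<in> carrier C" and y: "y \<in> carrier D"
    show "\<theta> (x \<boxtimes>\<^bsub>T\<^esub> y) \<one>\<^bsub>R\<^esub> = counit CD (x \<boxtimes>\<^bsub>T\<^esub> y) \<odot>\<^bsub>Q\<^esub> \<one>\<^bsub>Q\<^esub>"
      using x y C.counit_closed D.counit_closed
      by (simp add: pure pmeas_one[OF p] lin_smult[OF bilin_lin2[OF qb]] pmeas_one[OF q] counit_pure
          Qm.smult_assoc1)
  qed
  show ?thesis unfolding pmeas_def carrier_CD using 1 2 3 by blast
qed

text \<open>Counterpart of \<open>hopf_measuring\<close> free of extensionality, so that it survives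
  substitution of coalgebra maps and composition. Restricting both arguments leads back.\<close>

definition hpmeas ::
  "'k ring \<Rightarrow> ('k, 'u, 'a) hopf_algebroid \<Rightarrow> ('k, 'v, 'b) hopf_algebroid \<Rightarrow> ('k, 'c) coalgebra \<Rightarrow>
   ('c \<Rightarrow> 'u \<Rightarrow> 'v) \<Rightarrow> ('c \<Rightarrow> 'a \<Rightarrow> 'b) \<Rightarrow> bool" where
  "hpmeas K H H' C \<Psi> \<psi> \<longleftrightarrow> cocoalg K C \<and>
     pmeas K C (total_alg H) (total_alg H') \<Psi> \<and> pmeas K C (base_alg H) (base_alg H') \<psi> \<and>
     (\<forall>x\<in>carrier C. \<forall>a\<in>carrier (base_alg H). \<Psi> x (src H a) = src H' (\<psi> x a)) \<and>
     (\<forall>x\<in>carrier C. \<forall>a\<in>carrier (base_alg H). \<Psi> x (tgt H a) = tgt H' (\<psi> x a)) \<and>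
     (\<forall>x\<in>carrier C. \<forall>u\<in>carrier (total_alg H). \<Psi> x (antipode H u) = antipode H' (\<Psi> x u)) \<and>
     (\<forall>x\<in>carrier C. \<forall>u\<in>carrier (total_alg H). \<psi> x (augmentation H u) = augmentation H' (\<Psi> x u)) \<and>
     (\<forall>x\<in>carrier C. \<forall>u\<in>carrier (total_alg H). coproduct H' (\<Psi> x u) =
        tsum (atensor H') (coproduct H u) (\<lambda>u\<^sub>1 u\<^sub>2.
          tsum (atensor H') (comult C x) (\<lambda>x\<^sub>1 x\<^sub>2. \<Psi> x\<^sub>1 u\<^sub>1 \<boxtimes>\<^bsub>atensor H'\<^esub> \<Psi> x\<^sub>2 u\<^sub>2)))"

lemma hpmeas_pmeas:
  "hpmeas K H H' C \<Psi> \<psi> \<Longrightarrow> pmeas K C (total_alg H) (total_alg H') \<Psi>"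
  "hpmeas K H H' C \<Psi> \<psi> \<Longrightarrow> pmeas K C (base_alg H) (base_alg H') \<psi>"
  by (simp_all add: hpmeas_def)

lemma hpmeas_eqs:
  assumes "hpmeas K H H' C \<Psi> \<psi>" "x \<in> carrier C"
  shows "a \<in> carrier (base_alg H) \<Longrightarrow> \<Psi> x (src H a) = src H' (\<psi> x a)"
    "a \<in> carrier (base_alg H) \<Longrightarrow> \<Psi> x (tgt H a) = tgt H' (\<psi> x a)"
    "u \<in> carrier (total_alg H) \<Longrightarrow> \<Psi> x (antipode H u) = antipode H' (\<Psi> x u)"
    "u \<in> carrier (total_alg H) \<Longrightarrow> \<psi> x (augmentation H u) = augmentation H' (\<Psi> x u)"
    "u \<in> carrier (total_alg H) \<Longrightarrow> coproduct H' (\<Psi> x u) =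
        tsum (atensor H') (coproduct H u) (\<lambda>u\<^sub>1 u\<^sub>2.
          tsum (atensor H') (comult C x) (\<lambda>x\<^sub>1 x\<^sub>2. \<Psi> x\<^sub>1 u\<^sub>1 \<boxtimes>\<^bsub>atensor H'\<^esub> \<Psi> x\<^sub>2 u\<^sub>2))"
  using assms by (simp_all add: hpmeas_def)

lemma hopf_measuring_hpmeas:
  assumes "halg K H" "halg K H'" "hopf_measuring K H H' C \<Psi> \<psi>"
  shows "hpmeas K H H' C \<Psi> \<psi>"
proof -
  interpret H: halg K H by fact
  interpret H': halg K H' by fact
  interpret C: cocoalg K C using assms by (intro cocoalgI) (simp add: hopf_measuring_def)
  show ?thesis
    using assms(3) C.cocoalg_axioms alg_measuring_pmeas[OF C.C_module H.U_module H'.U_module]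
      alg_measuring_pmeas[OF C.C_module H.A_module H'.A_module]
    by (simp add: hopf_measuring_def hpmeas_def hopf_V_def)
qed

lemma hpmeas_hopf_measuring:
  assumes "halg K H" "halg K H'" and p: "hpmeas K H H' C \<Psi> \<psi>"
  shows "hopf_measuring K H H' C (\<lambda>x\<in>carrier C. \<lambda>u\<in>carrier (total_alg H). \<Psi> x u)
    (\<lambda>x\<in>carrier C. \<lambda>a\<in>carrier (base_alg H). \<psi> x a)"
proof -
  interpret H: halg K H by fact
  interpret H': halg K H' by fact
  interpret C: cocoalg K C using p by (simp add: hpmeas_def)
  let ?\<Psi> = "\<lambda>x\<in>carrier C. \<lambda>u\<in>carrier H.U. \<Psi> x u" and ?\<psi> = "\<lambda>x\<in>carrier C. \<lambda>a\<in>carrier H.A. \<psi> x a"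
  have P: "pmeas K C H.U H'.U \<Psi>" "pmeas K C H.A H'.A \<psi>" using p by (simp_all add: hpmeas_def)
  note b = pmeas_bilin[OF P(1)] pmeas_bilin[OF P(2)]
  have V: "(?\<Psi> x, ?\<psi> x) \<in> hopf_V K H H'" if x: "x \<in> carrier C" for x
    using p x lin_linear_maps[OF bilin_lin2[OF b(1) x]] lin_linear_maps[OF bilin_lin2[OF b(2) x]]
    by (simp add: hopf_V_def hpmeas_def H.src_closed H.tgt_closed lin_closed[OF H.lin_antipode]
        lin_closed[OF H.lin_augmentation])
  have D: "coproduct H' (?\<Psi> x u) = tsum H'.T (coproduct H u) (\<lambda>u\<^sub>1 u\<^sub>2.
      tsum H'.T (C.\<Delta> x) (\<lambda>x\<^sub>1 x\<^sub>2. ?\<Psi> x\<^sub>1 u\<^sub>1 \<boxtimes>\<^bsub>H'.T\<^esub> ?\<Psi> x\<^sub>2 u\<^sub>2))" if "x \<in> carrier C" "u \<in> carrier H.U" for x u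
  proof -
    have "coproduct H' (?\<Psi> x u) = tsum H'.T (coproduct H u) (\<lambda>u\<^sub>1 u\<^sub>2.
        tsum H'.T (C.\<Delta> x) (\<lambda>x\<^sub>1 x\<^sub>2. \<Psi> x\<^sub>1 u\<^sub>1 \<boxtimes>\<^bsub>H'.T\<^esub> \<Psi> x\<^sub>2 u\<^sub>2))"
      using that p by (simp add: hpmeas_def)
    also have "\<dots> = tsum H'.T (coproduct H u) (\<lambda>u\<^sub>1 u\<^sub>2.
        tsum H'.T (C.\<Delta> x) (\<lambda>x\<^sub>1 x\<^sub>2. ?\<Psi> x\<^sub>1 u\<^sub>1 \<boxtimes>\<^bsub>H'.T\<^esub> ?\<Psi> x\<^sub>2 u\<^sub>2))"
      using that by (intro tsum_cong[OF H.is_tensor_T H.coproduct_closed] C.csum_cong) auto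
    finally show ?thesis .
  qed
  show ?thesis
    unfolding hopf_measuring_def
    using C.cocoalgebra V D pmeas_alg_measuring[OF C.coalg_axioms H.U_alg P(1)]
      pmeas_alg_measuring[OF C.coalg_axioms H.A_alg P(2)] by blast
qed

text \<open>\<open>chom_sum\<close> turns each Sweedler sum over \<open>f x\<close> into one over
  \<open>x\<close>. Such pullbacks are the test measurings against which two coalgebra maps are
  compared.\<close>

lemma hpmeas_chom:
  assumes H: "halg K H" "halg K H'" and p: "hpmeas K H H' D \<Psi> \<psi>" and f: "chom K C D f"
  shows "hpmeas K H H' C (\<lambda>x. \<Psi> (f x)) (\<lambda>x. \<psi> (f x))"
proof -
  interpret H: halg K H by fact
  interpret H': halg K H' by fact
  have P: "pmeas K D H.U H'.U \<Psi>" "pmeas K D H.A H'.A \<psi>" using p by (simp_all add: hpmeas_def)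
  have b: "bilin K D D H'.T (\<lambda>x y. \<Psi> x u \<boxtimes>\<^bsub>H'.T\<^esub> \<Psi> y v)" if "u \<in> carrier H.U" "v \<in> carrier H.U" for u v
    by (rule bilin_comp[OF H'.bilin_T bilin_lin1[OF pmeas_bilin[OF P(1)] that(1)] bilin_lin1[OF pmeas_bilin[OF P(1)] that(2)]])
  have "tsum H'.T (coproduct H u) (\<lambda>u\<^sub>1 u\<^sub>2. tsum H'.T (comult D (f x)) (\<lambda>x\<^sub>1 x\<^sub>2. \<Psi> x\<^sub>1 u\<^sub>1 \<boxtimes>\<^bsub>H'.T\<^esub> \<Psi> x\<^sub>2 u\<^sub>2))
     = tsum H'.T (coproduct H u) (\<lambda>u\<^sub>1 u\<^sub>2. tsum H'.T (comult C x) (\<lambda>x\<^sub>1 x\<^sub>2. \<Psi> (f x\<^sub>1) u\<^sub>1 \<boxtimes>\<^bsub>H'.T\<^esub> \<Psi> (f x\<^sub>2) u\<^sub>2))"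
    if "x \<in> carrier C" "u \<in> carrier H.U" for x u
    using that by (intro tsum_cong[OF H.is_tensor_T H.coproduct_closed] chom_sum[OF f b])
  then show ?thesis
    using p chom_closed[OF f] chom_cocoalg[OF f] pmeas_chom[OF P(1) f H'.U_alg H.U_alg] pmeas_chom[OF P(2) f H'.A_alg H.A_alg]
    by (simp add: hpmeas_def)
qed

text \<open>Balancedness is where cocommutativity of the coalgebra enters.\<close>

lemma hpmeas_balanced:
  assumes H: "halg K H" "halg K H'" and p: "hpmeas K H H' C \<Psi> \<psi>" and x: "x \<in> carrier C"
  defines "\<beta> \<equiv> \<lambda>u v. tsum (atensor H') (comult C x) (\<lambda>p q. \<Psi> p u \<boxtimes>\<^bsub>atensor H'\<^esub> \<Psi> q v)"
  shows "bilin K (total_alg H) (total_alg H) (atensor H') \<beta>"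
    and "\<And>a u v. a \<in> carrier (base_alg H) \<Longrightarrow> u \<in> carrier (total_alg H) \<Longrightarrow> v \<in> carrier (total_alg H) \<Longrightarrow>
      \<beta> (tgt H a \<otimes>\<^bsub>total_alg H\<^esub> u) v = \<beta> u (src H a \<otimes>\<^bsub>total_alg H\<^esub> v)"
proof -
  interpret H: halg K H by fact
  interpret H': halg K H' by fact
  interpret C: cocoalg K C using p by (simp add: hpmeas_def)
  have P: "pmeas K C H.U H'.U \<Psi>" "pmeas K C H.A H'.A \<psi>" using p by (simp_all add: hpmeas_def)
  note b1 = pmeas_bilin[OF P(1)] and b2 = pmeas_bilin[OF P(2)]
  have bb: "bilin K H.U H.U H'.T (\<lambda>u v. \<Psi> c u \<boxtimes>\<^bsub>H'.T\<^esub> \<Psi> d v)" if "c \<in> carrier C" "d \<in> carrier C" for c d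
    by (rule bilin_comp[OF H'.bilin_T bilin_lin2[OF b1 that(1)] bilin_lin2[OF b1 that(2)]])
  show "bilin K H.U H.U H'.T \<beta>"
    unfolding \<beta>_def
    by (intro bilinI H.U_module H'.T_module C.lin_csum_fun x bb[THEN bilin_lin1] bb[THEN bilin_lin2])
  fix a u v assume a: "a \<in> carrier H.A" and u: "u \<in> carrier H.U" and v: "v \<in> carrier H.U"
  \<comment> \<open>Common form of the two sides: the legs of \<open>x\<close> act on
    \<open>u\<close>, on \<open>a\<close> and on \<open>v\<close> in this order, with
    \<open>a\<close> already moved into the second factor by the source map.\<close>
  let ?\<sigma> = "\<lambda>c d e. \<Psi> c u \<boxtimes>\<^bsub>H'.T\<^esub> (src H' (\<psi> d a) \<otimes>\<^bsub>H'.U\<^esub> \<Psi> e v)"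
  have c1: "\<Psi> c w \<in> carrier H'.U" if "c \<in> carrier C" "w \<in> carrier H.U" for c w by (rule bilin_closed[OF b1 that])
  have c2: "\<psi> c a \<in> carrier H'.A" if "c \<in> carrier C" for c by (rule bilin_closed[OF b2 that a])
  have ls: "lin K C H'.U (\<lambda>d. src H' (\<psi> d a))" by (rule lin_compose[OF bilin_lin1[OF b2 a] H'.lin_src])
  have bm: "bilin K C C H'.U (\<lambda>d e. src H' (\<psi> d a) \<otimes>\<^bsub>H'.U\<^esub> \<Psi> e v)"
    by (rule bilin_comp[OF bilin_mult[OF H'.U_alg] ls bilin_lin1[OF b1 v]])
  have t: "trilin K C C C H'.T ?\<sigma>"
    unfolding trilin_def
    by (intro conjI ballI C.C_module H'.T_module
        lin_compose[OF bilin_lin1[OF b1 u] bilin_lin1[OF H'.bilin_T]]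
        lin_compose[OF bilin_lin1[OF bm] bilin_lin2[OF H'.bilin_T]]
        lin_compose[OF bilin_lin2[OF bm] bilin_lin2[OF H'.bilin_T]] bilin_closed[OF bm] c1 u)
  have cl: "?\<sigma> c d e \<in> carrier H'.T" if "c \<in> carrier C" "d \<in> carrier C" "e \<in> carrier C" for c d e
    using that by (intro H'.T_closed c1 u bilin_closed[OF bm])
  have "\<beta> (tgt H a \<otimes>\<^bsub>H.U\<^esub> u) v = tsum H'.T (C.\<Delta> x) (\<lambda>p q. tsum H'.T (C.\<Delta> p) (\<lambda>c d. ?\<sigma> d c q))"
    unfolding \<beta>_def
  proof (rule C.csum_cong[OF x])
    fix y z assume y: "y \<in> carrier C" and z: "z \<in> carrier C"
    have "\<Psi> y (tgt H a \<otimes>\<^bsub>H.U\<^esub> u) = tsum H'.U (C.\<Delta> y) (\<lambda>c d. \<Psi> c (tgt H a) \<otimes>\<^bsub>H'.U\<^esub> \<Psi> d u)"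
      by (rule pmeas_mult[OF P(1) y H.tgt_closed[OF a] u])
    then have "\<Psi> y (tgt H a \<otimes>\<^bsub>H.U\<^esub> u) \<boxtimes>\<^bsub>H'.T\<^esub> \<Psi> z v
      = tsum H'.T (C.\<Delta> y) (\<lambda>c d. (\<Psi> c (tgt H a) \<otimes>\<^bsub>H'.U\<^esub> \<Psi> d u) \<boxtimes>\<^bsub>H'.T\<^esub> \<Psi> z v)"
      using z y u v a by (simp add: C.csum_lin[OF bilin_lin1[OF H'.bilin_T]] c1 H.tgt_closed)
    also have "\<dots> = tsum H'.T (C.\<Delta> y) (\<lambda>c d. ?\<sigma> d c z)"
    proof (rule C.csum_cong[OF y])
      fix c d assume "c \<in> carrier C" "d \<in> carrier C"
      then show "(\<Psi> c (tgt H a) \<otimes>\<^bsub>H'.U\<^esub> \<Psi> d u) \<boxtimes>\<^bsub>H'.T\<^esub> \<Psi> z v = ?\<sigma> d c z"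
        using p a H'.T_balanced[OF c2 c1 c1] u v z by (simp add: hpmeas_def)
    qed
    finally show "\<Psi> y (tgt H a \<otimes>\<^bsub>H.U\<^esub> u) \<boxtimes>\<^bsub>H'.T\<^esub> \<Psi> z v = tsum H'.T (C.\<Delta> y) (\<lambda>c d. ?\<sigma> d c z)" .
  qed
  \<comment> \<open>Balancing in \<open>H'\<close> has left \<open>a\<close> on the first leg and
    \<open>u\<close> on the second, the opposite of the order in \<open>?\<sigma>\<close>.
    Cocommutativity exchanges the two legs.\<close>
  also have "\<dots> = tsum H'.T (C.\<Delta> x) (\<lambda>p q. tsum H'.T (C.\<Delta> p) (\<lambda>c d. ?\<sigma> c d q))"
    by (intro C.csum_cong C.cocomm_sum[OF trilin_left(2)[OF t]] x)
  also have "\<dots> = tsum H'.T (C.\<Delta> x) (\<lambda>p q. tsum H'.T (C.\<Delta> q) (?\<sigma> p))"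
    by (rule C.coassoc_sum[OF t x])
  also have "\<dots> = \<beta> u (src H a \<otimes>\<^bsub>H.U\<^esub> v)"
    unfolding \<beta>_def
  proof (rule C.csum_cong[OF x])
    fix y z assume y: "y \<in> carrier C" and z: "z \<in> carrier C"
    have "\<Psi> z (src H a \<otimes>\<^bsub>H.U\<^esub> v) = tsum H'.U (C.\<Delta> z) (\<lambda>d e. \<Psi> d (src H a) \<otimes>\<^bsub>H'.U\<^esub> \<Psi> e v)"
      by (rule pmeas_mult[OF P(1) z H.src_closed[OF a] v])
    also have "\<dots> = tsum H'.U (C.\<Delta> z) (\<lambda>d e. src H' (\<psi> d a) \<otimes>\<^bsub>H'.U\<^esub> \<Psi> e v)"
      using p a by (intro C.csum_cong z) (simp add: hpmeas_def)
    finally show "tsum H'.T (C.\<Delta> z) (?\<sigma> y) = \<Psi> y u \<boxtimes>\<^bsub>H'.T\<^esub> \<Psi> z (src H a \<otimes>\<^bsub>H.U\<^esub> v)"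
      using C.csum_lin[OF bilin_lin2[OF H'.bilin_T c1[OF y u]] z bilin_closed[OF bm]] by simp
  qed
  finally show "\<beta> (tgt H a \<otimes>\<^bsub>H.U\<^esub> u) v = \<beta> u (src H a \<otimes>\<^bsub>H.U\<^esub> v)" .
qed

text \<open>Every law is linear in the element of the tensor coalgebra and reduces to pure tensors,
  where source, target, antipode and counit are passed through the two maps in turn. The coproduct
  is the delicate case, since a Sweedler sum has to be taken over a tensor that is itself a sum in
  the balanced square of \<open>H'\<close>.\<close>

lemma hpmeas_compose:
  fixes C :: "('k, 'c) coalgebra" and D :: "('k, 'd) coalgebra"
  assumes H: "halg K H" "halg K H'" "halg K H''"
    and p: "hpmeas K H H' C \<Phi> \<phi>" and q: "hpmeas K H' H'' D \<Phi>' \<phi>'"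
    and b: "bilin K (ktensor K C D) (total_alg H) (total_alg H'') \<Theta>"
      "bilin K (ktensor K C D) (base_alg H) (base_alg H'') \<theta>"
    and pure: "\<And>x y u. x \<in> carrier C \<Longrightarrow> y \<in> carrier D \<Longrightarrow> u \<in> carrier (total_alg H) \<Longrightarrow>
        \<Theta> (x \<boxtimes>\<^bsub>ktensor K C D\<^esub> y) u = \<Phi>' y (\<Phi> x u)"
      "\<And>x y u. x \<in> carrier C \<Longrightarrow> y \<in> carrier D \<Longrightarrow> u \<in> carrier (base_alg H) \<Longrightarrow>
        \<theta> (x \<boxtimes>\<^bsub>ktensor K C D\<^esub> y) u = \<phi>' y (\<phi> x u)"
  shows "hpmeas K H H'' (tensor_coalg K C D) \<Theta> \<theta>"
proof -
  interpret H: halg K H by fact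
  interpret H': halg K H' by fact
  interpret H'': halg K H'' by fact
  interpret cocoalg_pair K C D using p q by (simp add: hpmeas_def cocoalg_pair_def)
  have P: "pmeas K C H.U H'.U \<Phi>" "pmeas K C H.A H'.A \<phi>" using p by (simp_all add: hpmeas_def)
  have Q: "pmeas K D H'.U H''.U \<Phi>'" "pmeas K D H'.A H''.A \<phi>'" using q by (simp_all add: hpmeas_def)
  note pb = pmeas_bilin[OF P(1)] pmeas_bilin[OF P(2)] and qb = pmeas_bilin[OF Q(1)] pmeas_bilin[OF Q(2)]
  note ext = ktensor_lin_ext[OF C.C_module D.C_module]
  note cl = bilin_closed[OF pb(1)] bilin_closed[OF pb(2)] bilin_closed[OF qb(1)] bilin_closed[OF qb(2)]
  have 1: "pmeas K CD H.U H''.U \<Theta>" "pmeas K CD H.A H''.A \<theta>"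
    using pmeas_compose[OF cocoalg_pair_axioms H.U_alg H'.U_alg H''.U_alg P(1) Q(1) b(1) pure(1)]
      pmeas_compose[OF cocoalg_pair_axioms H.A_alg H'.A_alg H''.A_alg P(2) Q(2) b(2) pure(2)] by blast+
  have 2: "\<Theta> z (src H a) = src H'' (\<theta> z a)" if a: "a \<in> carrier H.A" and z: "z \<in> carrier T" for z a
    by (rule ext[OF bilin_lin1[OF b(1) H.src_closed[OF a]] lin_compose[OF bilin_lin1[OF b(2) a] H''.lin_src] _ z])
       (simp add: pure H.src_closed hpmeas_eqs[OF p] hpmeas_eqs[OF q] cl a)
  have 3: "\<Theta> z (tgt H a) = tgt H'' (\<theta> z a)" if a: "a \<in> carrier H.A" and z: "z \<in> carrier T" for z a
    by (rule ext[OF bilin_lin1[OF b(1) H.tgt_closed[OF a]] lin_compose[OF bilin_lin1[OF b(2) a] H''.lin_tgt] _ z])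
       (simp add: pure H.tgt_closed hpmeas_eqs[OF p] hpmeas_eqs[OF q] cl a)
  have 4: "\<Theta> z (antipode H u) = antipode H'' (\<Theta> z u)" if u: "u \<in> carrier H.U" and z: "z \<in> carrier T" for z u
    by (rule ext[OF bilin_lin1[OF b(1) lin_closed[OF H.lin_antipode u]]
          lin_compose[OF bilin_lin1[OF b(1) u] H''.lin_antipode] _ z])
       (simp add: pure lin_closed[OF H.lin_antipode] hpmeas_eqs(3)[OF p] hpmeas_eqs(3)[OF q] cl u)
  have 5: "\<theta> z (augmentation H u) = augmentation H'' (\<Theta> z u)" if u: "u \<in> carrier H.U" and z: "z \<in> carrier T" for z u
    by (rule ext[OF bilin_lin1[OF b(2) lin_closed[OF H.lin_augmentation u]]
          lin_compose[OF bilin_lin1[OF b(1) u] H''.lin_augmentation] _ z])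
       (simp add: pure lin_closed[OF H.lin_augmentation] hpmeas_eqs(4)[OF p] hpmeas_eqs(4)[OF q] cl u)
  have 6: "coproduct H'' (\<Theta> z u) = tsum H''.T (coproduct H u) (\<lambda>u\<^sub>1 u\<^sub>2.
      tsum H''.T (comult CD z) (\<lambda>z\<^sub>1 z\<^sub>2. \<Theta> z\<^sub>1 u\<^sub>1 \<boxtimes>\<^bsub>H''.T\<^esub> \<Theta> z\<^sub>2 u\<^sub>2))"
    if u: "u \<in> carrier H.U" and z: "z \<in> carrier T" for z u
  proof -
    have bt: "bilin K T T H''.T (\<lambda>z\<^sub>1 z\<^sub>2. \<Theta> z\<^sub>1 v \<boxtimes>\<^bsub>H''.T\<^esub> \<Theta> z\<^sub>2 w)" if "v \<in> carrier H.U" "w \<in> carrier H.U" for v w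
      by (rule bilin_comp[OF H''.bilin_T bilin_lin1[OF b(1) that(1)] bilin_lin1[OF b(1) that(2)]])
    show ?thesis
    proof (rule ext[OF lin_compose[OF bilin_lin1[OF b(1) u] H''.lin_coproduct]
          lin_tsum_fun[OF H.is_tensor_T H.coproduct_closed[OF u] T_module H''.T_module lin_comult_sum[OF bt]] _ z])
      fix x y assume x: "x \<in> carrier C" and y: "y \<in> carrier D"
      let ?\<beta> = "\<lambda>v w. tsum H''.T (D.\<Delta> y) (\<lambda>c d. \<Phi>' c v \<boxtimes>\<^bsub>H''.T\<^esub> \<Phi>' d w)"
      let ?\<gamma> = "\<lambda>v w. tsum H'.T (C.\<Delta> x) (\<lambda>a b. \<Phi> a v \<boxtimes>\<^bsub>H'.T\<^esub> \<Phi> b w)"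
      \<comment> \<open>Balancedness makes \<open>?\<beta>\<close> descend to
        \<open>atensor H'\<close>. It then acts termwise on the coproduct of
        \<open>\<Phi> x u\<close>, which is known only as a sum and not through its chosen
        representative.\<close>
      note l = H'.T_lift[OF hpmeas_balanced[OF H(2,3) q y]]
      have gc: "?\<gamma> v w \<in> carrier H'.T" if "v \<in> carrier H.U" "w \<in> carrier H.U" for v w
        using that by (intro C.csum_closed H'.T_module x H'.T_closed cl)
      have "coproduct H'' (\<Theta> (x \<boxtimes>\<^bsub>T\<^esub> y) u) = tsum H''.T (coproduct H' (\<Phi> x u)) ?\<beta>"
        using x y u by (simp add: pure cl hpmeas_eqs(5)[OF q])
      also have "\<dots> = tsum H''.T (tsum H'.T (coproduct H u) ?\<gamma>) ?\<beta>"
        using x u by (simp add: hpmeas_eqs(5)[OF p])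
      also have "\<dots> = tsum H''.T (coproduct H u) (\<lambda>v w. tsum H''.T (?\<gamma> v w) ?\<beta>)"
        using gc by (intro lin_tsum[OF H.is_tensor_T H.coproduct_closed[OF u] _ l(1)])
      also have "\<dots> = tsum H''.T (coproduct H u) (\<lambda>v w. tsum H''.T (comult CD (x \<boxtimes>\<^bsub>T\<^esub> y))
          (\<lambda>z\<^sub>1 z\<^sub>2. \<Theta> z\<^sub>1 v \<boxtimes>\<^bsub>H''.T\<^esub> \<Theta> z\<^sub>2 w))"
      proof (rule tsum_cong[OF H.is_tensor_T H.coproduct_closed[OF u]])
        fix v w assume v: "v \<in> carrier H.U" and w: "w \<in> carrier H.U"
        have "tsum H''.T (?\<gamma> v w) ?\<beta> = tsum H''.T (C.\<Delta> x) (\<lambda>a b. tsum H''.T (\<Phi> a v \<boxtimes>\<^bsub>H'.T\<^esub> \<Phi> b w) ?\<beta>)"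
          using v w by (intro C.csum_lin[OF l(1)] x H'.T_closed cl)
        also have "\<dots> = tsum H''.T (C.\<Delta> x) (\<lambda>a b. ?\<beta> (\<Phi> a v) (\<Phi> b w))"
          using v w by (intro C.csum_cong l(2) x cl)
        also have "\<dots> = tsum H''.T (C.\<Delta> x) (\<lambda>a b. tsum H''.T (D.\<Delta> y)
            (\<lambda>c d. \<Theta> (a \<boxtimes>\<^bsub>T\<^esub> c) v \<boxtimes>\<^bsub>H''.T\<^esub> \<Theta> (b \<boxtimes>\<^bsub>T\<^esub> d) w))"
          using v w by (intro C.csum_cong D.csum_cong x y) (simp add: pure)
        also have "\<dots> = tsum H''.T (comult CD (x \<boxtimes>\<^bsub>T\<^esub> y)) (\<lambda>z\<^sub>1 z\<^sub>2. \<Theta> z\<^sub>1 v \<boxtimes>\<^bsub>H''.T\<^esub> \<Theta> z\<^sub>2 w)"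
          by (rule comult_sum[OF bt[OF v w] x y, symmetric])
        finally show "tsum H''.T (?\<gamma> v w) ?\<beta> =
          tsum H''.T (comult CD (x \<boxtimes>\<^bsub>T\<^esub> y)) (\<lambda>z\<^sub>1 z\<^sub>2. \<Theta> z\<^sub>1 v \<boxtimes>\<^bsub>H''.T\<^esub> \<Theta> z\<^sub>2 w)" .
      qed
      finally show "coproduct H'' (\<Theta> (x \<boxtimes>\<^bsub>T\<^esub> y) u) = tsum H''.T (coproduct H u) (\<lambda>v w.
          tsum H''.T (comult CD (x \<boxtimes>\<^bsub>T\<^esub> y)) (\<lambda>z\<^sub>1 z\<^sub>2. \<Theta> z\<^sub>1 v \<boxtimes>\<^bsub>H''.T\<^esub> \<Theta> z\<^sub>2 w))" .
    qed
  qed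
  show ?thesis
    unfolding hpmeas_def carrier_CD by (intro conjI ballI CD.cocoalg_axioms 1 2 3 4 5 6)
qed

section \<open>The category of Hopf algebroids\<close>

text \<open>The morphisms of \<^const>\<open>halg_hom\<close> without the extensionality convention.\<close>

definition hhom ::
  "'k ring \<Rightarrow> ('k, 'u, 'a) hopf_algebroid \<Rightarrow> ('k, 'v, 'b) hopf_algebroid \<Rightarrow>
   ('u \<Rightarrow> 'v) \<Rightarrow> ('a \<Rightarrow> 'b) \<Rightarrow> bool" where
  "hhom K H H' F f \<longleftrightarrow>
     lin K (total_alg H) (total_alg H') F \<and> F \<in> ring_hom (total_alg H) (total_alg H') \<and>
     lin K (base_alg H) (base_alg H') f \<and> f \<in> ring_hom (base_alg H) (base_alg H') \<and>
     (\<forall>a\<in>carrier (base_alg H). F (src H a) = src H' (f a)) \<and>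
     (\<forall>a\<in>carrier (base_alg H). F (tgt H a) = tgt H' (f a)) \<and>
     (\<forall>u\<in>carrier (total_alg H). F (antipode H u) = antipode H' (F u)) \<and>
     (\<forall>u\<in>carrier (total_alg H). f (augmentation H u) = augmentation H' (F u)) \<and>
     (\<forall>u\<in>carrier (total_alg H). coproduct H' (F u) =
        tsum (atensor H') (coproduct H u) (\<lambda>u\<^sub>1 u\<^sub>2. F u\<^sub>1 \<boxtimes>\<^bsub>atensor H'\<^esub> F u\<^sub>2))"

lemma hhom_eqs:
  assumes "hhom K H H' F f"
  shows "a \<in> carrier (base_alg H) \<Longrightarrow> F (src H a) = src H' (f a)"
    "a \<in> carrier (base_alg H) \<Longrightarrow> F (tgt H a) = tgt H' (f a)"
    "u \<in> carrier (total_alg H) \<Longrightarrow> F (antipode H u) = antipode H' (F u)"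
    "u \<in> carrier (total_alg H) \<Longrightarrow> f (augmentation H u) = augmentation H' (F u)"
    "u \<in> carrier (total_alg H) \<Longrightarrow> coproduct H' (F u) =
        tsum (atensor H') (coproduct H u) (\<lambda>u\<^sub>1 u\<^sub>2. F u\<^sub>1 \<boxtimes>\<^bsub>atensor H'\<^esub> F u\<^sub>2)"
  using assms by (simp_all add: hhom_def)

lemma hhom_lin:
  assumes "hhom K H H' F f"
  shows "lin K (total_alg H) (total_alg H') F" "lin K (base_alg H) (base_alg H') f"
    "F \<in> ring_hom (total_alg H) (total_alg H')" "f \<in> ring_hom (base_alg H) (base_alg H')"
  using assms by (simp_all add: hhom_def)

lemma halg_hom_iff:
  assumes H: "halg K H" "halg K H'"
  shows "(F, f) \<in> halg_hom K H H' \<longleftrightarrow> hhom K H H' F f \<and>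
    F \<in> extensional (carrier (total_alg H)) \<and> f \<in> extensional (carrier (base_alg H))"
proof -
  interpret H: halg K H by fact
  interpret H': halg K H' by fact
  show ?thesis
    using linear_maps_iff[OF H.U_module H'.U_module, of F] linear_maps_iff[OF H.A_module H'.A_module, of f] H.coproduct_closed
    by (auto simp: halg_hom_def hopf_V_def alg_hom_def hhom_def tensor_map_def)
qed

lemma hhom_cong:
  assumes H: "halg K H" "halg K H'" and h: "hhom K H H' F f"
    and eq: "\<And>u. u \<in> carrier (total_alg H) \<Longrightarrow> F u = F' u" "\<And>a. a \<in> carrier (base_alg H) \<Longrightarrow> f a = f' a"
  shows "hhom K H H' F' f'"
proof -
  interpret H: halg K H by fact
  interpret H': halg K H' by fact
  have 1: "F' \<in> ring_hom H.U H'.U" "f' \<in> ring_hom H.A H'.A"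
    using hhom_lin(3,4)[OF h] by (simp_all add: ring_hom_def Pi_def flip: eq)
  have 2: "coproduct H' (F' u) = tsum H'.T (coproduct H u) (\<lambda>u\<^sub>1 u\<^sub>2. F' u\<^sub>1 \<boxtimes>\<^bsub>H'.T\<^esub> F' u\<^sub>2)"
    if u: "u \<in> carrier H.U" for u
    unfolding eq(1)[OF u, symmetric] hhom_eqs(5)[OF h u]
    by (rule tsum_cong[OF H.is_tensor_T H.coproduct_closed[OF u]]) (simp add: eq)
  show ?thesis
    unfolding hhom_def
    by (intro conjI ballI 1 2 lin_cong[OF hhom_lin(1)[OF h] eq(1)] lin_cong[OF hhom_lin(2)[OF h] eq(2)])
       (simp_all add: hhom_eqs(1-4)[OF h] H.src_closed H.tgt_closed lin_closed[OF H.lin_antipode]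
          lin_closed[OF H.lin_augmentation] flip: eq)
qed

lemma hhom_id: "halg K H \<Longrightarrow> hhom K H H (\<lambda>u. u) (\<lambda>a. a)"
proof -
  assume "halg K H"
  then interpret halg K H .
  show ?thesis
    unfolding hhom_def
    by (simp add: lin_id U_module A_module tsum_T_id coproduct_closed ring_hom_def)
qed

lemma hhom_compose:
  assumes H: "halg K H" "halg K H'" "halg K H''" and F: "hhom K H H' F f" and G: "hhom K H' H'' G g"
  shows "hhom K H H'' (\<lambda>u. G (F u)) (\<lambda>a. g (f a))"
proof -
  interpret H: halg K H by fact
  interpret H': halg K H' by fact
  interpret H'': halg K H'' by fact
  note F' = hhom_lin[OF F] and G' = hhom_lin[OF G]
  have cF: "F u \<in> carrier H'.U" if "u \<in> carrier H.U" for u by (rule lin_closed[OF F'(1) that])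
  have cf: "f u \<in> carrier H'.A" if "u \<in> carrier H.A" for u by (rule lin_closed[OF F'(2) that])
  have cG: "G u \<in> carrier H''.U" if "u \<in> carrier H'.U" for u by (rule lin_closed[OF G'(1) that])
  have cg: "g u \<in> carrier H''.A" if "u \<in> carrier H'.A" for u by (rule lin_closed[OF G'(2) that])
  have b: "bilin K H'.U H'.U H''.T (\<lambda>u v. G u \<boxtimes>\<^bsub>H''.T\<^esub> G v)"
    by (rule bilin_comp[OF H''.bilin_T G'(1) G'(1)])
  \<comment> \<open>\<open>G\<close> is multiplicative and carries target and source of
    \<open>a\<close> to those of \<open>g a\<close>, so balancing over the base algebra of
    \<open>H'\<close> is inherited from balancing in \<open>H''\<close>.\<close>
  have bal: "G (tgt H' a \<otimes>\<^bsub>H'.U\<^esub> u) \<boxtimes>\<^bsub>H''.T\<^esub> G v = G u \<boxtimes>\<^bsub>H''.T\<^esub> G (src H' a \<otimes>\<^bsub>H'.U\<^esub> v)"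
    if "a \<in> carrier H'.A" "u \<in> carrier H'.U" "v \<in> carrier H'.U" for a u v
    using that H''.T_balanced[OF cg cG cG]
    by (simp add: ring_hom_mult[OF G'(3)] H'.src_closed H'.tgt_closed hhom_eqs[OF G])
  note l = H'.T_lift[OF b bal]
  have D: "coproduct H'' (G (F u)) = tsum H''.T (coproduct H u) (\<lambda>v w. G (F v) \<boxtimes>\<^bsub>H''.T\<^esub> G (F w))"
    if u: "u \<in> carrier H.U" for u
  proof -
    have "coproduct H'' (G (F u)) = tsum H''.T (tsum H'.T (coproduct H u) (\<lambda>v w. F v \<boxtimes>\<^bsub>H'.T\<^esub> F w))
        (\<lambda>v w. G v \<boxtimes>\<^bsub>H''.T\<^esub> G w)"
      using u by (simp add: hhom_eqs(5)[OF G] cF hhom_eqs(5)[OF F])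
    also have "\<dots> = tsum H''.T (coproduct H u) (\<lambda>v w. tsum H''.T (F v \<boxtimes>\<^bsub>H'.T\<^esub> F w) (\<lambda>v w. G v \<boxtimes>\<^bsub>H''.T\<^esub> G w))"
      by (intro lin_tsum[OF H.is_tensor_T H.coproduct_closed[OF u] _ l(1)] H'.T_closed cF)
    also have "\<dots> = tsum H''.T (coproduct H u) (\<lambda>v w. G (F v) \<boxtimes>\<^bsub>H''.T\<^esub> G (F w))"
      by (intro tsum_cong[OF H.is_tensor_T H.coproduct_closed[OF u]] l(2) cF)
    finally show ?thesis .
  qed
  have r: "(\<lambda>u. G (F u)) \<in> ring_hom H.U H''.U" "(\<lambda>a. g (f a)) \<in> ring_hom H.A H''.A"
    using ring_hom_trans[OF F'(3) G'(3)] ring_hom_trans[OF F'(4) G'(4)] by (simp_all add: comp_def)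
  show ?thesis
    unfolding hhom_def
    by (intro conjI ballI lin_compose[OF F'(1) G'(1)] lin_compose[OF F'(2) G'(2)] r D)
       (simp_all add: hhom_eqs(1-4)[OF F] hhom_eqs(1-4)[OF G] cF cf)
qed

lemma category_HAlg:
  "category (HAlg K :: ('k, 'u, 'a) hopf_algebroid set) (halg_hom K) halg_comp halg_id"
proof -
  have id: "halg_id X \<in> halg_hom K X X" if "X \<in> HAlg K" for X :: "('k, 'u, 'a) hopf_algebroid"
  proof -
    note X = HAlg_halg[OF that]
    show ?thesis
      using hhom_cong[OF X X hhom_id[OF X], of "\<lambda>u\<in>carrier (total_alg X). u" "\<lambda>a\<in>carrier (base_alg X). a"]
      by (simp add: halg_id_def halg_hom_iff[OF X X])
  qed
  have comp: "halg_comp X Y Z p q \<in> halg_hom K X Z"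
    if X: "X \<in> HAlg K" and Y: "Y \<in> HAlg K" and Z: "Z \<in> HAlg K" and p: "p \<in> halg_hom K X Y" and q: "q \<in> halg_hom K Y Z"
    for X Y Z :: "('k, 'u, 'a) hopf_algebroid" and p q
  proof -
    note h = HAlg_halg[OF X] HAlg_halg[OF Y] HAlg_halg[OF Z]
    obtain F f G g where pq: "p = (F, f)" "q = (G, g)" by (cases p; cases q)
    have "hhom K X Z (\<lambda>u. G (F u)) (\<lambda>a. g (f a))"
      using p q unfolding pq halg_hom_iff[OF h(1,2)] halg_hom_iff[OF h(2,3)]
      by (intro hhom_compose[OF h]) auto
    from hhom_cong[OF h(1,3) this, of "compose (carrier (total_alg X)) G F" "compose (carrier (base_alg X)) g f"]
    show ?thesis by (simp add: halg_comp_def pq halg_hom_iff[OF h(1,3)] compose_def)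
  qed
  have fun1: "F \<in> carrier (total_alg X) \<rightarrow> carrier (total_alg Y)" "f \<in> carrier (base_alg X) \<rightarrow> carrier (base_alg Y)"
    "F \<in> extensional (carrier (total_alg X))" "f \<in> extensional (carrier (base_alg X))"
    if "(F, f) \<in> halg_hom K X Y" for F f and X Y :: "('k, 'u, 'a) hopf_algebroid"
    using that by (auto simp: halg_hom_def hopf_V_def linear_maps_def PiE_def)
  have neutral: "halg_comp X X Y (halg_id X) p = p \<and> halg_comp X Y Y p (halg_id Y) = p"
    if "p \<in> halg_hom K X Y" for X Y :: "('k, 'u, 'a) hopf_algebroid" and p
  proof (cases p)
    case (Pair F f)
    note ff = fun1[OF that[unfolded Pair]]
    show ?thesis
      unfolding Pair halg_comp_def halg_id_def
      using ff Id_compose[OF ff(1,3)] Id_compose[OF ff(2,4)] compose_Id[OF ff(1,3)] compose_Id[OF ff(2,4)] by simp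
  qed
  have assoc: "halg_comp W Y Z (halg_comp W X Y p q) r = halg_comp W X Z p (halg_comp X Y Z q r)"
    if "p \<in> halg_hom K W X" for W X Y Z :: "('k, 'u, 'a) hopf_algebroid" and p q r
  proof (cases p)
    case (Pair F f)
    show ?thesis
      unfolding Pair halg_comp_def
      by (simp add: compose_assoc[OF fun1(1)[OF that[unfolded Pair]]] compose_assoc[OF fun1(2)[OF that[unfolded Pair]]])
  qed
  show ?thesis
    unfolding category_def using id comp neutral assoc by blast
qed

section \<open>Grouplike elements of measuring coalgebras\<close>

context
  fixes K :: "'k ring" and H :: "('k, 'u, 'a) hopf_algebroid" and H' :: "('k, 'v, 'b) hopf_algebroid"
  assumes H: "halg K H" and H': "halg K H'"
begin

interpretation H: halg K H by (rule H)
interpretation H': halg K H' by (rule H')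

text \<open>The coproduct of \<open>g\<close> is one pure tensor, so each Sweedler sum in a
  measuring law has a single term and the law becomes a homomorphism law; the counit value gives
  preservation of units.\<close>

lemma grouplike_hhom:
  assumes p: "hpmeas K H H' M \<Phi> \<phi>" and g: "grouplike K M g"
  shows "hhom K H H' (\<Phi> g) (\<phi> g)"
proof -
  interpret M: cocoalg K M using g by (simp add: grouplike_def)
  have gM: "g \<in> carrier M" "M.\<epsilon> g = \<one>\<^bsub>K\<^esub>" using g by (simp_all add: grouplike_def)
  note P = hpmeas_pmeas[OF p]
  note b1 = pmeas_bilin[OF P(1)] and b2 = pmeas_bilin[OF P(2)]
  have 1: "\<Phi> g \<in> ring_hom H.U H'.U"
    using gM by (intro ring_hom_memI)
      (simp_all add: bilin_closed[OF b1] lin_add[OF bilin_lin2[OF b1]] pmeas_mult[OF P(1)] pmeas_one[OF P(1)]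
        tsum_grouplike[OF g bilin_comp[OF bilin_mult[OF H'.U_alg] bilin_lin1[OF b1] bilin_lin1[OF b1]]])
  have 2: "\<phi> g \<in> ring_hom H.A H'.A"
    using gM by (intro ring_hom_memI)
      (simp_all add: bilin_closed[OF b2] lin_add[OF bilin_lin2[OF b2]] pmeas_mult[OF P(2)] pmeas_one[OF P(2)]
        tsum_grouplike[OF g bilin_comp[OF bilin_mult[OF H'.A_alg] bilin_lin1[OF b2] bilin_lin1[OF b2]]])
  have 3: "coproduct H' (\<Phi> g u) = tsum H'.T (coproduct H u) (\<lambda>v w. \<Phi> g v \<boxtimes>\<^bsub>H'.T\<^esub> \<Phi> g w)"
    if u: "u \<in> carrier H.U" for u
    unfolding hpmeas_eqs(5)[OF p gM(1) u]
    by (intro tsum_cong[OF H.is_tensor_T H.coproduct_closed[OF u]]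
        tsum_grouplike[OF g bilin_comp[OF H'.bilin_T bilin_lin1[OF b1] bilin_lin1[OF b1]]])
  show ?thesis
    unfolding hhom_def
    by (intro conjI ballI 1 2 3 bilin_lin2[OF b1 gM(1)] bilin_lin2[OF b2 gM(1)] hpmeas_eqs(1-4)[OF p gM(1)])
qed

lemma pmeas_scalar:
  assumes R: "k_algebra K R" and S: "k_algebra K S" and F: "lin K R S F" "F \<in> ring_hom R S"
  shows "pmeas K (unit_coalg K) R S (\<lambda>c u. c \<odot>\<^bsub>S\<^esub> F u)"
proof -
  note K = H.U.R.is_cring
  interpret R: ring R by (rule k_algebra_ring[OF R])
  interpret S: ring S by (rule k_algebra_ring[OF S])
  interpret Sm: module K S by (rule k_algebra_module[OF S])
  note g = ground_module[OF K]
  have cF: "F u \<in> carrier S" if "u \<in> carrier R" for u by (rule lin_closed[OF F(1) that])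
  have l: "lin K (ground K) S (\<lambda>c. c \<odot>\<^bsub>S\<^esub> x)" if "x \<in> carrier S" for x
    using that by (intro linI g Sm.module_axioms) (simp_all add: ground_def Sm.smult_l_distr Sm.smult_assoc1)
  have b: "bilin K (unit_coalg K) R S (\<lambda>c u. c \<odot>\<^bsub>S\<^esub> F u)"
  proof (rule bilinI[OF same_module_module[OF same_unit[OF K] g] k_algebra_module[OF R] Sm.module_axioms])
    show "lin K (unit_coalg K) S (\<lambda>c. c \<odot>\<^bsub>S\<^esub> F u)" if "u \<in> carrier R" for u
      by (rule same_module_lin[OF same_unit[OF K] same_module_refl l[OF cF[OF that]]])
    fix c assume "c \<in> carrier (unit_coalg K)"
    then have c: "c \<in> carrier K" by (simp add: carrier_unit[OF K])
    have "lin K S S (\<lambda>x. c \<odot>\<^bsub>S\<^esub> x)"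
      using c by (intro linI Sm.module_axioms) (simp_all add: Sm.smult_r_distr H.U.R.m_comm flip: Sm.smult_assoc1)
    from lin_compose[OF F(1) this] show "lin K R S (\<lambda>u. c \<odot>\<^bsub>S\<^esub> F u)" .
  qed
  have m: "c \<odot>\<^bsub>S\<^esub> F (u \<otimes>\<^bsub>R\<^esub> v) = tsum S (comult (unit_coalg K) c) (\<lambda>a b. (a \<odot>\<^bsub>S\<^esub> F u) \<otimes>\<^bsub>S\<^esub> (b \<odot>\<^bsub>S\<^esub> F v))"
    if c: "c \<in> carrier K" and u: "u \<in> carrier R" and v: "v \<in> carrier R" for c u v
    using c u v cF tsum_kpure[OF bilin_comp[OF bilin_mult[OF S] l[OF cF[OF u]] l[OF cF[OF v]]], of c "\<one>\<^bsub>K\<^esub>"]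
    by (simp add: comult_unit[OF K] ground_def ring_hom_mult[OF F(2)] k_algebra_smult[OF S])
  show ?thesis
    unfolding pmeas_def using b m by (simp add: carrier_unit[OF K] counit_unit[OF K] ring_hom_one[OF F(2)])
qed

text \<open>Converse of \<open>grouplike_hhom\<close>: a morphism is spread over the scalars. Sums
  over the coproduct of \<open>c\<close> have a single term in which \<open>c\<close> stands in one
  place and the unit in the other, and all structure maps commute with scalars.\<close>

lemma hpmeas_scalar:
  assumes h: "hhom K H H' F f"
  shows "hpmeas K H H' (unit_coalg K) (\<lambda>c u. c \<odot>\<^bsub>total_alg H'\<^esub> F u) (\<lambda>c a. c \<odot>\<^bsub>base_alg H'\<^esub> f a)"
proof -
  note K = H.U.R.is_cring
  note l = hhom_lin[OF h]
  have cF: "F u \<in> carrier H'.U" if "u \<in> carrier H.U" for u by (rule lin_closed[OF l(1) that])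
  have cf: "f u \<in> carrier H'.A" if "u \<in> carrier H.A" for u by (rule lin_closed[OF l(2) that])
  have ls: "lin K (ground K) H'.U (\<lambda>c. c \<odot>\<^bsub>H'.U\<^esub> x)" if "x \<in> carrier H'.U" for x
    using that by (intro linI ground_module[OF K] H'.U_module) (simp_all add: ground_def H'.U.smult_l_distr H'.U.smult_assoc1)
  have D: "coproduct H' (c \<odot>\<^bsub>H'.U\<^esub> F u) = tsum H'.T (coproduct H u) (\<lambda>v w.
      tsum H'.T (comult (unit_coalg K) c) (\<lambda>a b. (a \<odot>\<^bsub>H'.U\<^esub> F v) \<boxtimes>\<^bsub>H'.T\<^esub> (b \<odot>\<^bsub>H'.U\<^esub> F w)))"
    if c: "c \<in> carrier K" and u: "u \<in> carrier H.U" for c u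
  proof -
    interpret T: module K H'.T by (rule H'.T_module)
    have lc: "lin K H'.T H'.T (\<lambda>x. c \<odot>\<^bsub>H'.T\<^esub> x)"
      using c by (intro linI H'.T_module) (simp_all add: T.smult_r_distr H.U.R.m_comm flip: T.smult_assoc1)
    have "coproduct H' (c \<odot>\<^bsub>H'.U\<^esub> F u) = c \<odot>\<^bsub>H'.T\<^esub> tsum H'.T (coproduct H u) (\<lambda>v w. F v \<boxtimes>\<^bsub>H'.T\<^esub> F w)"
      using c u by (simp add: lin_smult[OF H'.lin_coproduct] cF hhom_eqs(5)[OF h])
    also have "\<dots> = tsum H'.T (coproduct H u) (\<lambda>v w. c \<odot>\<^bsub>H'.T\<^esub> (F v \<boxtimes>\<^bsub>H'.T\<^esub> F w))"
      by (intro lin_tsum[OF H.is_tensor_T H.coproduct_closed[OF u] _ lc] H'.T_closed cF)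
    also have "\<dots> = tsum H'.T (coproduct H u) (\<lambda>v w.
      tsum H'.T (comult (unit_coalg K) c) (\<lambda>a b. (a \<odot>\<^bsub>H'.U\<^esub> F v) \<boxtimes>\<^bsub>H'.T\<^esub> (b \<odot>\<^bsub>H'.U\<^esub> F w)))"
    proof (rule tsum_cong[OF H.is_tensor_T H.coproduct_closed[OF u]])
      fix v w assume v: "v \<in> carrier H.U" and w: "w \<in> carrier H.U"
      show "c \<odot>\<^bsub>H'.T\<^esub> (F v \<boxtimes>\<^bsub>H'.T\<^esub> F w) =
        tsum H'.T (comult (unit_coalg K) c) (\<lambda>a b. (a \<odot>\<^bsub>H'.U\<^esub> F v) \<boxtimes>\<^bsub>H'.T\<^esub> (b \<odot>\<^bsub>H'.U\<^esub> F w))"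
        using c v w cF tsum_kpure[OF bilin_comp[OF H'.bilin_T ls[OF cF[OF v]] ls[OF cF[OF w]]], of c "\<one>\<^bsub>K\<^esub>"]
        by (simp add: comult_unit[OF K] ground_def lin_smult[OF bilin_lin1[OF H'.bilin_T]])
    qed
    finally show ?thesis .
  qed
  show ?thesis
    unfolding hpmeas_def carrier_unit[OF K]
    by (intro conjI ballI cocoalg_unit[OF K] pmeas_scalar H.U_alg H'.U_alg H.A_alg H'.A_alg l D)
       (simp_all add: hhom_eqs(1-4)[OF h] cF cf lin_smult[OF H'.lin_src] lin_smult[OF H'.lin_tgt]
          lin_smult[OF H'.lin_antipode] lin_smult[OF H'.lin_augmentation])
qed

end

section \<open>Composition of measurings\<close>

text \<open>Composition of linear maps is bilinear, so it descends to the tensor product with values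
  in \<open>Vect\<close>. The three conclusions are exactly what \<open>hpmeas_compose\<close> and
  the return to extensional measurings consume.\<close>

lemma comp_measuring:
  assumes C: "module K C" "module K D" and p: "bilin K C R S \<Phi>" and q: "bilin K D S Q \<Phi>'"
  shows "bilin K (ktensor K C D) R Q (comp_measuring K C D R Q \<Phi> \<Phi>')"
    and "z \<in> carrier (ktensor K C D) \<Longrightarrow> comp_measuring K C D R Q \<Phi> \<Phi>' z \<in> extensional (carrier R)"
    and "x \<in> carrier C \<Longrightarrow> y \<in> carrier D \<Longrightarrow> u \<in> carrier R \<Longrightarrow>
      comp_measuring K C D R Q \<Phi> \<Phi>' (x \<boxtimes>\<^bsub>ktensor K C D\<^esub> y) u = \<Phi>' y (\<Phi> x u)"
proof -
  let ?T = "ktensor K C D" and ?V = "Vect K R Q"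
  let ?\<gamma> = "\<lambda>x y. compose (carrier R) (\<Phi>' y) (\<Phi> x)"
  note m = bilin_module[OF p] bilin_module[OF q]
  note V = Vect_module[OF m(2) m(6)]
  note pc = bilin_closed[OF p] and qc = bilin_closed[OF q]
  have cl: "?\<gamma> x y \<in> carrier ?V" if "x \<in> carrier C" "y \<in> carrier D" for x y
    using lin_linear_maps[OF lin_compose[OF bilin_lin2[OF p that(1)] bilin_lin2[OF q that(2)]]]
    by (simp add: Vect_def compose_def)
  have b: "bilin K C D ?V ?\<gamma>"
    by (intro bilinI linI C V cl)
       (auto simp: Vect_def compose_def lin_add[OF bilin_lin1[OF p]] lin_add[OF bilin_lin1[OF q]]
          lin_smult[OF bilin_lin1[OF p]] lin_smult[OF bilin_lin1[OF q]] pc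
          lin_add[OF bilin_lin2[OF q]] lin_smult[OF bilin_lin2[OF q]] intro!: restrict_ext)
  note l = lin_ktsum[OF b]
  have lm: "comp_measuring K C D R Q \<Phi> \<Phi>' \<in> linear_maps K ?T ?V"
    using lin_linear_maps[OF l(1)] by (simp add: comp_measuring_def)
  note T = ktensor_module[OF C]
  show "bilin K ?T R Q (comp_measuring K C D R Q \<Phi> \<Phi>')"
    by (rule linear_maps_Vect_bilin(1)[OF T m(2) m(6) lm])
  show "z \<in> carrier ?T \<Longrightarrow> comp_measuring K C D R Q \<Phi> \<Phi>' z \<in> extensional (carrier R)"
    by (rule linear_maps_Vect_bilin(2)[OF T m(2) m(6) lm])
  show "x \<in> carrier C \<Longrightarrow> y \<in> carrier D \<Longrightarrow> u \<in> carrier R \<Longrightarrow>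
      comp_measuring K C D R Q \<Phi> \<Phi>' (x \<boxtimes>\<^bsub>?T\<^esub> y) u = \<Phi>' y (\<Phi> x u)"
    by (simp add: comp_measuring_def kpure_closed[OF C] l(2) compose_eq)
qed

lemma hopf_measuring_extensional:
  assumes H: "halg K H" "halg K H'" and m: "hopf_measuring K H H' C \<Psi> \<psi>" and x: "x \<in> carrier C"
  shows "\<Psi> x \<in> extensional (carrier (total_alg H))" "\<psi> x \<in> extensional (carrier (base_alg H))"
  using m x by (auto simp: hopf_measuring_def hopf_V_def linear_maps_def PiE_def)

lemma comp_hopf_measuring:
  fixes C :: "('k, 'c) coalgebra" and D :: "('k, 'd) coalgebra"
  assumes H: "halg K H" "halg K H'" "halg K H''"
    and p: "hpmeas K H H' C \<Phi> \<phi>" and q: "hpmeas K H' H'' D \<Phi>' \<phi>'"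
  shows "hopf_measuring K H H'' (tensor_coalg K C D)
    (comp_measuring K C D (total_alg H) (total_alg H'') \<Phi> \<Phi>')
    (comp_measuring K C D (base_alg H) (base_alg H'') \<phi> \<phi>')"
proof -
  interpret cocoalg_pair K C D using p q by (simp add: hpmeas_def cocoalg_pair_def)
  let ?\<Theta> = "comp_measuring K C D (total_alg H) (total_alg H'') \<Phi> \<Phi>'"
  let ?\<theta> = "comp_measuring K C D (base_alg H) (base_alg H'') \<phi> \<phi>'"
  note b = pmeas_bilin[OF hpmeas_pmeas(1)[OF p]] pmeas_bilin[OF hpmeas_pmeas(1)[OF q]]
    pmeas_bilin[OF hpmeas_pmeas(2)[OF p]] pmeas_bilin[OF hpmeas_pmeas(2)[OF q]]
  note c1 = comp_measuring[OF C.C_module D.C_module b(1,2)] and c2 = comp_measuring[OF C.C_module D.C_module b(3,4)]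
  have "hpmeas K H H'' CD ?\<Theta> ?\<theta>"
    by (rule hpmeas_compose[OF H p q c1(1) c2(1) c1(3) c2(3)])
  \<comment> \<open>\<open>comp_measuring\<close> is already extensional at both levels, so the
    restrictions introduced by \<open>hpmeas_hopf_measuring\<close> change nothing.\<close>
  moreover have "(\<lambda>z\<in>carrier CD. \<lambda>u\<in>carrier (total_alg H). ?\<Theta> z u) = ?\<Theta>"
    "(\<lambda>z\<in>carrier CD. \<lambda>u\<in>carrier (base_alg H). ?\<theta> z u) = ?\<theta>"
    unfolding carrier_CD using c1(2) c2(2)
    by (auto intro!: extensionalityI[where A = "carrier T"] simp: extensional_restrict comp_measuring_def)
  ultimately show ?thesis using hpmeas_hopf_measuring[OF H(1,3)] by fastforce
qed

section \<open>Universal measurings\<close>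

text \<open>Pulling the universal measuring back along \<open>f\<close> gives a test measuring,
  through which \<open>f\<close> and \<open>g\<close> both factor after restriction to the carrier.
  Equations between coalgebra maps into a measuring coalgebra are thereby reduced to equations
  between linear maps.\<close>

lemma universal_measuring_unique:
  fixes C :: "('k, 'c) coalgebra"
  assumes H: "halg K H" "halg K H'" and u: "universal_measuring TYPE('c) K H H' M \<Phi> \<phi>"
    and f: "chom K C M f" and g: "chom K C M g"
    and eq: "\<And>x v. x \<in> carrier C \<Longrightarrow> v \<in> carrier (total_alg H) \<Longrightarrow> \<Phi> (f x) v = \<Phi> (g x) v"
      "\<And>x a. x \<in> carrier C \<Longrightarrow> a \<in> carrier (base_alg H) \<Longrightarrow> \<phi> (f x) a = \<phi> (g x) a"
    and x: "x \<in> carrier C"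
  shows "f x = g x"
proof -
  have m: "hopf_measuring K H H' M \<Phi> \<phi>" using u by (simp add: universal_measuring_def)
  note e = hopf_measuring_extensional[OF H m]
  let ?\<Psi> = "\<lambda>x\<in>carrier C. \<lambda>v\<in>carrier (total_alg H). \<Phi> (f x) v"
  let ?\<psi> = "\<lambda>x\<in>carrier C. \<lambda>a\<in>carrier (base_alg H). \<phi> (f x) a"
  have m': "hopf_measuring K H H' C ?\<Psi> ?\<psi>"
    by (rule hpmeas_hopf_measuring[OF H hpmeas_chom[OF H hopf_measuring_hpmeas[OF H m] f]])
  have f': "(\<lambda>v\<in>carrier (total_alg H). \<Phi> (f x) v) = \<Phi> (f x)" "(\<lambda>a\<in>carrier (base_alg H). \<phi> (f x) a) = \<phi> (f x)"
    if "x \<in> carrier C" for x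
    by (rule extensional_restrict[OF e(1)[OF chom_closed[OF f that]]]
        extensional_restrict[OF e(2)[OF chom_closed[OF f that]]])+
  have g': "\<Phi> (f x) = \<Phi> (g x)" "\<phi> (f x) = \<phi> (g x)" if "x \<in> carrier C" for x
    using extensionalityI[OF e(1)[OF chom_closed[OF f that]] e(1)[OF chom_closed[OF g that]] eq(1)[OF that]]
      extensionalityI[OF e(2)[OF chom_closed[OF f that]] e(2)[OF chom_closed[OF g that]] eq(2)[OF that]] by simp_all
  have 1: "?\<Psi> = compose (carrier C) \<Phi> (restrict f (carrier C))" "?\<psi> = compose (carrier C) \<phi> (restrict f (carrier C))"
    unfolding compose_def by (rule restrict_ext, simp add: f')+
  have 2: "?\<Psi> = compose (carrier C) \<Phi> (restrict g (carrier C))" "?\<psi> = compose (carrier C) \<phi> (restrict g (carrier C))"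
    unfolding compose_def by (rule restrict_ext, simp add: f', simp add: g')+
  have "\<exists>!\<xi>. \<xi> \<in> cocoalg_hom K C M \<and> ?\<Psi> = compose (carrier C) \<Phi> \<xi> \<and> ?\<psi> = compose (carrier C) \<phi> \<xi>"
    using u m' unfolding universal_measuring_def by blast
  then have "restrict f (carrier C) = restrict g (carrier C)"
    using chom_restrict_cocoalg_hom[OF f] chom_restrict_cocoalg_hom[OF g] 1 2 by blast
  then show ?thesis using x by (metis restrict_apply')
qed

text \<open>Unique existence ensures that the definite description denotes a map with the stated
  properties.\<close>

lemma induced_hom:
  fixes C :: "('k, 'c) coalgebra"
  assumes u: "universal_measuring TYPE('c) K H H' M \<Phi> \<phi>" and m: "hopf_measuring K H H' C \<Psi> \<psi>"
  shows "induced_hom K C \<Psi> \<psi> M \<Phi> \<phi> \<in> cocoalg_hom K C M"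
    and "x \<in> carrier C \<Longrightarrow> \<Phi> (induced_hom K C \<Psi> \<psi> M \<Phi> \<phi> x) = \<Psi> x"
    and "x \<in> carrier C \<Longrightarrow> \<phi> (induced_hom K C \<Psi> \<psi> M \<Phi> \<phi> x) = \<psi> x"
proof -
  let ?P = "\<lambda>\<xi>. \<xi> \<in> cocoalg_hom K C M \<and> \<Psi> = compose (carrier C) \<Phi> \<xi> \<and> \<psi> = compose (carrier C) \<phi> \<xi>"
  have "\<exists>!\<xi>. ?P \<xi>" using u m unfolding universal_measuring_def by blast
  from theI'[OF this] have P: "?P (induced_hom K C \<Psi> \<psi> M \<Phi> \<phi>)" unfolding induced_hom_def .
  then show "induced_hom K C \<Psi> \<psi> M \<Phi> \<phi> \<in> cocoalg_hom K C M" by simp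
  show "x \<in> carrier C \<Longrightarrow> \<Phi> (induced_hom K C \<Psi> \<psi> M \<Phi> \<phi> x) = \<Psi> x"
    using fun_cong[OF conjunct1[OF conjunct2[OF P]], of x] by (simp only: compose_eq)
  show "x \<in> carrier C \<Longrightarrow> \<phi> (induced_hom K C \<Psi> \<psi> M \<Phi> \<phi> x) = \<psi> x"
    using fun_cong[OF conjunct2[OF conjunct2[OF P]], of x] by (simp only: compose_eq)
qed

section \<open>The enriched category of Hopf algebroids\<close>

text \<open>Each instance of universality has its task: scalars for the points of hom coalgebras,
  elements of \<open>Mc\<close> for the unit laws, double tensors for the existence of composition,
  triple tensors for associativity.\<close>

locale measuring_system =
  fixes K :: "'k ring"
    and Mc :: "('k, 'u, 'a) hopf_algebroid \<Rightarrow> ('k, 'u, 'a) hopf_algebroid \<Rightarrow> ('k, 'm) coalgebra"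
    and \<Phi> :: "('k, 'u, 'a) hopf_algebroid \<Rightarrow> ('k, 'u, 'a) hopf_algebroid \<Rightarrow> 'm \<Rightarrow> 'u \<Rightarrow> 'u"
    and \<phi> :: "('k, 'u, 'a) hopf_algebroid \<Rightarrow> ('k, 'u, 'a) hopf_algebroid \<Rightarrow> 'm \<Rightarrow> 'a \<Rightarrow> 'a"
  assumes K: "cring K"
    and univ_k: "H \<in> HAlg K \<Longrightarrow> H' \<in> HAlg K \<Longrightarrow>
      universal_measuring TYPE('k) K H H' (Mc H H') (\<Phi> H H') (\<phi> H H')"
    and univ_m: "H \<in> HAlg K \<Longrightarrow> H' \<in> HAlg K \<Longrightarrow>
      universal_measuring TYPE('m) K H H' (Mc H H') (\<Phi> H H') (\<phi> H H')"
    and univ_mm: "H \<in> HAlg K \<Longrightarrow> H' \<in> HAlg K \<Longrightarrow>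
      universal_measuring TYPE(('m, 'm) tensor) K H H' (Mc H H') (\<Phi> H H') (\<phi> H H')"
    and univ_mmm: "H \<in> HAlg K \<Longrightarrow> H' \<in> HAlg K \<Longrightarrow>
      universal_measuring TYPE((('m, 'm) tensor, 'm) tensor) K H H' (Mc H H') (\<Phi> H H') (\<phi> H H')"
begin

abbreviation "ecomp \<equiv> Mc_comp K Mc \<Phi> \<phi>"
abbreviation "point \<equiv> Mc_point K Mc \<Phi> \<phi>"

interpretation K: cring K by (rule K)

section \<open>Morphisms of Hopf algebroids as points of the measuring coalgebra\<close>

context
  fixes X Y :: "('k, 'u, 'a) hopf_algebroid"
  assumes X: "X \<in> HAlg K" and Y: "Y \<in> HAlg K"
begin

lemma measuring: "hopf_measuring K X Y (Mc X Y) (\<Phi> X Y) (\<phi> X Y)"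
  using univ_k[OF X Y] by (simp add: universal_measuring_def)

lemma hpmeas: "hpmeas K X Y (Mc X Y) (\<Phi> X Y) (\<phi> X Y)"
  by (rule hopf_measuring_hpmeas[OF HAlg_halg[OF X] HAlg_halg[OF Y] measuring])

lemma cocoalg_Mc: "cocoalg K (Mc X Y)"
  using hpmeas by (simp add: hpmeas_def)

lemma module_Mc: "module K (Mc X Y)"
  using cocoalg_Mc by (simp add: cocoalg_def coalg.C_module)

lemma bilin_\<Phi>: "bilin K (Mc X Y) (total_alg X) (total_alg Y) (\<Phi> X Y)"
  "bilin K (Mc X Y) (base_alg X) (base_alg Y) (\<phi> X Y)"
  by (rule pmeas_bilin[OF hpmeas_pmeas(1)[OF hpmeas]] pmeas_bilin[OF hpmeas_pmeas(2)[OF hpmeas]])+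

lemma point_hom:
  assumes p: "(F, f) \<in> halg_hom K X Y"
  shows "point X Y (F, f) \<in> cocoalg_hom K (unit_coalg K) (Mc X Y)"
    and "c \<in> carrier K \<Longrightarrow> u \<in> carrier (total_alg X) \<Longrightarrow> \<Phi> X Y (point X Y (F, f) c) u = c \<odot>\<^bsub>total_alg Y\<^esub> F u"
    and "c \<in> carrier K \<Longrightarrow> a \<in> carrier (base_alg X) \<Longrightarrow> \<phi> X Y (point X Y (F, f) c) a = c \<odot>\<^bsub>base_alg Y\<^esub> f a"
proof -
  note h = HAlg_halg[OF X] HAlg_halg[OF Y]
  let ?\<Psi> = "scalar_measuring K (total_alg X) (total_alg Y) F" and ?\<psi> = "scalar_measuring K (base_alg X) (base_alg Y) f"
  have "hpmeas K X Y (unit_coalg K) (\<lambda>c u. c \<odot>\<^bsub>total_alg Y\<^esub> F u) (\<lambda>c a. c \<odot>\<^bsub>base_alg Y\<^esub> f a)"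
    using p by (intro hpmeas_scalar h) (simp add: halg_hom_iff[OF h])
  from hpmeas_hopf_measuring[OF h this] have m: "hopf_measuring K X Y (unit_coalg K) ?\<Psi> ?\<psi>"
    by (simp add: scalar_measuring_def Vect_def carrier_unit[OF K])
  note i = induced_hom[OF univ_k[OF X Y] m]
  show "point X Y (F, f) \<in> cocoalg_hom K (unit_coalg K) (Mc X Y)"
    using i(1) by (simp add: Mc_point_def)
  show "c \<in> carrier K \<Longrightarrow> u \<in> carrier (total_alg X) \<Longrightarrow> \<Phi> X Y (point X Y (F, f) c) u = c \<odot>\<^bsub>total_alg Y\<^esub> F u"
    using i(2)[of c] by (simp add: Mc_point_def carrier_unit[OF K] scalar_measuring_def Vect_def)
  show "c \<in> carrier K \<Longrightarrow> a \<in> carrier (base_alg X) \<Longrightarrow> \<phi> X Y (point X Y (F, f) c) a = c \<odot>\<^bsub>base_alg Y\<^esub> f a"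
    using i(3)[of c] by (simp add: Mc_point_def carrier_unit[OF K] scalar_measuring_def Vect_def)
qed

lemma hom_unit_eq:
  assumes f: "chom K (unit_coalg K) (Mc X Y) f" and c: "c \<in> carrier K"
  shows "f c = c \<odot>\<^bsub>Mc X Y\<^esub> f \<one>\<^bsub>K\<^esub>"
proof -
  have "lin K (ground K) (Mc X Y) f"
    by (rule same_module_lin[OF same_module_sym[OF same_unit[OF K]] same_module_refl chom_lin[OF f]])
  from lin_smult[OF this c, of "\<one>\<^bsub>K\<^esub>"] show ?thesis using c by (simp add: ground_def)
qed

text \<open>Evaluating the measuring of a point at the unit recovers the pair, which gives
  injectivity. Conversely, a coalgebra map out of k sends the unit to a grouplike element; the
  measuring there is a morphism, and its point agrees with the given map by uniqueness.\<close>

lemma point_bij: "bij_betw (point X Y) (halg_hom K X Y) (cocoalg_hom K (unit_coalg K) (Mc X Y))"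
proof (rule bij_betwI')
  note h = HAlg_halg[OF X] HAlg_halg[OF Y]
  interpret X: halg K X by (rule h(1))
  interpret Y: halg K Y by (rule h(2))
  fix p q assume p: "p \<in> halg_hom K X Y" and q: "q \<in> halg_hom K X Y"
  obtain F f G g where pq: "p = (F, f)" "q = (G, g)" by (cases p; cases q)
  note p' = p[unfolded pq] and q' = q[unfolded pq]
  have Fh: "hhom K X Y F f" "hhom K X Y G g"
    and ex: "F \<in> extensional (carrier X.U)" "f \<in> extensional (carrier X.A)"
      "G \<in> extensional (carrier X.U)" "g \<in> extensional (carrier X.A)"
    using p' q' by (simp_all add: halg_hom_iff[OF h])
  show "point X Y p = point X Y q \<longleftrightarrow> p = q"
  proof
    assume eq: "point X Y p = point X Y q"
    have "F u = G u" if "u \<in> carrier X.U" for u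
      using point_hom(2)[OF p' K.one_closed that] point_hom(2)[OF q' K.one_closed that] eq that
        lin_closed[OF hhom_lin(1)[OF Fh(1)] that] lin_closed[OF hhom_lin(1)[OF Fh(2)] that]
      by (simp add: pq)
    moreover have "f a = g a" if "a \<in> carrier X.A" for a
      using point_hom(3)[OF p' K.one_closed that] point_hom(3)[OF q' K.one_closed that] eq that
        lin_closed[OF hhom_lin(2)[OF Fh(1)] that] lin_closed[OF hhom_lin(2)[OF Fh(2)] that]
      by (simp add: pq)
    ultimately show "p = q"
      using extensionalityI[OF ex(1,3)] extensionalityI[OF ex(2,4)] by (simp add: pq)
  qed simp
next
  fix p assume p: "p \<in> halg_hom K X Y"
  obtain F f where "p = (F, f)" by (cases p)
  then show "point X Y p \<in> cocoalg_hom K (unit_coalg K) (Mc X Y)" using point_hom(1) p by simp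
next
  note h = HAlg_halg[OF X] HAlg_halg[OF Y]
  fix \<xi> assume \<xi>: "\<xi> \<in> cocoalg_hom K (unit_coalg K) (Mc X Y)"
  note c = cocoalg_hom_chom[OF \<xi>]
  let ?g = "\<xi> \<one>\<^bsub>K\<^esub>"
  have g: "grouplike K (Mc X Y) ?g" by (rule chom_grouplike[OF c grouplike_unit[OF K]])
  then have gM: "?g \<in> carrier (Mc X Y)" by (simp add: grouplike_def)
  have p: "(\<Phi> X Y ?g, \<phi> X Y ?g) \<in> halg_hom K X Y"
    using grouplike_hhom[OF h hpmeas g] hopf_measuring_extensional[OF h measuring gM]
    by (simp add: halg_hom_iff[OF h])
  note pt = point_hom[OF p]
  have "\<xi> x = point X Y (\<Phi> X Y ?g, \<phi> X Y ?g) x" if x: "x \<in> carrier (unit_coalg K)" for x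
  proof (rule universal_measuring_unique[OF h univ_k[OF X Y] c cocoalg_hom_chom[OF pt(1)] _ _ x])
    fix c' assume "c' \<in> carrier (unit_coalg K)"
    then have c': "c' \<in> carrier K" by (simp add: carrier_unit[OF K])
    show "\<Phi> X Y (\<xi> c') u = \<Phi> X Y (point X Y (\<Phi> X Y ?g, \<phi> X Y ?g) c') u" if u: "u \<in> carrier (total_alg X)" for u
      using lin_smult[OF bilin_lin1[OF bilin_\<Phi>(1) u] c' gM] by (simp add: hom_unit_eq[OF c c'] pt(2)[OF c' u])
    show "\<phi> X Y (\<xi> c') u = \<phi> X Y (point X Y (\<Phi> X Y ?g, \<phi> X Y ?g) c') u" if u: "u \<in> carrier (base_alg X)" for u
      using lin_smult[OF bilin_lin1[OF bilin_\<Phi>(2) u] c' gM] by (simp add: hom_unit_eq[OF c c'] pt(3)[OF c' u])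
  qed
  \<comment> \<open>Both maps are extensional on the carrier of the unit coalgebra, so agreement
    there is equality.\<close>
  then have "\<xi> = point X Y (\<Phi> X Y ?g, \<phi> X Y ?g)"
    using \<xi> pt(1) by (intro extensionalityI[where A = "carrier (unit_coalg K)"])
      (auto simp: cocoalg_hom_def linear_maps_def PiE_def)
  then show "\<exists>p\<in>halg_hom K X Y. \<xi> = point X Y p" using p by blast
qed

end

section \<open>Composition of measuring coalgebras and of points\<close>

context
  fixes X Y Z :: "('k, 'u, 'a) hopf_algebroid"
  assumes X: "X \<in> HAlg K" and Y: "Y \<in> HAlg K" and Z: "Z \<in> HAlg K"
begin

lemma ecomp_hom: "ecomp X Y Z \<in> cocoalg_hom K (tensor_coalg K (Mc X Y) (Mc Y Z)) (Mc X Z)"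
  and ecomp_eval: "x \<in> carrier (Mc X Y) \<Longrightarrow> y \<in> carrier (Mc Y Z) \<Longrightarrow> u \<in> carrier (total_alg X) \<Longrightarrow>
    \<Phi> X Z (ecomp X Y Z (x \<boxtimes>\<^bsub>ktensor K (Mc X Y) (Mc Y Z)\<^esub> y)) u = \<Phi> Y Z y (\<Phi> X Y x u)"
  and ecomp_eval': "x \<in> carrier (Mc X Y) \<Longrightarrow> y \<in> carrier (Mc Y Z) \<Longrightarrow> a \<in> carrier (base_alg X) \<Longrightarrow>
    \<phi> X Z (ecomp X Y Z (x \<boxtimes>\<^bsub>ktensor K (Mc X Y) (Mc Y Z)\<^esub> y)) a = \<phi> Y Z y (\<phi> X Y x a)"
proof -
  note h = HAlg_halg[OF X] HAlg_halg[OF Y] HAlg_halg[OF Z]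
  interpret cocoalg_pair K "Mc X Y" "Mc Y Z"
    by (intro cocoalg_pair.intro cocoalg_Mc X Y Z)
  note m = comp_hopf_measuring[OF h hpmeas[OF X Y] hpmeas[OF Y Z]]
  note i = induced_hom[OF univ_mm[OF X Z] m]
  note ev = comp_measuring(3)[OF module_Mc[OF X Y] module_Mc[OF Y Z] bilin_\<Phi>(1)[OF X Y] bilin_\<Phi>(1)[OF Y Z]]
    comp_measuring(3)[OF module_Mc[OF X Y] module_Mc[OF Y Z] bilin_\<Phi>(2)[OF X Y] bilin_\<Phi>(2)[OF Y Z]]
  show "ecomp X Y Z \<in> cocoalg_hom K CD (Mc X Z)"
    using i(1) by (simp add: Mc_comp_def)
  show "x \<in> carrier (Mc X Y) \<Longrightarrow> y \<in> carrier (Mc Y Z) \<Longrightarrow> u \<in> carrier (total_alg X) \<Longrightarrow>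
    \<Phi> X Z (ecomp X Y Z (x \<boxtimes>\<^bsub>T\<^esub> y)) u = \<Phi> Y Z y (\<Phi> X Y x u)"
    using i(2)[of "x \<boxtimes>\<^bsub>T\<^esub> y"] by (simp add: Mc_comp_def carrier_CD T_closed ev)
  show "x \<in> carrier (Mc X Y) \<Longrightarrow> y \<in> carrier (Mc Y Z) \<Longrightarrow> a \<in> carrier (base_alg X) \<Longrightarrow>
    \<phi> X Z (ecomp X Y Z (x \<boxtimes>\<^bsub>T\<^esub> y)) a = \<phi> Y Z y (\<phi> X Y x a)"
    using i(3)[of "x \<boxtimes>\<^bsub>T\<^esub> y"] by (simp add: Mc_comp_def carrier_CD T_closed ev)
qed

lemma chom_ecomp: "chom K (tensor_coalg K (Mc X Y) (Mc Y Z)) (Mc X Z) (ecomp X Y Z)"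
  by (rule cocoalg_hom_chom[OF ecomp_hom])

lemma lin_ecomp: "lin K (ktensor K (Mc X Y) (Mc Y Z)) (Mc X Z) (ecomp X Y Z)"
proof -
  interpret cocoalg_pair K "Mc X Y" "Mc Y Z"
    by (intro cocoalg_pair.intro cocoalg_Mc X Y Z)
  show ?thesis
    by (rule same_module_lin[OF same_module_sym[OF same_T] same_module_refl chom_lin[OF chom_ecomp]])
qed

lemma ecomp_closed: "x \<in> carrier (Mc X Y) \<Longrightarrow> y \<in> carrier (Mc Y Z) \<Longrightarrow>
    ecomp X Y Z (x \<boxtimes>\<^bsub>ktensor K (Mc X Y) (Mc Y Z)\<^esub> y) \<in> carrier (Mc X Z)"
  by (rule lin_closed[OF lin_ecomp kpure_closed[OF module_Mc[OF X Y] module_Mc[OF Y Z]]])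

lemma point_comp:
  assumes p: "p \<in> halg_hom K X Y" and q: "q \<in> halg_hom K Y Z" and c: "c \<in> carrier K"
  shows "point X Z (halg_comp X Y Z p q) c =
    ecomp X Y Z (tensor_map (ktensor K (ground K) (ground K)) (ktensor K (Mc X Y) (Mc Y Z))
      (point X Y p) (point Y Z q) (c \<boxtimes>\<^bsub>ktensor K (ground K) (ground K)\<^esub> \<one>\<^bsub>K\<^esub>))"
proof -
  note h = HAlg_halg[OF X] HAlg_halg[OF Y] HAlg_halg[OF Z]
  interpret X: halg K X by (rule h(1))
  interpret Y: halg K Y by (rule h(2))
  interpret Z: halg K Z by (rule h(3))
  obtain F f G g where pq: "p = (F, f)" "q = (G, g)" by (cases p; cases q)
  note p' = p[unfolded pq(1)] and q' = q[unfolded pq(2)]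
  let ?GF = "compose (carrier X.U) G F" and ?gf = "compose (carrier X.A) g f"
  have r: "(?GF, ?gf) \<in> halg_hom K X Z"
  proof -
    have "halg_comp X Y Z p q \<in> halg_hom K X Z"
      using category_HAlg[of K] X Y Z p q unfolding category_def by blast
    then show ?thesis by (simp add: halg_comp_def pq)
  qed
  have Fh: "hhom K X Y F f" "hhom K Y Z G g" using p' q' by (simp_all add: halg_hom_iff h)
  note F = hhom_lin[OF Fh(1)] and G = hhom_lin[OF Fh(2)]
  let ?f = "point X Y (F, f)" and ?g = "point Y Z (G, g)"
  note f = cocoalg_hom_chom[OF point_hom(1)[OF X Y p']] and g = cocoalg_hom_chom[OF point_hom(1)[OF Y Z q']]
  \<comment> \<open>The right-hand side with its second factor frozen at the grouplike element
    \<open>?g\<close> of the unit. In this form it is a coalgebra map out of k, so it can be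
    compared with a point by the universal property over the scalars.\<close>
  let ?e = "\<lambda>c. ecomp X Y Z (?f c \<boxtimes>\<^bsub>ktensor K (Mc X Y) (Mc Y Z)\<^esub> ?g \<one>\<^bsub>K\<^esub>)"
  have e: "chom K (unit_coalg K) (Mc X Z) ?e"
    by (rule chom_compose[OF f chom_compose[OF chom_tensor_grouplike[OF
            chom_grouplike[OF g grouplike_unit[OF K]] cocoalg_Mc[OF X Y]] chom_ecomp]])
  have cf: "?f c \<in> carrier (Mc X Y)" "?g c \<in> carrier (Mc Y Z)" if "c \<in> carrier K" for c
    using chom_closed[OF f] chom_closed[OF g] that by (simp_all add: carrier_unit[OF K])
  have "point X Z (?GF, ?gf) c = ?e c"
  proof (rule universal_measuring_unique[OF h(1,3) univ_k[OF X Z] cocoalg_hom_chom[OF point_hom(1)[OF X Z r]] e])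
    fix d assume "d \<in> carrier (unit_coalg K)"
    then have d: "d \<in> carrier K" by (simp add: carrier_unit[OF K])
    { fix u assume u: "u \<in> carrier X.U"
      have "\<Phi> X Z (?e d) u = \<one>\<^bsub>K\<^esub> \<odot>\<^bsub>total_alg Z\<^esub> G (d \<odot>\<^bsub>Y.U\<^esub> F u)"
        using d u lin_closed[OF F(1) u]
        by (simp add: ecomp_eval cf point_hom(2)[OF X Y p'] point_hom(2)[OF Y Z q'])
      also have "\<dots> = d \<odot>\<^bsub>total_alg Z\<^esub> G (F u)"
        using d lin_closed[OF G(1) lin_closed[OF F(1) u]] lin_smult[OF G(1) d lin_closed[OF F(1) u]] by simp
      finally show "\<Phi> X Z (point X Z (?GF, ?gf) d) u = \<Phi> X Z (?e d) u"
        using d u by (simp add: point_hom(2)[OF X Z r] compose_eq) }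
    { fix u assume u: "u \<in> carrier X.A"
      have "\<phi> X Z (?e d) u = \<one>\<^bsub>K\<^esub> \<odot>\<^bsub>base_alg Z\<^esub> g (d \<odot>\<^bsub>Y.A\<^esub> f u)"
        using d u lin_closed[OF F(2) u]
        by (simp add: ecomp_eval' cf point_hom(3)[OF X Y p'] point_hom(3)[OF Y Z q'])
      also have "\<dots> = d \<odot>\<^bsub>base_alg Z\<^esub> g (f u)"
        using d lin_closed[OF G(2) lin_closed[OF F(2) u]] lin_smult[OF G(2) d lin_closed[OF F(2) u]] by simp
      finally show "\<phi> X Z (point X Z (?GF, ?gf) d) u = \<phi> X Z (?e d) u"
        using d u by (simp add: point_hom(3)[OF X Z r] compose_eq) }
  qed (use c in \<open>simp add: carrier_unit[OF K]\<close>)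
  moreover have "lin K (ground K) (Mc X Y) ?f" "lin K (ground K) (Mc Y Z) ?g"
    by (rule same_module_lin[OF same_module_sym[OF same_unit[OF K]] same_module_refl chom_lin[OF f]]
        same_module_lin[OF same_module_sym[OF same_unit[OF K]] same_module_refl chom_lin[OF g]])+
  from tensor_map_pure[OF this, of c "\<one>\<^bsub>K\<^esub>"] c
  have "tensor_map (ktensor K (ground K) (ground K)) (ktensor K (Mc X Y) (Mc Y Z)) ?f ?g
      (c \<boxtimes>\<^bsub>ktensor K (ground K) (ground K)\<^esub> \<one>\<^bsub>K\<^esub>) = ?f c \<boxtimes>\<^bsub>ktensor K (Mc X Y) (Mc Y Z)\<^esub> ?g \<one>\<^bsub>K\<^esub>"
    by (simp add: ground_def)
  ultimately show ?thesis by (simp add: pq halg_comp_def)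
qed

end

text \<open>Both sides are coalgebra maps out of the triple tensor coalgebra. On pure tensors the
  measurings they induce apply the maps of \<open>x\<close>, \<open>y\<close> and \<open>z\<close>
  in succession, so they agree; linearity extends this to all tensors, and uniqueness gives the
  claim.\<close>

lemma ecomp_assoc:
  assumes W: "W \<in> HAlg K" and X: "X \<in> HAlg K" and Y: "Y \<in> HAlg K" and Z: "Z \<in> HAlg K"
    and t: "t \<in> carrier (ktensor K (ktensor K (Mc W X) (Mc X Y)) (Mc Y Z))"
  shows "ecomp W Y Z (tensor_map (ktensor K (ktensor K (Mc W X) (Mc X Y)) (Mc Y Z)) (ktensor K (Mc W Y) (Mc Y Z))
           (ecomp W X Y) id t) =
         ecomp W X Z (tensor_map (ktensor K (Mc W X) (ktensor K (Mc X Y) (Mc Y Z))) (ktensor K (Mc W X) (Mc X Z))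
           id (ecomp X Y Z)
           (tensor_assoc (ktensor K (Mc W X) (ktensor K (Mc X Y) (Mc Y Z))) (ktensor K (Mc X Y) (Mc Y Z)) t))"
proof -
  note h = HAlg_halg[OF W] HAlg_halg[OF X] HAlg_halg[OF Y] HAlg_halg[OF Z]
  interpret cocoalg_triple K "Mc W X" "Mc X Y" "Mc Y Z"
    by (intro cocoalg_triple.intro cocoalg_Mc W X Y Z)
  have id: "id = (\<lambda>x. x)" by (simp add: fun_eq_iff)
  note cl = chom_tensor_map[OF chom_ecomp[OF W X Y] chom_id[OF cocoalg_Mc[OF Y Z]]]
  note cr = chom_tensor_map[OF chom_id[OF cocoalg_Mc[OF W X]] chom_ecomp[OF X Y Z]]
  let ?l = "\<lambda>t. ecomp W Y Z (tensor_map L.T (ktensor K (Mc W Y) (Mc Y Z)) (ecomp W X Y) (\<lambda>x. x) t)"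
  let ?r = "\<lambda>t. ecomp W X Z (tensor_map R.T (ktensor K (Mc W X) (Mc X Z)) (\<lambda>x. x) (ecomp X Y Z)
      (tensor_assoc R3 DE.T t))"
  have l: "chom K L.CD (Mc W Z) ?l" by (rule chom_compose[OF cl(1) chom_ecomp[OF W Y Z]])
  have r: "chom K L.CD (Mc W Z) ?r"
    by (rule chom_compose[OF chom_assoc chom_compose[OF cr(1) chom_ecomp[OF W X Z]]])
  have lin: "lin K L3 (Mc W Z) f" if "chom K L.CD (Mc W Z) f" for f
    unfolding L_T[symmetric]
    by (rule same_module_lin[OF same_module_sym[OF L.same_T] same_module_refl chom_lin[OF that]])
  note ext = ktensor3_lin_ext[OF module_Mc[OF W X] module_Mc[OF X Y] module_Mc[OF Y Z]]
  have pure: "?l ((x \<boxtimes>\<^bsub>CD.T\<^esub> y) \<boxtimes>\<^bsub>L3\<^esub> z) = ecomp W Y Z (ecomp W X Y (x \<boxtimes>\<^bsub>CD.T\<^esub> y) \<boxtimes>\<^bsub>ktensor K (Mc W Y) (Mc Y Z)\<^esub> z)"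
    "?r ((x \<boxtimes>\<^bsub>CD.T\<^esub> y) \<boxtimes>\<^bsub>L3\<^esub> z) = ecomp W X Z (x \<boxtimes>\<^bsub>ktensor K (Mc W X) (Mc X Z)\<^esub> ecomp X Y Z (y \<boxtimes>\<^bsub>DE.T\<^esub> z))"
    if "x \<in> carrier (Mc W X)" "y \<in> carrier (Mc X Y)" "z \<in> carrier (Mc Y Z)" for x y z
    using that by (simp_all add: assoc_pure cl(2) cr(2) CD.T_closed DE.T_closed CD.carrier_CD DE.carrier_CD flip: L_T)
  have "?l t = ?r t"
  proof (rule universal_measuring_unique[OF h(1,4) univ_mmm[OF W Z] l r])
    show "t \<in> carrier L.CD" using t by (simp add: L.carrier_CD L_T)
  next
    fix s assume "s \<in> carrier L.CD"
    then have s: "s \<in> carrier L3" by (simp add: L.carrier_CD L_T)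
    show "\<Phi> W Z (?l s) u = \<Phi> W Z (?r s) u" if u: "u \<in> carrier (total_alg W)" for u
    proof (rule ext[OF lin_compose[OF lin[OF l] bilin_lin1[OF bilin_\<Phi>(1)[OF W Z] u]]
          lin_compose[OF lin[OF r] bilin_lin1[OF bilin_\<Phi>(1)[OF W Z] u]] s])
      fix x y z assume xyz: "x \<in> carrier (Mc W X)" "y \<in> carrier (Mc X Y)" "z \<in> carrier (Mc Y Z)"
      show "\<Phi> W Z (?l ((x \<boxtimes>\<^bsub>CD.T\<^esub> y) \<boxtimes>\<^bsub>L3\<^esub> z)) u = \<Phi> W Z (?r ((x \<boxtimes>\<^bsub>CD.T\<^esub> y) \<boxtimes>\<^bsub>L3\<^esub> z)) u"
        unfolding pure[OF xyz] using xyz u bilin_closed[OF bilin_\<Phi>(1)[OF W X] xyz(1) u]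
        by (simp add: ecomp_eval ecomp_closed W X Y Z)
    qed
    show "\<phi> W Z (?l s) u = \<phi> W Z (?r s) u" if u: "u \<in> carrier (base_alg W)" for u
    proof (rule ext[OF lin_compose[OF lin[OF l] bilin_lin1[OF bilin_\<Phi>(2)[OF W Z] u]]
          lin_compose[OF lin[OF r] bilin_lin1[OF bilin_\<Phi>(2)[OF W Z] u]] s])
      fix x y z assume xyz: "x \<in> carrier (Mc W X)" "y \<in> carrier (Mc X Y)" "z \<in> carrier (Mc Y Z)"
      show "\<phi> W Z (?l ((x \<boxtimes>\<^bsub>CD.T\<^esub> y) \<boxtimes>\<^bsub>L3\<^esub> z)) u = \<phi> W Z (?r ((x \<boxtimes>\<^bsub>CD.T\<^esub> y) \<boxtimes>\<^bsub>L3\<^esub> z)) u"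
        unfolding pure[OF xyz] using xyz u bilin_closed[OF bilin_\<Phi>(2)[OF W X] xyz(1) u]
        by (simp add: ecomp_eval' ecomp_closed W X Y Z)
    qed
  qed
  then show ?thesis unfolding id L_T R_T .
qed

section \<open>Unit laws of the enrichment\<close>

lemma id_hom: "X \<in> HAlg K \<Longrightarrow> halg_id X \<in> halg_hom K X X"
  using category_HAlg[of K] unfolding category_def by blast

text \<open>The unit laws are tested on \<open>Mc X Y\<close> itself, since the universal property is not assumed for
  the type of \<open>k \<otimes> Mc X Y\<close>: for the grouplike element \<open>g\<close> given by the unit, the map \<open>x \<mapsto> ecomp (g \<otimes> x)\<close>
  is an endomorphism inducing the same measuring as the identity.\<close>

lemma ecomp_unit_one:
  assumes X: "X \<in> HAlg K" and Y: "Y \<in> HAlg K" and x: "x \<in> carrier (Mc X Y)"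
  shows "ecomp X X Y (point X X (halg_id X) \<one>\<^bsub>K\<^esub> \<boxtimes>\<^bsub>ktensor K (Mc X X) (Mc X Y)\<^esub> x) = x"
    and "ecomp X Y Y (x \<boxtimes>\<^bsub>ktensor K (Mc X Y) (Mc Y Y)\<^esub> point Y Y (halg_id Y) \<one>\<^bsub>K\<^esub>) = x"
proof -
  note h = HAlg_halg[OF X] HAlg_halg[OF Y]
  interpret X: halg K X by (rule h(1))
  interpret Y: halg K Y by (rule h(2))
  let ?g = "point X X (halg_id X) \<one>\<^bsub>K\<^esub>" and ?h = "point Y Y (halg_id Y) \<one>\<^bsub>K\<^esub>"
  note iX = id_hom[OF X, unfolded halg_id_def] and iY = id_hom[OF Y, unfolded halg_id_def]
  have g: "grouplike K (Mc X X) ?g" "grouplike K (Mc Y Y) ?h"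
    unfolding halg_id_def
    by (rule chom_grouplike[OF cocoalg_hom_chom[OF point_hom(1)[OF X X iX]] grouplike_unit[OF K]]
        chom_grouplike[OF cocoalg_hom_chom[OF point_hom(1)[OF Y Y iY]] grouplike_unit[OF K]])+
  have gc: "?g \<in> carrier (Mc X X)" "?h \<in> carrier (Mc Y Y)" using g by (simp_all add: grouplike_def)
  have ev: "\<Phi> X X ?g u = u" if "u \<in> carrier X.U" for u
    using that by (simp add: halg_id_def point_hom(2)[OF X X iX])
  have ev': "\<phi> X X ?g u = u" if "u \<in> carrier X.A" for u
    using that by (simp add: halg_id_def point_hom(3)[OF X X iX])
  have ew: "\<Phi> Y Y ?h u = u" if "u \<in> carrier Y.U" for u
    using that by (simp add: halg_id_def point_hom(2)[OF Y Y iY])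
  have ew': "\<phi> Y Y ?h u = u" if "u \<in> carrier Y.A" for u
    using that by (simp add: halg_id_def point_hom(3)[OF Y Y iY])
  note M = cocoalg_Mc[OF X Y]
  note b = bilin_closed[OF bilin_\<Phi>(1)[OF X Y]] bilin_closed[OF bilin_\<Phi>(2)[OF X Y]]
  have c1: "chom K (Mc X Y) (Mc X Y) (\<lambda>x. ecomp X X Y (?g \<boxtimes>\<^bsub>ktensor K (Mc X X) (Mc X Y)\<^esub> x))"
    by (rule chom_compose[OF chom_grouplike_tensor[OF g(1) M] chom_ecomp[OF X X Y]])
  have c2: "chom K (Mc X Y) (Mc X Y) (\<lambda>x. ecomp X Y Y (x \<boxtimes>\<^bsub>ktensor K (Mc X Y) (Mc Y Y)\<^esub> ?h))"
    by (rule chom_compose[OF chom_tensor_grouplike[OF g(2) M] chom_ecomp[OF X Y Y]])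
  show "ecomp X X Y (?g \<boxtimes>\<^bsub>ktensor K (Mc X X) (Mc X Y)\<^esub> x) = x"
    by (rule universal_measuring_unique[OF h univ_m[OF X Y] c1 chom_id[OF M] _ _ x])
       (simp_all add: ecomp_eval[OF X X Y] ecomp_eval'[OF X X Y] gc ev ev')
  show "ecomp X Y Y (x \<boxtimes>\<^bsub>ktensor K (Mc X Y) (Mc Y Y)\<^esub> ?h) = x"
    by (rule universal_measuring_unique[OF h univ_m[OF X Y] c2 chom_id[OF M] _ _ x])
       (simp_all add: ecomp_eval[OF X Y Y] ecomp_eval'[OF X Y Y] gc ew ew' b)
qed

lemma bilin_scalar:
  assumes V: "module K V"
  shows "bilin K (ground K) V V (\<lambda>c x. c \<odot>\<^bsub>V\<^esub> x)"
proof -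
  interpret V: module K V by fact
  show ?thesis
    by (intro bilinI linI ground_module K V)
       (simp_all add: ground_def V.smult_l_distr V.smult_r_distr V.smult_assoc1 K.m_comm flip: V.smult_assoc1)
qed

text \<open>Both sides are linear in the tensor. On a pure tensor the scalar is extracted from the
  unit by \<open>hom_unit_eq\<close> and leaves the composition by linearity, which leaves the case
  of the scalar unit, settled in \<open>ecomp_unit_one\<close>.\<close>

lemma ecomp_unit:
  assumes X: "X \<in> HAlg K" and Y: "Y \<in> HAlg K"
  shows "t \<in> carrier (ktensor K (ground K) (Mc X Y)) \<Longrightarrow>
      ecomp X X Y (tensor_map (ktensor K (ground K) (Mc X Y)) (ktensor K (Mc X X) (Mc X Y)) (point X X (halg_id X)) id t) =
      tsum (Mc X Y) t (\<lambda>c x. c \<odot>\<^bsub>Mc X Y\<^esub> x)"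
    and "t' \<in> carrier (ktensor K (Mc X Y) (ground K)) \<Longrightarrow>
      ecomp X Y Y (tensor_map (ktensor K (Mc X Y) (ground K)) (ktensor K (Mc X Y) (Mc Y Y)) id (point Y Y (halg_id Y)) t') =
      tsum (Mc X Y) t' (\<lambda>x c. c \<odot>\<^bsub>Mc X Y\<^esub> x)"
proof -
  have id: "id = (\<lambda>x. x)" by (simp add: fun_eq_iff)
  note M = module_Mc[OF X Y] and g = ground_module[OF K]
  note b = bilin_scalar[OF M]
  note iX = id_hom[OF X, unfolded halg_id_def] and iY = id_hom[OF Y, unfolded halg_id_def]
  let ?f = "point X X (halg_id X)" and ?h = "point Y Y (halg_id Y)"
  have cf: "chom K (unit_coalg K) (Mc X X) ?f" "chom K (unit_coalg K) (Mc Y Y) ?h"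
    unfolding halg_id_def
    by (rule cocoalg_hom_chom[OF point_hom(1)[OF X X iX]] cocoalg_hom_chom[OF point_hom(1)[OF Y Y iY]])+
  have lf: "lin K (ground K) (Mc X X) ?f" "lin K (ground K) (Mc Y Y) ?h"
    by (rule same_module_lin[OF same_module_sym[OF same_unit[OF K]] same_module_refl chom_lin[OF cf(1)]]
        same_module_lin[OF same_module_sym[OF same_unit[OF K]] same_module_refl chom_lin[OF cf(2)]])+
  have o: "?f \<one>\<^bsub>K\<^esub> \<in> carrier (Mc X X)" "?h \<one>\<^bsub>K\<^esub> \<in> carrier (Mc Y Y)"
    using chom_closed[OF cf(1)] chom_closed[OF cf(2)] by (simp_all add: carrier_unit[OF K])
  note tl = lin_tensor_map[OF lf(1) lin_id[OF M]] and tr = lin_tensor_map[OF lin_id[OF M] lf(2)]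
  { assume t: "t \<in> carrier (ktensor K (ground K) (Mc X Y))"
    have "ecomp X X Y (tensor_map (ktensor K (ground K) (Mc X Y)) (ktensor K (Mc X X) (Mc X Y)) ?f (\<lambda>x. x) t) =
      tsum (Mc X Y) t (\<lambda>c x. c \<odot>\<^bsub>Mc X Y\<^esub> x)"
    proof (rule ktensor_lin_ext[OF g M lin_compose[OF tl(1) lin_ecomp[OF X X Y]] lin_ktsum(1)[OF b] _ t])
      fix c x assume c: "c \<in> carrier (ground K)" and x: "x \<in> carrier (Mc X Y)"
      then have c': "c \<in> carrier K" by (simp add: ground_def)
      have "ecomp X X Y (?f c \<boxtimes>\<^bsub>ktensor K (Mc X X) (Mc X Y)\<^esub> x) = c \<odot>\<^bsub>Mc X Y\<^esub> x"
        using lin_smult[OF lin_compose[OF bilin_lin1[OF bilin_kpure[OF module_Mc[OF X X] M] x] lin_ecomp[OF X X Y]] c' o(1)]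
        by (simp add: hom_unit_eq[OF X X cf(1) c'] ecomp_unit_one(1)[OF X Y x])
      then show "ecomp X X Y (tensor_map (ktensor K (ground K) (Mc X Y)) (ktensor K (Mc X X) (Mc X Y)) ?f (\<lambda>x. x)
          (c \<boxtimes>\<^bsub>ktensor K (ground K) (Mc X Y)\<^esub> x)) =
        tsum (Mc X Y) (c \<boxtimes>\<^bsub>ktensor K (ground K) (Mc X Y)\<^esub> x) (\<lambda>c x. c \<odot>\<^bsub>Mc X Y\<^esub> x)"
        by (simp add: tl(2)[OF c x] lin_ktsum(2)[OF b c x])
    qed
    then show "ecomp X X Y (tensor_map (ktensor K (ground K) (Mc X Y)) (ktensor K (Mc X X) (Mc X Y)) ?f id t) =
      tsum (Mc X Y) t (\<lambda>c x. c \<odot>\<^bsub>Mc X Y\<^esub> x)" unfolding id . }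
  { assume t: "t' \<in> carrier (ktensor K (Mc X Y) (ground K))"
    have "ecomp X Y Y (tensor_map (ktensor K (Mc X Y) (ground K)) (ktensor K (Mc X Y) (Mc Y Y)) (\<lambda>x. x) ?h t') =
      tsum (Mc X Y) t' (\<lambda>x c. c \<odot>\<^bsub>Mc X Y\<^esub> x)"
    proof (rule ktensor_lin_ext[OF M g lin_compose[OF tr(1) lin_ecomp[OF X Y Y]] lin_ktsum(1)[OF bilin_swap[OF b]] _ t])
      fix c x assume c: "c \<in> carrier (ground K)" and x: "x \<in> carrier (Mc X Y)"
      then have c': "c \<in> carrier K" by (simp add: ground_def)
      have "ecomp X Y Y (x \<boxtimes>\<^bsub>ktensor K (Mc X Y) (Mc Y Y)\<^esub> ?h c) = c \<odot>\<^bsub>Mc X Y\<^esub> x"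
        using lin_smult[OF lin_compose[OF bilin_lin2[OF bilin_kpure[OF M module_Mc[OF Y Y]] x] lin_ecomp[OF X Y Y]] c' o(2)]
        by (simp add: hom_unit_eq[OF Y Y cf(2) c'] ecomp_unit_one(2)[OF X Y x])
      then show "ecomp X Y Y (tensor_map (ktensor K (Mc X Y) (ground K)) (ktensor K (Mc X Y) (Mc Y Y)) (\<lambda>x. x) ?h
          (x \<boxtimes>\<^bsub>ktensor K (Mc X Y) (ground K)\<^esub> c)) =
        tsum (Mc X Y) (x \<boxtimes>\<^bsub>ktensor K (Mc X Y) (ground K)\<^esub> c) (\<lambda>x c. c \<odot>\<^bsub>Mc X Y\<^esub> x)"
        by (simp add: tr(2)[OF x c] lin_ktsum(2)[OF bilin_swap[OF b] x c])
    qed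
    then show "ecomp X Y Y (tensor_map (ktensor K (Mc X Y) (ground K)) (ktensor K (Mc X Y) (Mc Y Y)) id ?h t') =
      tsum (Mc X Y) t' (\<lambda>x c. c \<odot>\<^bsub>Mc X Y\<^esub> x)" unfolding id . }
qed

section \<open>The enriched category and its underlying category\<close>

lemma enriched: "cocoalg_enriched_category K (HAlg K) Mc ecomp (Mc_unit K Mc \<Phi> \<phi>)"
proof -
  have "point X X (halg_id X) \<in> cocoalg_hom K (unit_coalg K) (Mc X X)" if "X \<in> HAlg K" for X
    using point_hom(1)[OF that that] id_hom[OF that] by (simp add: halg_id_def)
  then show ?thesis
    unfolding cocoalg_enriched_category_def Let_def Mc_unit_def
    by (simp add: cocoalg.cocoalgebra[OF cocoalg_Mc] ecomp_hom ecomp_assoc ecomp_unit)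
qed

end

theorem theorem2p7:
  fixes K :: "'k ring"
    and Mc :: "('k, 'u, 'a) hopf_algebroid \<Rightarrow> ('k, 'u, 'a) hopf_algebroid \<Rightarrow> ('k, 'm) coalgebra"
    and \<Phi> :: "('k, 'u, 'a) hopf_algebroid \<Rightarrow> ('k, 'u, 'a) hopf_algebroid \<Rightarrow> 'm \<Rightarrow> 'u \<Rightarrow> 'u"
    and \<phi> :: "('k, 'u, 'a) hopf_algebroid \<Rightarrow> ('k, 'u, 'a) hopf_algebroid \<Rightarrow> 'm \<Rightarrow> 'a \<Rightarrow> 'a"
  assumes "field K"
    and "\<And>H H'. H \<in> HAlg K \<Longrightarrow> H' \<in> HAlg K \<Longrightarrow>
           universal_measuring TYPE('k) K H H' (Mc H H') (\<Phi> H H') (\<phi> H H') \<and>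
           universal_measuring TYPE('m) K H H' (Mc H H') (\<Phi> H H') (\<phi> H H') \<and>
           universal_measuring TYPE(('m, 'm) tensor) K H H' (Mc H H') (\<Phi> H H') (\<phi> H H') \<and>
           universal_measuring TYPE((('m, 'm) tensor, 'm) tensor) K H H'
             (Mc H H') (\<Phi> H H') (\<phi> H H')"
  shows "enriches_category K (HAlg K :: ('k, 'u, 'a) hopf_algebroid set)
           (halg_hom K) halg_comp halg_id
           Mc (Mc_comp K Mc \<Phi> \<phi>) (Mc_unit K Mc \<Phi> \<phi>) (Mc_point K Mc \<Phi> \<phi>)"
proof -
  interpret measuring_system K Mc \<Phi> \<phi>
    by (rule measuring_system.intro[OF fieldE(1)[OF assms(1)]]) (simp_all add: assms(2))
  show ?thesis
    unfolding enriches_category_def Let_def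
    by (simp add: category_HAlg enriched point_bij point_comp Mc_unit_def)
qed

end
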